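(* Let $X,(X_{it})_{i,t\ge 1}$ be iid real random variables with $\mathbb{E}[X]=0$, $\mathbb{E}[X^2]=1$ and $\mathbb{E}[X^4]<\infty$, and let $p=p_n$ be a sequence of positive integers with $p_n\to\infty$ as $n\to\infty$. Let $\mathbf{S}=\mathbf{S}_n=(S_{ij})_{1\le i,j\le p}$ with $S_{ij}=\frac1n\sum_{t=1}^n X_{it}X_{jt}$, and set $$Z_n:=\frac{\operatorname{tr}(\mathbf{S}^2)-\mu_n}{\sigma_n},$$ where $$\sigma_n^2:=\Big(\frac{p}{n}+2\frac{p^2}{n^2}+\frac{p^3}{n^3}\Big)4(\mathbb{E}[X^4]-1)+4\frac{p^2}{n^2},\qquad \mu_n:=\mathbb{E}[\operatorname{tr}(\mathbf{S}^2)]=\frac{p}{n}(n+\mathbb{E}[X^4]-2)+\frac{p^2}{n}.$$ Then, as $n\to\infty$, $Z_n$ converges in distribution to a standard normal random variable $Z$.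
   Context: $\mathbf{S}=\frac1n\sum_{t=1}^n \mathbf{x}_t\mathbf{x}_t^\top$ is the sample covariance matrix of the observations $\mathbf{x}_t=(X_{1t},\ldots,X_{pt})^\top$, $t=1,\ldots,n$, and $\operatorname{tr}(\mathbf{S}^2)=\sum_{i,j=1}^p S_{ij}^2$ is its squared Frobenius norm. $\sigma_n>0$ denotes the positive square root of $\sigma_n^2$. *)

theory Defs
  imports "HOL-Probability.Probability" "Jordan_Normal_Form.Matrix"
begin

definition mat_trace :: "'b::comm_monoid_add mat \<Rightarrow> 'b" where
  "mat_trace A = (\<Sum>i<dim_row A. A $$ (i, i))"

(* X i t is the i-th coordinate of the t-th observation, with i, t starting at 1, whereas
   matrix entries are numbered from 0; hence the shift of the row and column index. *)
definition sample_cov :: "(nat \<Rightarrow> nat \<Rightarrow> 'a \<Rightarrow> real) \<Rightarrow> nat \<Rightarrow> nat \<Rightarrow> 'a \<Rightarrow> real mat" where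
  "sample_cov X p n \<omega> =
     mat p p (\<lambda>(i, j). 1 / real n * (\<Sum>t = 1..n. X (Suc i) t \<omega> * X (Suc j) t \<omega>))"

definition tr_S_sq :: "(nat \<Rightarrow> nat \<Rightarrow> 'a \<Rightarrow> real) \<Rightarrow> nat \<Rightarrow> nat \<Rightarrow> 'a \<Rightarrow> real" where
  "tr_S_sq X p n \<omega> = mat_trace (sample_cov X p n \<omega> ^\<^sub>m 2)"

definition mu_S :: "'a measure \<Rightarrow> (nat \<Rightarrow> nat \<Rightarrow> 'a \<Rightarrow> real) \<Rightarrow> nat \<Rightarrow> nat \<Rightarrow> real" where
  "mu_S M X p n = (\<integral>\<omega>. tr_S_sq X p n \<omega> \<partial>M)"

(* m4 stands for the fourth moment of the entries. *)
definition sigma_sq :: "real \<Rightarrow> nat \<Rightarrow> nat \<Rightarrow> real" where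
  "sigma_sq m4 p n =
     (real p / real n + 2 * (real p ^ 2 / real n ^ 2) + real p ^ 3 / real n ^ 3) * (4 * (m4 - 1))
       + 4 * (real p ^ 2 / real n ^ 2)"

definition Z_stat ::
  "'a measure \<Rightarrow> real \<Rightarrow> (nat \<Rightarrow> nat \<Rightarrow> 'a \<Rightarrow> real) \<Rightarrow> nat \<Rightarrow> nat \<Rightarrow> 'a \<Rightarrow> real" where
  "Z_stat M m4 X p n \<omega> = (tr_S_sq X p n \<omega> - mu_S M X p n) / sqrt (sigma_sq m4 p n)"

lemma tr_S_sq_eq_Frobenius:
  "tr_S_sq X p n \<omega> = (\<Sum>i<p. \<Sum>j<p. (sample_cov X p n \<omega> $$ (i, j))\<^sup>2)"
proof -
  let ?S = "sample_cov X p n \<omega>"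
  have S: "?S \<in> carrier_mat p p" by (simp add: sample_cov_def)
  have sym: "?S $$ (i, j) = ?S $$ (j, i)" if "i < p" "j < p" for i j
    using that by (simp add: sample_cov_def mult.commute)
  have "?S ^\<^sub>m 2 = ?S * ?S"
    using S by (simp add: numeral_2_eq_2)
  then have "tr_S_sq X p n \<omega> = (\<Sum>i<p. \<Sum>j<p. ?S $$ (i, j) * ?S $$ (j, i))"
    using S by (auto simp: tr_S_sq_def mat_trace_def scalar_prod_def atLeast0LessThan
        intro!: sum.cong)
  also have "\<dots> = (\<Sum>i<p. \<Sum>j<p. (?S $$ (i, j))\<^sup>2)"
    by (intro sum.cong refl) (metis sym power2_eq_square lessThan_iff)
  finally show ?thesis .
qed

end

theory Submission
  imports Defs "HOL-Real_Asymp.Real_Asymp"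
begin

text \<open>
Write \<open>Y\<^sub>i\<^sub>t = X\<^sub>i\<^sub>t\<^sup>2 - 1\<close>, so that \<open>Y\<^sub>i\<^sub>t\<close> is centred with variance \<open>v = E[X\<^sup>4] - 1\<close>. Multiplying out
\<open>n\<^sup>2 tr(S\<^sup>2) = \<Sum>\<^sub>i\<^sub>,\<^sub>j (\<Sum>\<^sub>t X\<^sub>i\<^sub>t X\<^sub>j\<^sub>t)\<^sup>2\<close> and substituting \<open>X\<^sup>2 = 1 + Y\<close> gives
(\<open>trace_decomposition\<close>)
\<open>n\<^sup>2 (tr(S\<^sup>2) - \<mu>) = \<Sum> (X\<^sub>i\<^sub>t\<^sup>4 - E[X\<^sup>4]) + 2 (n + p - 2) \<Sum> Y\<^sub>i\<^sub>t + 2 R + 2 C + 4 Q\<close>,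
where \<open>R\<close> and \<open>C\<close> sum \<open>Y Y'\<close> over pairs of entries in a common row or column, and
\<open>Q = \<Sum>\<^sub>i\<^sub><\<^sub>j \<Sum>\<^sub>s\<^sub><\<^sub>t X\<^sub>i\<^sub>s X\<^sub>j\<^sub>s X\<^sub>i\<^sub>t X\<^sub>j\<^sub>t\<close>. The summands of each of the last four sums are uncorrelated, so their
variances can be read off. The linear sum contributes \<open>4 v p (n + p - 2)\<^sup>2 / n\<^sup>3\<close> and the sum \<open>Q\<close>
contributes \<open>4 p (p - 1) n (n - 1) / n\<^sup>4\<close>, which together are \<open>\<sigma>\<^sup>2\<close> to leading order, however \<open>p\<close> compares to
\<open>n\<close>. The sums \<open>R\<close> and \<open>C\<close> are of smaller order because \<open>\<sigma> \<ge> 2 p / n\<close>. The fourth powers have infinite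
variance in general, but the average of the centred ones tends to \<open>0\<close> in \<open>L\<^sup>1\<close> by truncation, which is enough for the same reason.

It remains to find the limit law of \<open>W = a \<Sum> f(X\<^sub>i\<^sub>t) + b Q\<close>, where \<open>f(X)\<close> is a centred bounded truncation of
\<open>Y\<close> at a level that grows slowly with \<open>n\<close>. Adding the observations one at a time writes \<open>W\<close> as a sum of
increments \<open>D\<^sub>t\<close> with conditional mean \<open>0\<close> given the earlier observations. In \<open>E[D\<^sub>t\<^sup>2 | past]\<close> the
mixed term vanishes, because \<open>E[f(X\<^sub>i) X\<^sub>j X\<^sub>k] = 0\<close> whenever \<open>j \<noteq> k\<close>, and the random part is a multiple of
\<open>\<Sum>\<^sub>i\<^sub><\<^sub>j (\<Sum>\<^sub>s\<^sub><\<^sub>t X\<^sub>i\<^sub>s X\<^sub>j\<^sub>s)\<^sup>2\<close>. This is again an off-diagonal trace, so the same expansion shows that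
it is close to its mean in \<open>L\<^sup>1\<close>, and so close that even the sum over \<open>t\<close> of the errors tends to \<open>0\<close>
(\<open>past_form_deviation\<close>). So the characteristic function of \<open>W\<close> can be compared with the Gaussian one
increment by increment, each with its unconditional variance (\<open>char_function_martingale_bound\<close>). The Taylor
remainders are controlled by \<open>\<Sum>\<^sub>t E[D\<^sub>t\<^sup>4]\<close>. With only four moments of \<open>X\<close> the fourth moment of the quadratic part
of \<open>D\<^sub>t\<close> is still finite, since it is a multilinear polynomial in the entries, and it is at most a constant times
the square of the second moment by hypercontractivity (\<open>mpoly_fourth_moment\<close>).

All bounds are explicit in \<open>n\<close>, \<open>p\<close> and the truncation level; they are collected in
\<open>char_function_Z_stat_bound\<close>, and Levy's continuity theorem concludes.
\<close>

section \<open>Independence of functions of disjoint families\<close>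

text \<open>
Measurability with respect to this sigma-algebra on the sample space says that a function depends on the variables with index in \<open>A\<close> only, and is closed under the usual operations; this
keeps the independence arguments below free of explicit representations by functions on a product space.
\<close>

definition (in prob_space) gen :: "('i \<Rightarrow> 'a \<Rightarrow> real) \<Rightarrow> 'i set \<Rightarrow> 'a measure" where
  "gen X A = vimage_algebra (space M) (\<lambda>\<omega>. \<lambda>i\<in>A. X i \<omega>) (\<Pi>\<^sub>M i\<in>A. borel)"

context prob_space
begin

lemma space_gen [simp]: "space (gen X A) = space M"
  by (simp add: gen_def)

lemma measurable_gen: "i \<in> A \<Longrightarrow> X i \<in> borel_measurable (gen X A)"
proof -
  assume i: "i \<in> A"
  let ?r = "\<lambda>\<omega>. \<lambda>i\<in>A. X i \<omega>"
  have "?r \<in> measurable (gen X A) (\<Pi>\<^sub>M i\<in>A. borel)"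
    unfolding gen_def by (rule measurable_vimage_algebra1) (auto simp: space_PiM)
  then have "(\<lambda>\<omega>. ?r \<omega> i) \<in> borel_measurable (gen X A)"
    using measurable_compose[OF _ measurable_component_singleton[OF i], of ?r] by simp
  then show ?thesis using i by simp
qed

lemma gen_mono:
  assumes "A \<subseteq> B" "f \<in> borel_measurable (gen X A)"
  shows "f \<in> borel_measurable (gen X B)"
proof -
  have "id \<in> measurable (gen X B) (gen X A)"
  proof -
    have "(\<lambda>\<omega>. \<lambda>i\<in>A. X i \<omega>) \<in> measurable (gen X B) (\<Pi>\<^sub>M i\<in>A. borel)"
      using assms(1) by (intro measurable_restrict measurable_gen) auto
    then show ?thesis
      by (subst (2) gen_def) (rule measurable_vimage_algebra2, auto)
  qed
  from measurable_compose[OF this assms(2)] show ?thesis by simp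
qed

lemma indep_var_gen:
  fixes f :: "'a \<Rightarrow> 'c::topological_space" and g :: "'a \<Rightarrow> 'c"
  assumes ind: "indep_vars (\<lambda>_. borel) X I" and AB: "A \<subseteq> I" "B \<subseteq> I" "A \<inter> B = {}"
    and f: "f \<in> borel_measurable (gen X A)" and g: "g \<in> borel_measurable (gen X B)"
  shows "indep_var borel f borel g"
proof -
  let ?r = "\<lambda>A \<omega>. \<lambda>i\<in>A. X i \<omega>"
  have i: "indep_var (\<Pi>\<^sub>M i\<in>A. borel) (?r A) (\<Pi>\<^sub>M i\<in>B. borel) (?r B)"
    using indep_var_restrict[OF ind AB(3,1,2)] .
  have sub: "sets (gen X A) = sigma_sets (space M) {?r A -` E \<inter> space M | E. E \<in> sets (\<Pi>\<^sub>M i\<in>A. borel)}" for A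
    by (simp add: gen_def sets_vimage_algebra)
  have i2: "indep_set (sets (gen X A)) (sets (gen X B))" 
    and r: "random_variable (\<Pi>\<^sub>M i\<in>A. borel) (?r A)" "random_variable (\<Pi>\<^sub>M i\<in>B. borel) (?r B)"
    using i unfolding indep_var_eq sub by auto
  have s: "sets (gen X A) \<subseteq> events" "sets (gen X B) \<subseteq> events"
    using indep_setD_ev1[OF i2] indep_setD_ev2[OF i2] by auto
  have pull: "sigma_sets (space M) {h -` E \<inter> space M | E. E \<in> sets borel} \<subseteq> sets (gen X C)"
    if "h \<in> borel_measurable (gen X C)" for C and h :: "'a \<Rightarrow> 'e::topological_space"
  proof -
    have "{h -` E \<inter> space M | E. E \<in> sets borel} \<subseteq> sets (gen X C)"
      using measurable_sets[OF that] by auto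
    from sets.sigma_sets_subset[OF this] show ?thesis by simp
  qed
  have rv: "random_variable borel f" "random_variable borel g"
    using measurable_mono[OF order_refl refl s(1), THEN subsetD, OF _ f]
      measurable_mono[OF order_refl refl s(2), THEN subsetD, OF _ g] by simp_all
  show ?thesis
    unfolding indep_var_eq indep_sets2_eq
  proof (intro conjI ballI rv)
    show "sigma_sets (space M) {f -` E \<inter> space M | E. E \<in> sets borel} \<subseteq> events"
      using pull[OF f] s(1) by (rule subset_trans)
    show "sigma_sets (space M) {g -` E \<inter> space M | E. E \<in> sets borel} \<subseteq> events"
      using pull[OF g] s(2) by (rule subset_trans)
    fix a b
    assume "a \<in> sigma_sets (space M) {f -` E \<inter> space M | E. E \<in> sets borel}"
      and "b \<in> sigma_sets (space M) {g -` E \<inter> space M | E. E \<in> sets borel}"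
    with pull[OF f] pull[OF g] have "a \<in> sets (gen X A)" "b \<in> sets (gen X B)" by (blast dest: subsetD)+
    then show "prob (a \<inter> b) = prob a * prob b" by (rule indep_setD[OF i2])
  qed
qed

lemma gen_measurable_M:
  assumes "indep_vars (\<lambda>_. borel) X I" "A \<subseteq> I" "f \<in> borel_measurable (gen X A)"
  shows "f \<in> borel_measurable M"
  using indep_var_gen[OF assms(1,2) empty_subsetI _ assms(3), of "\<lambda>_. undefined"]
  by (auto simp: indep_var_eq)

lemma
  fixes f g :: "'a \<Rightarrow> 'b::{real_normed_field, banach, second_countable_topology}"
  assumes "indep_vars (\<lambda>_. borel) X I" "A \<subseteq> I" "B \<subseteq> I" "A \<inter> B = {}"
    and "f \<in> borel_measurable (gen X A)" "g \<in> borel_measurable (gen X B)"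
    and "integrable M f" "integrable M g"
  shows expectation_gen_mult: "(LINT \<omega>|M. f \<omega> * g \<omega>) = (LINT \<omega>|M. f \<omega>) * (LINT \<omega>|M. g \<omega>)"
    and integrable_gen_mult: "integrable M (\<lambda>\<omega>. f \<omega> * g \<omega>)"
  using indep_var_lebesgue_integral[OF indep_var_gen[OF assms(1-6)] assms(7,8)]
    indep_var_integrable[OF indep_var_gen[OF assms(1-6)] assms(7,8)] by auto

lemma
  fixes h :: "'i \<Rightarrow> real \<Rightarrow> real"
  assumes ind: "indep_vars (\<lambda>_. borel) X I" and S: "S \<subseteq> I" "finite S"
    and h: "\<And>i. i \<in> S \<Longrightarrow> h i \<in> borel_measurable borel"
    and int: "\<And>i. i \<in> S \<Longrightarrow> integrable M (\<lambda>\<omega>. h i (X i \<omega>))"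
  shows expectation_prod_indep: "(LINT \<omega>|M. (\<Prod>i\<in>S. h i (X i \<omega>))) = (\<Prod>i\<in>S. LINT \<omega>|M. h i (X i \<omega>))"
    and integrable_prod_indep: "integrable M (\<lambda>\<omega>. \<Prod>i\<in>S. h i (X i \<omega>))"
proof -
  have "indep_vars (\<lambda>_. borel) (\<lambda>i \<omega>. h i (X i \<omega>)) S"
    using indep_vars_compose2[OF indep_vars_subset[OF ind S(1)], of h "\<lambda>_. borel"] h by auto
  from indep_vars_lebesgue_integral[OF S(2) this int] indep_vars_integrable[OF S(2) this int]
  show "(LINT \<omega>|M. (\<Prod>i\<in>S. h i (X i \<omega>))) = (\<Prod>i\<in>S. LINT \<omega>|M. h i (X i \<omega>))"
    and "integrable M (\<lambda>\<omega>. \<Prod>i\<in>S. h i (X i \<omega>))" by auto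
qed

section \<open>Moment inequalities\<close>

lemma integrable_power_le:
  fixes f :: "'a \<Rightarrow> real"
  assumes [measurable]: "f \<in> borel_measurable M" and int: "integrable M (\<lambda>\<omega>. f \<omega> ^ m)" and "k \<le> m" "even m"
  shows "integrable M (\<lambda>\<omega>. f \<omega> ^ k)"
proof (rule Bochner_Integration.integrable_bound)
  show "integrable M (\<lambda>\<omega>. 1 + f \<omega> ^ m)" using int by auto
  show "AE \<omega> in M. norm (f \<omega> ^ k) \<le> norm (1 + f \<omega> ^ m)"
  proof (rule AE_I2)
    fix \<omega>
    have e: "0 \<le> f \<omega> ^ m" "f \<omega> ^ m = \<bar>f \<omega>\<bar> ^ m" using \<open>even m\<close> by (auto simp: zero_le_even_power power_even_abs)
    show "norm (f \<omega> ^ k) \<le> norm (1 + f \<omega> ^ m)"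
    proof (cases "\<bar>f \<omega>\<bar> \<le> 1")
      case True
      then have "\<bar>f \<omega>\<bar> ^ k \<le> 1" by (simp add: power_le_one)
      moreover have "0 \<le> \<bar>f \<omega>\<bar> ^ m" by simp
      ultimately have "\<bar>f \<omega>\<bar> ^ k \<le> 1 + \<bar>f \<omega>\<bar> ^ m" by linarith
      with e show ?thesis by (simp add: power_abs)
    next
      case False
      then have "\<bar>f \<omega>\<bar> ^ k \<le> \<bar>f \<omega>\<bar> ^ m" using \<open>k \<le> m\<close> by (intro power_increasing) auto
      with e show ?thesis by (simp add: power_abs)
    qed
  qed
qed simp

lemma integrable_mult_of_squares:
  fixes f g :: "'a \<Rightarrow> real"
  assumes [measurable]: "f \<in> borel_measurable M" "g \<in> borel_measurable M"
    and "integrable M (\<lambda>\<omega>. f \<omega> ^ 2)" "integrable M (\<lambda>\<omega>. g \<omega> ^ 2)"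
  shows "integrable M (\<lambda>\<omega>. f \<omega> * g \<omega>)"
proof (rule Bochner_Integration.integrable_bound)
  show "integrable M (\<lambda>\<omega>. f \<omega> ^ 2 + g \<omega> ^ 2)" using assms by auto
  show "AE \<omega> in M. norm (f \<omega> * g \<omega>) \<le> norm (f \<omega> ^ 2 + g \<omega> ^ 2)"
  proof (rule AE_I2)
    fix \<omega>
    have "0 \<le> (\<bar>f \<omega>\<bar> - \<bar>g \<omega>\<bar>)^2" by simp
    then have "2 * \<bar>f \<omega> * g \<omega>\<bar> \<le> f \<omega> ^ 2 + g \<omega> ^ 2"
      by (simp add: power2_diff abs_mult)
    then show "norm (f \<omega> * g \<omega>) \<le> norm (f \<omega> ^ 2 + g \<omega> ^ 2)" by simp
  qed
qed simp

lemma expectation_Cauchy_Schwarz: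
  fixes f g :: "'a \<Rightarrow> real"
  assumes [measurable]: "f \<in> borel_measurable M" "g \<in> borel_measurable M"
    and f: "integrable M (\<lambda>\<omega>. f \<omega> ^ 2)" and g: "integrable M (\<lambda>\<omega>. g \<omega> ^ 2)"
  shows "(LINT \<omega>|M. f \<omega> * g \<omega>)\<^sup>2 \<le> (LINT \<omega>|M. f \<omega> ^ 2) * (LINT \<omega>|M. g \<omega> ^ 2)"
proof -
  define A B C where "A = (LINT \<omega>|M. f \<omega> ^ 2)" and "B = (LINT \<omega>|M. g \<omega> ^ 2)" and "C = (LINT \<omega>|M. f \<omega> * g \<omega>)"
  note fg = integrable_mult_of_squares[OF assms]
  have q: "0 \<le> a^2 * A + b^2 * B - 2 * a * b * C" for a b
  proof -
    have "0 \<le> (LINT \<omega>|M. (a * f \<omega> - b * g \<omega>)^2)" by (intro integral_nonneg_AE) auto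
    also have "\<dots> = (LINT \<omega>|M. a^2 * f \<omega>^2 + b^2 * g \<omega>^2 - 2 * a * b * (f \<omega> * g \<omega>))"
      by (intro Bochner_Integration.integral_cong) (auto simp: power2_eq_square algebra_simps)
    also have "\<dots> = a^2 * A + b^2 * B - 2 * a * b * C"
      using f g fg by (simp add: A_def B_def C_def)
    finally show ?thesis .
  qed
  have "B \<ge> 0" "A \<ge> 0" unfolding A_def B_def by (auto intro!: integral_nonneg_AE)
  show ?thesis
  proof (cases "B = 0")
    case True
    have "2 * b * C \<le> A" for b using q[of 1 b] True by simp
    from this[of "(A+1)/(2*C)"] have "C = 0" by (cases "C = 0") auto
    with \<open>A \<ge> 0\<close> True show ?thesis unfolding A_def B_def C_def by simp
  next
    case False
    with \<open>B \<ge> 0\<close> have "B > 0" by simp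
    have "0 \<le> B * (A * B - C^2)" using q[of B C] by (simp add: power2_eq_square algebra_simps)
    with \<open>B > 0\<close> have "C^2 \<le> A * B" by (simp add: zero_le_mult_iff)
    then show ?thesis unfolding A_def B_def C_def .
  qed
qed

lemma expectation_abs_le_sqrt:
  fixes f :: "'a \<Rightarrow> real"
  assumes [measurable]: "f \<in> borel_measurable M" and f: "integrable M (\<lambda>\<omega>. f \<omega> ^ 2)"
    and "(LINT \<omega>|M. f \<omega> ^ 2) \<le> r"
  shows "(LINT \<omega>|M. \<bar>f \<omega>\<bar>) \<le> sqrt r"
proof -
  have "(LINT \<omega>|M. \<bar>f \<omega>\<bar> * 1)\<^sup>2 \<le> (LINT \<omega>|M. \<bar>f \<omega>\<bar> ^ 2) * (LINT \<omega>|M. 1 ^ 2)"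
    by (rule expectation_Cauchy_Schwarz) (use f in auto)
  with assms(3) show ?thesis by (intro real_le_rsqrt) (simp add: prob_space)
qed

end

section \<open>Multilinear polynomials in independent centred variables\<close>

locale indep_centred = prob_space M for M :: "'a measure" +
  fixes Z :: "'i \<Rightarrow> 'a \<Rightarrow> real" and I :: "'i set" and v :: real
  assumes indep: "indep_vars (\<lambda>_. borel) Z I"
    and square_integrable: "\<And>i. i \<in> I \<Longrightarrow> integrable M (\<lambda>\<omega>. Z i \<omega> ^ 2)"
    and mean_zero: "\<And>i. i \<in> I \<Longrightarrow> (LINT \<omega>|M. Z i \<omega>) = 0"
    and second_moment: "\<And>i. i \<in> I \<Longrightarrow> (LINT \<omega>|M. Z i \<omega> ^ 2) = v"
begin

lemma Z_measurable: "i \<in> I \<Longrightarrow> Z i \<in> borel_measurable M"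
  using indep by (auto simp: indep_vars_def)

lemma Z_integrable: "i \<in> I \<Longrightarrow> integrable M (Z i)"
  using integrable_power_le[OF Z_measurable square_integrable, of i 1] by auto

lemma monomial_measurable_gen:
  assumes "S \<subseteq> A"
  shows "(\<lambda>\<omega>. \<Prod>i\<in>S. Z i \<omega>) \<in> borel_measurable (gen Z A)"
  using assms by (intro borel_measurable_prod measurable_gen) auto

text \<open>
A variable that occurs in only one of the two monomials has exponent \<open>1\<close> in the product and makes the expectation
vanish. So monomials over distinct index sets are orthogonal.
\<close>

lemma
  assumes S: "finite S" "S \<subseteq> I" and T: "finite T" "T \<subseteq> I"
  shows integrable_monomial_mult: "integrable M (\<lambda>\<omega>. (\<Prod>i\<in>S. Z i \<omega>) * (\<Prod>i\<in>T. Z i \<omega>))"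
    and expectation_monomial_mult: "(LINT \<omega>|M. (\<Prod>i\<in>S. Z i \<omega>) * (\<Prod>i\<in>T. Z i \<omega>)) = (if S = T then v ^ card S else 0)"
proof -
  define h where "h i x = (if i \<in> S then x else 1) * (if i \<in> T then x else 1 :: real)" for i x
  have *: "(\<Prod>i\<in>S. Z i \<omega>) * (\<Prod>i\<in>T. Z i \<omega>) = (\<Prod>i\<in>S \<union> T. h i (Z i \<omega>))" for \<omega>
  proof -
    have "(\<Prod>i\<in>S \<union> T. if i \<in> S then Z i \<omega> else 1) = (\<Prod>i\<in>S. Z i \<omega>)"
      using S T by (subst prod.inter_restrict[symmetric]) (auto simp: Int_absorb1)
    moreover have "(\<Prod>i\<in>S \<union> T. if i \<in> T then Z i \<omega> else 1) = (\<Prod>i\<in>T. Z i \<omega>)"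
      using S T by (subst prod.inter_restrict[symmetric]) (auto simp: Int_absorb1)
    ultimately show ?thesis by (simp add: h_def prod.distrib)
  qed
  have h1: "h i x = (if i \<in> S \<inter> T then x ^ 2 else if i \<in> S \<union> T then x else 1)" for i x
    by (auto simp: h_def power2_eq_square)
  have U: "S \<union> T \<subseteq> I" "finite (S \<union> T)" using S T by auto
  have m: "h i \<in> borel_measurable borel" for i
    unfolding h1 by measurable
  have int: "integrable M (\<lambda>\<omega>. h i (Z i \<omega>))" if "i \<in> S \<union> T" for i
    using that U Z_integrable[of i] square_integrable[of i] by (cases "i \<in> S"; cases "i \<in> T") (auto simp: h1)
  have e: "(LINT \<omega>|M. h i (Z i \<omega>)) = (if i \<in> S \<inter> T then v else 0)" if "i \<in> S \<union> T" for i
    using that U mean_zero[of i] second_moment[of i] by (cases "i \<in> S"; cases "i \<in> T") (auto simp: h1)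
  show "integrable M (\<lambda>\<omega>. (\<Prod>i\<in>S. Z i \<omega>) * (\<Prod>i\<in>T. Z i \<omega>))"
    unfolding * by (rule integrable_prod_indep[OF indep U m int])
  have "(LINT \<omega>|M. (\<Prod>i\<in>S. Z i \<omega>) * (\<Prod>i\<in>T. Z i \<omega>)) = (\<Prod>i\<in>S \<union> T. if i \<in> S \<inter> T then v else 0)"
    unfolding * by (subst expectation_prod_indep[OF indep U m int]) (auto simp: e)
  also have "\<dots> = (if S = T then v ^ card S else 0)"
  proof (cases "S = T")
    case True
    then show ?thesis by simp
  next
    case False
    then obtain i where "i \<in> S \<union> T" "i \<notin> S \<inter> T" by blast
    then show ?thesis using False U by (auto intro!: prod_zero)
  qed
  finally show "(LINT \<omega>|M. (\<Prod>i\<in>S. Z i \<omega>) * (\<Prod>i\<in>T. Z i \<omega>)) = (if S = T then v ^ card S else 0)" .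
qed

lemma
  fixes c :: "'t \<Rightarrow> real"
  assumes \<sigma>: "\<And>\<tau>. \<tau> \<in> T \<Longrightarrow> \<sigma> \<tau> \<subseteq> I \<and> finite (\<sigma> \<tau>) \<and> \<sigma> \<tau> \<noteq> {}"
  shows integrable_multilinear: "integrable M (\<lambda>\<omega>. \<Sum>\<tau>\<in>T. c \<tau> * (\<Prod>i\<in>\<sigma> \<tau>. Z i \<omega>))"
    and expectation_multilinear: "(LINT \<omega>|M. (\<Sum>\<tau>\<in>T. c \<tau> * (\<Prod>i\<in>\<sigma> \<tau>. Z i \<omega>))) = 0"
proof -
  have int: "integrable M (\<lambda>\<omega>. c \<tau> * (\<Prod>i\<in>\<sigma> \<tau>. Z i \<omega>))" if "\<tau> \<in> T" for \<tau>
    using integrable_monomial_mult[of "\<sigma> \<tau>" "{}"] \<sigma>[OF that] by simp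
  then show "integrable M (\<lambda>\<omega>. \<Sum>\<tau>\<in>T. c \<tau> * (\<Prod>i\<in>\<sigma> \<tau>. Z i \<omega>))"
    by (rule Bochner_Integration.integrable_sum)
  have "(LINT \<omega>|M. c \<tau> * (\<Prod>i\<in>\<sigma> \<tau>. Z i \<omega>)) = 0" if "\<tau> \<in> T" for \<tau>
    using expectation_monomial_mult[of "\<sigma> \<tau>" "{}"] \<sigma>[OF that] by simp
  with int show "(LINT \<omega>|M. (\<Sum>\<tau>\<in>T. c \<tau> * (\<Prod>i\<in>\<sigma> \<tau>. Z i \<omega>))) = 0"
    by (subst Bochner_Integration.integral_sum) (auto intro!: sum.neutral)
qed

text \<open>
Multilinear sums are indexed by an arbitrary set \<open>T\<close> with an injection \<open>\<sigma>\<close> to the index sets of the monomials,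
which fits sums over pairs and quadruples of indices directly.
\<close>

lemma
  fixes c :: "'t \<Rightarrow> real"
  assumes fin: "finite T" and inj: "inj_on \<sigma> T"
    and \<sigma>: "\<And>\<tau>. \<tau> \<in> T \<Longrightarrow> \<sigma> \<tau> \<subseteq> I \<and> finite (\<sigma> \<tau>) \<and> card (\<sigma> \<tau>) = d"
  shows integrable_multilinear_sq: "integrable M (\<lambda>\<omega>. (\<Sum>\<tau>\<in>T. c \<tau> * (\<Prod>i\<in>\<sigma> \<tau>. Z i \<omega>)) ^ 2)"
    and expectation_multilinear_sq: "(LINT \<omega>|M. (\<Sum>\<tau>\<in>T. c \<tau> * (\<Prod>i\<in>\<sigma> \<tau>. Z i \<omega>)) ^ 2) = (\<Sum>\<tau>\<in>T. c \<tau> ^ 2) * v ^ d"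
proof -
  have *: "(\<Sum>\<tau>\<in>T. c \<tau> * (\<Prod>i\<in>\<sigma> \<tau>. Z i \<omega>)) ^ 2 =
    (\<Sum>\<tau>\<in>T. \<Sum>\<tau>'\<in>T. (c \<tau> * c \<tau>') * ((\<Prod>i\<in>\<sigma> \<tau>. Z i \<omega>) * (\<Prod>i\<in>\<sigma> \<tau>'. Z i \<omega>)))" for \<omega>
    by (simp add: power2_eq_square sum_product algebra_simps)
  have int: "integrable M (\<lambda>\<omega>. (c \<tau> * c \<tau>') * ((\<Prod>i\<in>\<sigma> \<tau>. Z i \<omega>) * (\<Prod>i\<in>\<sigma> \<tau>'. Z i \<omega>)))"
    if "\<tau> \<in> T" "\<tau>' \<in> T" for \<tau> \<tau>'
    using that \<sigma> by (intro integrable_mult_right integrable_monomial_mult) auto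
  show "integrable M (\<lambda>\<omega>. (\<Sum>\<tau>\<in>T. c \<tau> * (\<Prod>i\<in>\<sigma> \<tau>. Z i \<omega>)) ^ 2)"
    unfolding * by (intro Bochner_Integration.integrable_sum int)
  have "(LINT \<omega>|M. (\<Sum>\<tau>\<in>T. c \<tau> * (\<Prod>i\<in>\<sigma> \<tau>. Z i \<omega>)) ^ 2) =
    (\<Sum>\<tau>\<in>T. \<Sum>\<tau>'\<in>T. (c \<tau> * c \<tau>') * (LINT \<omega>|M. (\<Prod>i\<in>\<sigma> \<tau>. Z i \<omega>) * (\<Prod>i\<in>\<sigma> \<tau>'. Z i \<omega>)))"
  proof -
    have "(LINT \<omega>|M. (\<Sum>\<tau>'\<in>T. (c \<tau> * c \<tau>') * ((\<Prod>i\<in>\<sigma> \<tau>. Z i \<omega>) * (\<Prod>i\<in>\<sigma> \<tau>'. Z i \<omega>)))) =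
      (\<Sum>\<tau>'\<in>T. (c \<tau> * c \<tau>') * (LINT \<omega>|M. (\<Prod>i\<in>\<sigma> \<tau>. Z i \<omega>) * (\<Prod>i\<in>\<sigma> \<tau>'. Z i \<omega>)))" if "\<tau> \<in> T" for \<tau>
      by (subst Bochner_Integration.integral_sum, erule int[OF that], simp)
    then show ?thesis
      unfolding * by (subst Bochner_Integration.integral_sum) (auto intro!: Bochner_Integration.integrable_sum int)
  qed
  also have "\<dots> = (\<Sum>\<tau>\<in>T. \<Sum>\<tau>'\<in>T. if \<tau> = \<tau>' then c \<tau> ^ 2 * v ^ d else 0)"
  proof (intro sum.cong refl)
    fix \<tau> \<tau>' assume t: "\<tau> \<in> T" "\<tau>' \<in> T"
    have eq: "\<sigma> \<tau> = \<sigma> \<tau>' \<longleftrightarrow> \<tau> = \<tau>'" using inj t by (auto dest: inj_onD)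
    have "(LINT \<omega>|M. (\<Prod>i\<in>\<sigma> \<tau>. Z i \<omega>) * (\<Prod>i\<in>\<sigma> \<tau>'. Z i \<omega>)) = (if \<sigma> \<tau> = \<sigma> \<tau>' then v ^ card (\<sigma> \<tau>) else 0)"
      using \<sigma> t by (intro expectation_monomial_mult) auto
    then show "(c \<tau> * c \<tau>') * (LINT \<omega>|M. (\<Prod>i\<in>\<sigma> \<tau>. Z i \<omega>) * (\<Prod>i\<in>\<sigma> \<tau>'. Z i \<omega>)) = (if \<tau> = \<tau>' then c \<tau> ^ 2 * v ^ d else 0)"
      using \<sigma> t unfolding eq by (auto simp: power2_eq_square)
  qed
  also have "\<dots> = (\<Sum>\<tau>\<in>T. c \<tau> ^ 2) * v ^ d"
    using fin by (simp add: sum_distrib_right)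
  finally show "(LINT \<omega>|M. (\<Sum>\<tau>\<in>T. c \<tau> * (\<Prod>i\<in>\<sigma> \<tau>. Z i \<omega>)) ^ 2) = (\<Sum>\<tau>\<in>T. c \<tau> ^ 2) * v ^ d" .
qed

end

lemma (in prob_space) integrable_power_mult4:
  fixes f g :: "'a \<Rightarrow> real"
  assumes [measurable]: "f \<in> borel_measurable M" "g \<in> borel_measurable M"
    and "integrable M (\<lambda>\<omega>. f \<omega> ^ 4)" "integrable M (\<lambda>\<omega>. g \<omega> ^ 4)" and ab: "a + b = 4"
  shows "integrable M (\<lambda>\<omega>. f \<omega> ^ a * g \<omega> ^ b)"
proof (rule Bochner_Integration.integrable_bound)
  show "integrable M (\<lambda>\<omega>. f \<omega> ^ 4 + g \<omega> ^ 4)" using assms by auto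
  show "AE \<omega> in M. norm (f \<omega> ^ a * g \<omega> ^ b) \<le> norm (f \<omega> ^ 4 + g \<omega> ^ 4)"
  proof (rule AE_I2)
    fix \<omega>
    define y where "y = max \<bar>f \<omega>\<bar> \<bar>g \<omega>\<bar>"
    have "\<bar>f \<omega>\<bar> ^ a * \<bar>g \<omega>\<bar> ^ b \<le> y ^ a * y ^ b"
      by (intro mult_mono power_mono) (auto simp: y_def)
    also have "\<dots> = y ^ 4" by (simp add: power_add[symmetric] ab)
    also have "\<dots> \<le> \<bar>f \<omega>\<bar> ^ 4 + \<bar>g \<omega>\<bar> ^ 4" by (auto simp: y_def max_def)
    finally show "norm (f \<omega> ^ a * g \<omega> ^ b) \<le> norm (f \<omega> ^ 4 + g \<omega> ^ 4)"
      by (simp add: abs_mult power_abs)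
  qed
qed simp

lemma sum_Pow_insert:
  assumes "finite F" "x \<notin> F"
  shows "(\<Sum>S\<in>Pow (insert x F). g S) = (\<Sum>S\<in>Pow F. g S) + (\<Sum>S\<in>Pow F. g (insert x S))"
proof -
  have "inj_on (insert x) (Pow F)" using assms by (auto simp: inj_on_def)
  moreover have "Pow F \<inter> insert x ` Pow F = {}" using assms by auto
  ultimately show ?thesis using assms
    by (simp add: Pow_insert sum.union_disjoint sum.reindex)
qed

locale indep_fourth = indep_centred M Z I 1 for M :: "'a measure" and Z :: "'i \<Rightarrow> 'a \<Rightarrow> real" and I +
  fixes m :: real
  assumes fourth_integrable: "\<And>i. i \<in> I \<Longrightarrow> integrable M (\<lambda>\<omega>. Z i \<omega> ^ 4)"
    and fourth_moment: "\<And>i. i \<in> I \<Longrightarrow> (LINT \<omega>|M. Z i \<omega> ^ 4) \<le> m"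
    and m_nonneg: "0 \<le> m"
begin

text \<open>
Here all subsets of \<open>A\<close> serve as indices, because this form is stable under splitting off one variable.
\<close>

definition mpoly :: "('i set \<Rightarrow> real) \<Rightarrow> 'i set \<Rightarrow> 'a \<Rightarrow> real" where
  "mpoly c A \<omega> = (\<Sum>S\<in>Pow A. c S * (\<Prod>i\<in>S. Z i \<omega>))"

lemma mpoly_measurable_gen: "mpoly c A \<in> borel_measurable (gen Z A)"
  unfolding mpoly_def by (intro borel_measurable_sum borel_measurable_times monomial_measurable_gen) auto

lemma mpoly_insert:
  assumes "finite F" "x \<notin> F"
  shows "mpoly c (insert x F) \<omega> = mpoly c F \<omega> + Z x \<omega> * mpoly (\<lambda>S. c (insert x S)) F \<omega>"
proof -
  have "(\<Prod>i\<in>insert x S. Z i \<omega>) = Z x \<omega> * (\<Prod>i\<in>S. Z i \<omega>)" if "S \<in> Pow F" for S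
    using assms that finite_subset[of S F] by (subst prod.insert) auto
  then show ?thesis
    by (simp add: mpoly_def sum_Pow_insert[OF assms] sum_distrib_left mult_ac)
qed

text \<open>
Hypercontractivity, by Bonami's induction on the number of variables. Write the polynomial as \<open>T + Z\<^sub>x R\<close>, where
\<open>T\<close> and \<open>R\<close> do not contain \<open>Z\<^sub>x\<close> and \<open>R\<close> has smaller degree. In the expansion of the fourth power the term with
\<open>Z\<^sub>x\<close> to the first power vanishes, and the others are bounded by \<open>E[T\<^sup>4]\<close>, \<open>E[R\<^sup>4]\<close> and
\<open>E[R\<^sup>2 T\<^sup>2] \<le> (E[R\<^sup>4] E[T\<^sup>4])\<^sup>1\<^sup>/\<^sup>2\<close>. With \<open>k = m + 4\<close> the induction closes because
\<open>7 + m \<le> 2 k\<close> and \<open>1 + 2 m \<le> k\<^sup>2\<close>, so that the three bounds add up to a square.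
\<close>

lemma mpoly_fourth_moment:
  assumes "finite A" "A \<subseteq> I" "\<And>S. S \<subseteq> A \<Longrightarrow> c S \<noteq> 0 \<Longrightarrow> card S \<le> d"
  shows "integrable M (\<lambda>\<omega>. mpoly c A \<omega> ^ 4) \<and>
    (LINT \<omega>|M. mpoly c A \<omega> ^ 4) \<le> (m + 4) ^ (2 * d) * (\<Sum>S\<in>Pow A. c S ^ 2) ^ 2"
  using assms
proof (induction A arbitrary: c d rule: finite_induct)
  case empty
  have "(c {})^4 \<le> (m + 4) ^ (2 * d) * (c {})^4"
    using mult_right_mono[of 1 "(m + 4) ^ (2 * d)" "(c {})^4"] m_nonneg by (simp add: one_le_power)
  then show ?case by (simp add: mpoly_def prob_space)
next
  case (insert x F)
  define c' where "c' = (\<lambda>S. c (insert x S))"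
  define T where "T = mpoly c F"
  define R where "R = mpoly c' F"
  have P: "mpoly c (insert x F) \<omega> = T \<omega> + Z x \<omega> * R \<omega>" for \<omega>
    using mpoly_insert[OF insert.hyps] by (simp add: T_def R_def c'_def)
  define t where "t = (\<Sum>S\<in>Pow F. c S ^ 2)"
  define r where "r = (\<Sum>S\<in>Pow F. c' S ^ 2)"
  have tr: "(\<Sum>S\<in>Pow (insert x F). c S ^ 2) = t + r"
    by (simp add: t_def r_def c'_def sum_Pow_insert[OF insert.hyps])
  have tr0: "t \<ge> 0" "r \<ge> 0" by (auto simp: t_def r_def intro!: sum_nonneg)
  define k where "k = m + 4"
  have k: "k \<ge> 4" using m_nonneg by (simp add: k_def)
  have F: "F \<subseteq> I" "x \<in> I" "{x} \<inter> F = {}" "{x} \<subseteq> I" using insert by auto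
  have T4: "integrable M (\<lambda>\<omega>. T \<omega> ^ 4)" "(LINT \<omega>|M. T \<omega> ^ 4) \<le> k ^ (2 * d) * t ^ 2"
    using insert.IH[of c d] insert.prems F by (auto simp: T_def t_def k_def)
  show ?case
  proof (cases d)
    case 0
    \<comment> \<open>a polynomial of degree \<open>0\<close> does not contain \<open>x\<close>\<close>
    have "c' S = 0" if "S \<in> Pow F" for S
    proof (rule ccontr)
      assume "c' S \<noteq> 0"
      then have "card (insert x S) \<le> 0" 
        using insert.prems(2)[of "insert x S"] that 0 by (auto simp: c'_def)
      moreover have "finite (insert x S)" using that insert.hyps finite_subset by auto
      ultimately show False by simp
    qed
    then have "R \<omega> = 0" "r = 0" for \<omega> by (auto simp: R_def mpoly_def r_def)
    then show ?thesis using T4 tr by (simp add: P[abs_def] k_def)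
  next
    case (Suc e)
    have "integrable M (\<lambda>\<omega>. mpoly c' F \<omega> ^ 4) \<and>
      (LINT \<omega>|M. mpoly c' F \<omega> ^ 4) \<le> (m + 4) ^ (2 * e) * (\<Sum>S\<in>Pow F. c' S ^ 2) ^ 2"
    proof (rule insert.IH[OF F(1)])
      fix S assume S: "S \<subseteq> F" "c' S \<noteq> 0"
      then have "card (insert x S) \<le> d" using insert.prems(2)[of "insert x S"] by (auto simp: c'_def)
      moreover have "card (insert x S) = Suc (card S)"
        using S insert.hyps finite_subset[OF S(1)] by (subst card_insert_disjoint) auto
      ultimately show "card S \<le> e" using Suc by simp
    qed
    then have R4: "integrable M (\<lambda>\<omega>. R \<omega> ^ 4)" "(LINT \<omega>|M. R \<omega> ^ 4) \<le> k ^ (2 * e) * r ^ 2"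
      by (auto simp: R_def r_def k_def)
    have gm: "T \<in> borel_measurable (gen Z F)" "R \<in> borel_measurable (gen Z F)"
      by (auto simp: T_def R_def mpoly_measurable_gen)
    have [measurable]: "T \<in> borel_measurable M" "R \<in> borel_measurable M" "Z x \<in> borel_measurable M"
      using gen_measurable_M[OF indep F(1)] gm Z_measurable F by auto
    have RT: "integrable M (\<lambda>\<omega>. R \<omega> ^ a * T \<omega> ^ b)" if "a + b = 4" for a b
      using R4 T4 that by (intro integrable_power_mult4) auto
    have Zp: "integrable M (\<lambda>\<omega>. Z x \<omega> ^ a)" if "a \<le> 4" for a
      using integrable_power_le[OF _ fourth_integrable, of x a] F that by auto
    have gx: "Z x \<in> borel_measurable (gen Z {x})" by (rule measurable_gen) simp
    have split: "integrable M (\<lambda>\<omega>. Z x \<omega> ^ a * (R \<omega> ^ a * T \<omega> ^ b))"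
      "(LINT \<omega>|M. Z x \<omega> ^ a * (R \<omega> ^ a * T \<omega> ^ b)) = (LINT \<omega>|M. Z x \<omega> ^ a) * (LINT \<omega>|M. R \<omega> ^ a * T \<omega> ^ b)"
      if "a + b = 4" for a b
    proof -
      have 1: "(\<lambda>\<omega>. Z x \<omega> ^ a) \<in> borel_measurable (gen Z {x})" using gx by simp
      have 2: "(\<lambda>\<omega>. R \<omega> ^ a * T \<omega> ^ b) \<in> borel_measurable (gen Z F)"
        using gm by (intro borel_measurable_times borel_measurable_power) auto
      show "integrable M (\<lambda>\<omega>. Z x \<omega> ^ a * (R \<omega> ^ a * T \<omega> ^ b))"
        by (rule integrable_gen_mult[OF indep F(4,1,3) 1 2 Zp RT]) (use that in auto)
      show "(LINT \<omega>|M. Z x \<omega> ^ a * (R \<omega> ^ a * T \<omega> ^ b)) = (LINT \<omega>|M. Z x \<omega> ^ a) * (LINT \<omega>|M. R \<omega> ^ a * T \<omega> ^ b)"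
        by (rule expectation_gen_mult[OF indep F(4,1,3) 1 2 Zp RT]) (use that in auto)
    qed
    have exp4: "mpoly c (insert x F) \<omega> ^ 4 =
        T \<omega> ^ 4 + 4 * (Z x \<omega> ^ 1 * (R \<omega> ^ 1 * T \<omega> ^ 3)) + 6 * (Z x \<omega> ^ 2 * (R \<omega> ^ 2 * T \<omega> ^ 2))
        + 4 * (Z x \<omega> ^ 3 * (R \<omega> ^ 3 * T \<omega> ^ 1)) + Z x \<omega> ^ 4 * (R \<omega> ^ 4 * T \<omega> ^ 0)" for \<omega>
      unfolding P by (simp add: power4_eq_xxxx power3_eq_cube power2_eq_square algebra_simps)
    note ints = T4(1) split(1)[of 1 3] split(1)[of 2 2] split(1)[of 3 1] split(1)[of 4 0]
    have intP: "integrable M (\<lambda>\<omega>. mpoly c (insert x F) \<omega> ^ 4)"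
      unfolding exp4 using ints by (intro Bochner_Integration.integrable_add integrable_mult_right) auto
    define m3 where "m3 = (LINT \<omega>|M. Z x \<omega> ^ 3)"
    define a b where "a = (LINT \<omega>|M. R \<omega> ^ 4)" and "b = (LINT \<omega>|M. R \<omega> ^ 2 * T \<omega> ^ 2)"
    have "(LINT \<omega>|M. mpoly c (insert x F) \<omega> ^ 4) =
      (LINT \<omega>|M. T \<omega> ^ 4) + 4 * (LINT \<omega>|M. Z x \<omega> ^ 1 * (R \<omega> ^ 1 * T \<omega> ^ 3))
       + 6 * (LINT \<omega>|M. Z x \<omega> ^ 2 * (R \<omega> ^ 2 * T \<omega> ^ 2))
       + 4 * (LINT \<omega>|M. Z x \<omega> ^ 3 * (R \<omega> ^ 3 * T \<omega> ^ 1)) + (LINT \<omega>|M. Z x \<omega> ^ 4 * (R \<omega> ^ 4 * T \<omega> ^ 0))"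
      unfolding exp4 using ints
      by (subst Bochner_Integration.integral_add Bochner_Integration.integral_mult_right_zero;
          (intro Bochner_Integration.integrable_add integrable_mult_right)?; simp)+
    also have "\<dots> = (LINT \<omega>|M. T \<omega> ^ 4) + 6 * b + 4 * (m3 * (LINT \<omega>|M. R \<omega> ^ 3 * T \<omega>)) + (LINT \<omega>|M. Z x \<omega> ^ 4) * a"
      using split(2)[of 1 3] split(2)[of 2 2] split(2)[of 3 1] split(2)[of 4 0] mean_zero[OF F(2)] second_moment[OF F(2)]
      by (simp add: m3_def a_def b_def)
    finally have E: "(LINT \<omega>|M. mpoly c (insert x F) \<omega> ^ 4) = \<dots>" .
    have ab0: "a \<ge> 0" "b \<ge> 0" by (auto simp: a_def b_def intro!: integral_nonneg_AE)
    have m3: "\<bar>m3\<bar> \<le> (1 + m) / 2"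
    proof -
      have "\<bar>m3\<bar> \<le> (LINT \<omega>|M. \<bar>Z x \<omega> ^ 3\<bar>)" unfolding m3_def by (rule integral_abs_bound)
      also have "\<dots> \<le> (LINT \<omega>|M. (Z x \<omega> ^ 2 + Z x \<omega> ^ 4) / 2)"
      proof (rule integral_mono)
        fix \<omega>
        have "0 \<le> \<bar>Z x \<omega>\<bar>^2 * (\<bar>Z x \<omega>\<bar> - 1)^2" by simp
        also have "\<dots> = Z x \<omega> ^ 2 + Z x \<omega> ^ 4 - 2 * \<bar>Z x \<omega> ^ 3\<bar>"
          by (simp add: power_abs power4_eq_xxxx power3_eq_cube power2_eq_square algebra_simps abs_mult)
        finally show "\<bar>Z x \<omega> ^ 3\<bar> \<le> (Z x \<omega> ^ 2 + Z x \<omega> ^ 4) / 2" by simp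
      qed (use Zp in auto)
      also have "\<dots> \<le> (1 + m) / 2" using Zp second_moment[OF F(2)] fourth_moment[OF F(2)] by simp
      finally show ?thesis .
    qed
    have r3t: "\<bar>LINT \<omega>|M. R \<omega> ^ 3 * T \<omega>\<bar> \<le> (a + b) / 2"
    proof -
      have "\<bar>LINT \<omega>|M. R \<omega> ^ 3 * T \<omega>\<bar> \<le> (LINT \<omega>|M. \<bar>R \<omega> ^ 3 * T \<omega>\<bar>)" by (rule integral_abs_bound)
      also have "\<dots> \<le> (LINT \<omega>|M. (R \<omega> ^ 4 + R \<omega> ^ 2 * T \<omega> ^ 2) / 2)"
      proof (rule integral_mono)
        fix \<omega>
        have "0 \<le> \<bar>R \<omega>\<bar>^2 * (\<bar>R \<omega>\<bar> - \<bar>T \<omega>\<bar>)^2" by simp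
        also have "\<dots> = R \<omega> ^ 4 + R \<omega> ^ 2 * T \<omega> ^ 2 - 2 * \<bar>R \<omega> ^ 3 * T \<omega>\<bar>"
          by (simp add: power4_eq_xxxx power3_eq_cube power2_eq_square algebra_simps abs_mult)
        finally show "\<bar>R \<omega> ^ 3 * T \<omega>\<bar> \<le> (R \<omega> ^ 4 + R \<omega> ^ 2 * T \<omega> ^ 2) / 2" by simp
      qed (use R4 RT[of 2 2] RT[of 3 1] in auto)
      also have "\<dots> = (a + b) / 2" using R4 RT[of 2 2] by (simp add: a_def b_def)
      finally show ?thesis .
    qed
    have "4 * (m3 * (LINT \<omega>|M. R \<omega> ^ 3 * T \<omega>)) \<le> 4 * (\<bar>m3\<bar> * \<bar>LINT \<omega>|M. R \<omega> ^ 3 * T \<omega>\<bar>)"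
      by (simp add: abs_mult[symmetric])
    also have "\<dots> \<le> 4 * ((1 + m) / 2 * ((a + b) / 2))"
      using m3 r3t m_nonneg by (intro mult_left_mono mult_mono) auto
    finally have c1: "4 * (m3 * (LINT \<omega>|M. R \<omega> ^ 3 * T \<omega>)) \<le> (1 + m) * (a + b)" by simp
    have c2: "(LINT \<omega>|M. Z x \<omega> ^ 4) * a \<le> m * a" using fourth_moment[OF F(2)] ab0 by (intro mult_right_mono)
    have b: "b \<le> k ^ (2 * e + 1) * (r * t)"
    proof (rule power2_le_imp_le)
      have "b\<^sup>2 \<le> (LINT \<omega>|M. (R \<omega> ^ 2) ^ 2) * (LINT \<omega>|M. (T \<omega> ^ 2) ^ 2)"
        unfolding b_def by (rule expectation_Cauchy_Schwarz) (use R4 T4 in auto)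
      also have "\<dots> \<le> (k ^ (2 * e) * r ^ 2) * (k ^ (2 * d) * t ^ 2)"
        using R4(2) T4(2) k by (intro mult_mono) auto
      also have "\<dots> = (k ^ (2 * e + 1) * (r * t))\<^sup>2"
        using Suc by (simp add: power_mult_distrib power2_eq_square power_add power_mult)
      finally show "b\<^sup>2 \<le> (k ^ (2 * e + 1) * (r * t))\<^sup>2" .
    qed (use k tr0 in auto)
    have a: "a \<le> k ^ (2 * e) * r\<^sup>2" using R4(2) by (simp add: a_def)
    have "1 + 2 * m \<le> k\<^sup>2" using m_nonneg by (simp add: k_def power2_eq_square algebra_simps)
    then have ka: "(1 + 2 * m) * a \<le> k\<^sup>2 * (k ^ (2 * e) * r\<^sup>2)" using a ab0 by (intro mult_mono) auto
    have "7 + m \<le> 2 * k" using m_nonneg by (simp add: k_def)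
    then have kb: "(7 + m) * b \<le> (2 * k) * (k ^ (2 * e + 1) * (r * t))" using b ab0 k by (intro mult_mono) auto
    have "(LINT \<omega>|M. mpoly c (insert x F) \<omega> ^ 4) \<le> (LINT \<omega>|M. T \<omega> ^ 4) + (7 + m) * b + (1 + 2 * m) * a"
      unfolding E using c1 c2 by (simp add: algebra_simps)
    also have "\<dots> \<le> k ^ (2 * d) * t ^ 2 + (2 * k) * (k ^ (2 * e + 1) * (r * t)) + k\<^sup>2 * (k ^ (2 * e) * r\<^sup>2)"
      using T4(2) ka kb by linarith
    also have "\<dots> = k ^ (2 * d) * (t + r) ^ 2"
      using Suc by (simp add: power2_eq_square algebra_simps)
    finally show ?thesis using intP by (simp add: tr k_def)
  qed
qed

lemma
  fixes c :: "'t \<Rightarrow> real"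
  assumes fin: "finite T" and inj: "inj_on \<sigma> T"
    and \<sigma>: "\<And>\<tau>. \<tau> \<in> T \<Longrightarrow> \<sigma> \<tau> \<subseteq> I \<and> finite (\<sigma> \<tau>) \<and> card (\<sigma> \<tau>) \<le> d"
  shows integrable_multilinear_fourth: "integrable M (\<lambda>\<omega>. (\<Sum>\<tau>\<in>T. c \<tau> * (\<Prod>i\<in>\<sigma> \<tau>. Z i \<omega>)) ^ 4)"
    and expectation_multilinear_fourth: "(LINT \<omega>|M. (\<Sum>\<tau>\<in>T. c \<tau> * (\<Prod>i\<in>\<sigma> \<tau>. Z i \<omega>)) ^ 4) \<le> (m + 4) ^ (2 * d) * (\<Sum>\<tau>\<in>T. c \<tau> ^ 2) ^ 2"
proof -
  define A where "A = (\<Union>\<tau>\<in>T. \<sigma> \<tau>)"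
  have A: "finite A" "A \<subseteq> I" using fin \<sigma> by (auto simp: A_def)
  define c' where "c' S = (if S \<in> \<sigma> ` T then c (inv_into T \<sigma> S) else 0)" for S
  have c': "c' (\<sigma> \<tau>) = c \<tau>" if "\<tau> \<in> T" for \<tau> using that inj by (simp add: c'_def)
  have re: "(\<Sum>S\<in>Pow A. g S) = (\<Sum>\<tau>\<in>T. g (\<sigma> \<tau>))" if "\<And>S. c' S = 0 \<Longrightarrow> g S = 0" for g :: "_ \<Rightarrow> real"
  proof -
    have "(\<Sum>S\<in>Pow A. g S) = (\<Sum>S\<in>\<sigma> ` T. g S)"
      using A that by (intro sum.mono_neutral_right) (auto simp: A_def c'_def)
    then show ?thesis using inj by (simp add: sum.reindex)
  qed
  have "mpoly c' A = (\<lambda>\<omega>. \<Sum>\<tau>\<in>T. c \<tau> * (\<Prod>i\<in>\<sigma> \<tau>. Z i \<omega>))"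
    unfolding mpoly_def by (subst re) (auto simp: c' intro!: sum.cong)
  moreover have "(\<Sum>S\<in>Pow A. c' S ^ 2) = (\<Sum>\<tau>\<in>T. c \<tau> ^ 2)"
    by (subst re) (auto simp: c' intro!: sum.cong)
  moreover have "card S \<le> d" if "c' S \<noteq> 0" for S
    using that \<sigma> by (auto simp: c'_def split: if_splits)
  ultimately show "integrable M (\<lambda>\<omega>. (\<Sum>\<tau>\<in>T. c \<tau> * (\<Prod>i\<in>\<sigma> \<tau>. Z i \<omega>)) ^ 4)"
    "(LINT \<omega>|M. (\<Sum>\<tau>\<in>T. c \<tau> * (\<Prod>i\<in>\<sigma> \<tau>. Z i \<omega>)) ^ 4) \<le> (m + 4) ^ (2 * d) * (\<Sum>\<tau>\<in>T. c \<tau> ^ 2) ^ 2"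
    using mpoly_fourth_moment[OF A, of c' d] by auto
qed

end

section \<open>Characteristic functions of sums with conditionally centred increments\<close>

lemma exp_minus_quadratic_bound:
  fixes x :: real
  assumes "0 \<le> x"
  shows "\<bar>exp (- x) - (1 - x)\<bar> \<le> x\<^sup>2 / 2"
proof -
  have pos: "0 < 1 + x + x\<^sup>2 / 2" using assms by (simp add: add_pos_nonneg)
  have "(1 + x + x\<^sup>2 / 2) * (1 - x + x\<^sup>2 / 2) = 1 + x ^ 4 / 4"
    by (simp add: power4_eq_xxxx power2_eq_square field_simps)
  then have "1 \<le> (1 - x + x\<^sup>2 / 2) * (1 + x + x\<^sup>2 / 2)" by (simp add: mult.commute)
  then have "1 / (1 + x + x\<^sup>2 / 2) \<le> 1 - x + x\<^sup>2 / 2"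
    using pos by (simp add: divide_le_eq)
  moreover have "exp (- x) \<le> 1 / (1 + x + x\<^sup>2 / 2)"
    using exp_lower_Taylor_quadratic[OF assms] pos by (simp add: exp_minus inverse_eq_divide frac_le)
  moreover have "1 - x \<le> exp (- x)" using exp_ge_add_one_self[of "- x"] by simp
  ultimately show ?thesis by (simp add: abs_le_iff)
qed

lemma iexp_quadratic_bound:
  "cmod (iexp x - (1 + \<i> * of_real x - of_real (x\<^sup>2) / 2)) \<le> \<bar>x\<bar> ^ 3 / 6"
proof -
  have "(\<Sum>k\<le>2. (\<i> * of_real x) ^ k / fact k) = 1 + \<i> * of_real x - of_real (x\<^sup>2) / (2 :: complex)"
    by (simp add: numeral_2_eq_2 power2_eq_square field_simps)
  then show ?thesis using iexp_approx1[of x 2] by (simp add: numeral_3_eq_3 fact_numeral)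
qed

lemma abs_cube_le_weighted:
  fixes x \<epsilon> :: real
  assumes "0 < \<epsilon>"
  shows "\<bar>x\<bar> ^ 3 \<le> (\<epsilon> * x ^ 2 + x ^ 4 / \<epsilon>) / 2"
proof -
  have "0 \<le> \<bar>x\<bar>\<^sup>2 * (\<epsilon> - \<bar>x\<bar>)\<^sup>2 / \<epsilon>" using assms by simp
  also have "\<dots> = \<epsilon> * \<bar>x\<bar> ^ 2 + \<bar>x\<bar> ^ 4 / \<epsilon> - 2 * \<bar>x\<bar> ^ 3"
    using assms by (simp add: power4_eq_xxxx power3_eq_cube power2_eq_square field_simps)
  finally show ?thesis by simp
qed

context prob_space
begin

text \<open>
Let \<open>U\<^sub>t\<close> be the exponential of the partial sum before step \<open>t\<close>. Taylor expansion gives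
\<open>E[U\<^sub>t exp (i \<theta> D\<^sub>t)] \<approx> (1 - \<theta>\<^sup>2 E[D\<^sub>t\<^sup>2] / 2) E[U\<^sub>t]\<close>, because the linear term vanishes and replacing
\<open>D\<^sub>t\<^sup>2\<close> by its mean costs at most \<open>d t\<close>; the first factor is close to \<open>exp (- \<theta>\<^sup>2 E[D\<^sub>t\<^sup>2] / 2)\<close>. The errors
add up, since the remaining factors have modulus at most \<open>1\<close>. The third absolute moment is traded for the second and the
fourth with the weight \<open>\<epsilon>\<close>.
\<close>

lemma char_function_martingale_bound:
  fixes D :: "nat \<Rightarrow> 'a \<Rightarrow> real" and \<theta> \<epsilon> :: real
  assumes meas: "\<And>t. t \<in> {1..n} \<Longrightarrow> D t \<in> borel_measurable M"
    and D4: "\<And>t. t \<in> {1..n} \<Longrightarrow> integrable M (\<lambda>\<omega>. D t \<omega> ^ 4)"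
    and centred: "\<And>t. t \<in> {1..n} \<Longrightarrow> (LINT \<omega>|M. iexp (\<theta> * (\<Sum>s\<in>{1..<t}. D s \<omega>)) * of_real (D t \<omega>)) = 0"
    and var: "\<And>t. t \<in> {1..n} \<Longrightarrow> cmod (LINT \<omega>|M. iexp (\<theta> * (\<Sum>s\<in>{1..<t}. D s \<omega>)) *
        of_real (D t \<omega> ^ 2 - (LINT \<omega>'|M. D t \<omega>' ^ 2))) \<le> d t"
    and \<epsilon>: "0 < \<epsilon>"
  shows "cmod ((LINT \<omega>|M. iexp (\<theta> * (\<Sum>t\<in>{1..n}. D t \<omega>))) - of_real (exp (- (\<theta>\<^sup>2 / 2 * (\<Sum>t\<in>{1..n}. LINT \<omega>|M. D t \<omega> ^ 2)))))
    \<le> (\<Sum>t\<in>{1..n}. \<bar>\<theta>\<bar> ^ 3 / 12 * (\<epsilon> * (LINT \<omega>|M. D t \<omega> ^ 2) + (LINT \<omega>|M. D t \<omega> ^ 4) / \<epsilon>)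
          + \<theta>\<^sup>2 / 2 * d t + \<theta> ^ 4 / 8 * (LINT \<omega>|M. D t \<omega> ^ 4))"
  using meas D4 centred var
proof (induction n)
  case 0
  then show ?case by (simp add: prob_space)
next
  case (Suc n)
  define S where "S \<omega> = (\<Sum>t\<in>{1..n}. D t \<omega>)" for \<omega>
  define U where "U \<omega> = iexp (\<theta> * S \<omega>)" for \<omega>
  define X where "X = D (Suc n)"
  define \<tau> where "\<tau> = (LINT \<omega>|M. X \<omega> ^ 2)"
  define \<kappa> where "\<kappa> = (LINT \<omega>|M. X \<omega> ^ 4)"
  define x where "x = \<theta>\<^sup>2 / 2 * \<tau>"
  define e where "e = exp (- (\<theta>\<^sup>2 / 2 * (\<Sum>t\<in>{1..n}. LINT \<omega>|M. D t \<omega> ^ 2)))"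
  have in1: "{1..<Suc n} = {1..n}" by auto
  have [measurable]: "S \<in> borel_measurable M" "X \<in> borel_measurable M"
    using Suc.prems(1) by (auto simp: S_def[abs_def] X_def intro!: borel_measurable_sum)
  then have [measurable]: "U \<in> borel_measurable M" unfolding U_def by measurable
  have nU: "cmod (U \<omega>) = 1" for \<omega> by (simp add: U_def)
  have X4: "integrable M (\<lambda>\<omega>. X \<omega> ^ 4)" using Suc.prems(2)[of "Suc n"] by (simp add: X_def)
  have Xp: "integrable M (\<lambda>\<omega>. X \<omega> ^ k)" if "k \<le> 4" for k
    using integrable_power_le[OF _ X4 that] by simp
  have UX: "integrable M (\<lambda>\<omega>. U \<omega> * of_real (g \<omega>))" if "integrable M g" for g
    by (rule Bochner_Integration.integrable_bound[OF that])
       (use that borel_measurable_integrable[OF that] nU in \<open>auto simp: norm_mult\<close>)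
  have U0: "(LINT \<omega>|M. U \<omega> * of_real (X \<omega>)) = 0"
    using Suc.prems(3)[of "Suc n", unfolded in1] by (simp add: U_def S_def X_def)
  have U2: "cmod (LINT \<omega>|M. U \<omega> * of_real (X \<omega> ^ 2 - \<tau>)) \<le> d (Suc n)"
    using Suc.prems(4)[of "Suc n", unfolded in1] by (simp add: U_def S_def X_def \<tau>_def)
  have iU: "integrable M U" using UX[of "\<lambda>_. 1"] by simp
  have uU: "cmod (LINT \<omega>|M. U \<omega>) \<le> 1"
    using integral_norm_bound[of M U] by (simp add: nU prob_space)
  define rest where "rest \<omega> = iexp (\<theta> * X \<omega>) - (1 + \<i> * of_real (\<theta> * X \<omega>) - of_real ((\<theta> * X \<omega>)\<^sup>2) / 2)" for \<omega>
  have [measurable]: "rest \<in> borel_measurable M" unfolding rest_def by measurable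
  have rb: "cmod (rest \<omega>) \<le> \<bar>\<theta>\<bar> ^ 3 / 12 * (\<epsilon> * X \<omega> ^ 2 + X \<omega> ^ 4 / \<epsilon>)" for \<omega>
  proof -
    have "cmod (rest \<omega>) \<le> \<bar>\<theta> * X \<omega>\<bar> ^ 3 / 6" unfolding rest_def by (rule iexp_quadratic_bound)
    also have "\<dots> = \<bar>\<theta>\<bar> ^ 3 / 6 * \<bar>X \<omega>\<bar> ^ 3" by (simp add: abs_mult power_mult_distrib)
    also have "\<dots> \<le> \<bar>\<theta>\<bar> ^ 3 / 6 * ((\<epsilon> * X \<omega> ^ 2 + X \<omega> ^ 4 / \<epsilon>) / 2)"
      by (intro mult_left_mono abs_cube_le_weighted \<epsilon>) auto
    finally show ?thesis by simp
  qed
  have ib: "integrable M (\<lambda>\<omega>. \<bar>\<theta>\<bar> ^ 3 / 12 * (\<epsilon> * X \<omega> ^ 2 + X \<omega> ^ 4 / \<epsilon>))"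
    using Xp[of 2] X4 by auto
  have iUr: "integrable M (\<lambda>\<omega>. U \<omega> * rest \<omega>)"
    by (rule Bochner_Integration.integrable_bound[OF ib])
      (use order_trans[OF rb abs_ge_self] in \<open>auto simp: norm_mult nU\<close>)
  have "cmod (LINT \<omega>|M. U \<omega> * rest \<omega>) \<le> (LINT \<omega>|M. \<bar>\<theta>\<bar> ^ 3 / 12 * (\<epsilon> * X \<omega> ^ 2 + X \<omega> ^ 4 / \<epsilon>))"
    by (rule order_trans[OF integral_norm_bound integral_mono[OF integrable_norm[OF iUr] ib]])
      (use rb in \<open>auto simp: norm_mult nU\<close>)
  also have "\<dots> = \<bar>\<theta>\<bar> ^ 3 / 12 * (\<epsilon> * \<tau> + \<kappa> / \<epsilon>)"
    using Xp[of 2] X4 by (simp add: \<tau>_def \<kappa>_def)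
  finally have t1: "cmod (LINT \<omega>|M. U \<omega> * rest \<omega>) \<le> \<bar>\<theta>\<bar> ^ 3 / 12 * (\<epsilon> * \<tau> + \<kappa> / \<epsilon>)" .
  have dec: "iexp (\<theta> * (\<Sum>t\<in>{1..Suc n}. D t \<omega>)) =
    U \<omega> * rest \<omega> + of_real (1 - x) * U \<omega> + \<i> * of_real \<theta> * (U \<omega> * of_real (X \<omega>))
      - of_real (\<theta>\<^sup>2 / 2) * (U \<omega> * of_real (X \<omega> ^ 2 - \<tau>))" for \<omega>
  proof -
    have "iexp (\<theta> * (\<Sum>t\<in>{1..Suc n}. D t \<omega>)) = U \<omega> * iexp (\<theta> * X \<omega>)"
      by (simp add: U_def S_def X_def exp_add[symmetric] algebra_simps)
    also have "iexp (\<theta> * X \<omega>) = rest \<omega> + (1 + \<i> * of_real (\<theta> * X \<omega>) - of_real ((\<theta> * X \<omega>)\<^sup>2) / 2)"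
      by (simp add: rest_def)
    finally show ?thesis by (simp add: x_def algebra_simps power_mult_distrib)
  qed
  have i3: "integrable M (\<lambda>\<omega>. U \<omega> * of_real (X \<omega>))" using UX[OF Xp[of 1]] by simp
  have i4: "integrable M (\<lambda>\<omega>. U \<omega> * of_real (X \<omega> ^ 2 - \<tau>))"
    using UX[OF Bochner_Integration.integrable_diff[OF Xp[of 2]]] by simp
  have E: "(LINT \<omega>|M. iexp (\<theta> * (\<Sum>t\<in>{1..Suc n}. D t \<omega>))) =
    (LINT \<omega>|M. U \<omega> * rest \<omega>) + of_real (1 - x) * (LINT \<omega>|M. U \<omega>) + \<i> * of_real \<theta> * (LINT \<omega>|M. U \<omega> * of_real (X \<omega>))
      - of_real (\<theta>\<^sup>2 / 2) * (LINT \<omega>|M. U \<omega> * of_real (X \<omega> ^ 2 - \<tau>))"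
    unfolding dec
    by (simp only: Bochner_Integration.integral_add Bochner_Integration.integral_diff integral_mult_right_zero
        iU iUr i3 i4 Bochner_Integration.integrable_add integrable_mult_right)
  have "\<tau> \<ge> 0" by (auto simp: \<tau>_def intro!: integral_nonneg_AE)
  then have x0: "x \<ge> 0" by (simp add: x_def)
  \<comment> \<open>The squared Gaussian exponent is absorbed by the fourth moment.\<close>
  have "\<tau>\<^sup>2 \<le> \<kappa>"
    using expectation_Cauchy_Schwarz[of "\<lambda>\<omega>. X \<omega> ^ 2" "\<lambda>_. 1"] X4 by (simp add: \<tau>_def \<kappa>_def prob_space)
  then have "x\<^sup>2 / 2 \<le> \<theta> ^ 4 / 8 * \<kappa>"
    by (simp add: x_def power_mult_distrib power_divide mult_left_mono flip: power_mult)
  then have t2: "cmod (of_real (1 - x) - of_real (exp (- x)) :: complex) \<le> \<theta> ^ 4 / 8 * \<kappa>"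
    using exp_minus_quadratic_bound[OF x0] by (simp add: abs_minus_commute flip: of_real_diff)
  have IH: "cmod ((LINT \<omega>|M. U \<omega>) - of_real e)
    \<le> (\<Sum>t\<in>{1..n}. \<bar>\<theta>\<bar> ^ 3 / 12 * (\<epsilon> * (LINT \<omega>|M. D t \<omega> ^ 2) + (LINT \<omega>|M. D t \<omega> ^ 4) / \<epsilon>)
          + \<theta>\<^sup>2 / 2 * d t + \<theta> ^ 4 / 8 * (LINT \<omega>|M. D t \<omega> ^ 4))" (is "_ \<le> ?B")
    unfolding U_def S_def e_def by (rule Suc.IH) (use Suc.prems in auto)
  have ex: "exp (- (\<theta>\<^sup>2 / 2 * (\<Sum>t\<in>{1..Suc n}. LINT \<omega>|M. D t \<omega> ^ 2))) = e * exp (- x)"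
    by (simp add: e_def x_def \<tau>_def X_def exp_add[symmetric] algebra_simps)
  have "(LINT \<omega>|M. iexp (\<theta> * (\<Sum>t\<in>{1..Suc n}. D t \<omega>))) - of_real (e * exp (- x)) =
    (LINT \<omega>|M. U \<omega> * rest \<omega>) - of_real (\<theta>\<^sup>2 / 2) * (LINT \<omega>|M. U \<omega> * of_real (X \<omega> ^ 2 - \<tau>))
    + (of_real (1 - x) - of_real (exp (- x))) * (LINT \<omega>|M. U \<omega>) + of_real (exp (- x)) * ((LINT \<omega>|M. U \<omega>) - of_real e)"
    unfolding E U0 by (simp add: algebra_simps)
  also have "cmod \<dots> \<le> cmod (LINT \<omega>|M. U \<omega> * rest \<omega>) + cmod (of_real (\<theta>\<^sup>2 / 2) * (LINT \<omega>|M. U \<omega> * of_real (X \<omega> ^ 2 - \<tau>)))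
    + cmod ((of_real (1 - x) - of_real (exp (- x))) * (LINT \<omega>|M. U \<omega>)) + cmod (of_real (exp (- x)) * ((LINT \<omega>|M. U \<omega>) - of_real e))"
    by (intro order_trans[OF norm_triangle_ineq] add_mono norm_triangle_ineq4 order_refl)
  also have "\<dots> \<le> \<bar>\<theta>\<bar> ^ 3 / 12 * (\<epsilon> * \<tau> + \<kappa> / \<epsilon>) + \<theta>\<^sup>2 / 2 * d (Suc n) + \<theta> ^ 4 / 8 * \<kappa> + ?B"
  proof (intro add_mono t1)
    show "cmod (of_real (\<theta>\<^sup>2 / 2) * (LINT \<omega>|M. U \<omega> * of_real (X \<omega> ^ 2 - \<tau>))) \<le> \<theta>\<^sup>2 / 2 * d (Suc n)"
      unfolding norm_mult norm_of_real using U2 by (intro mult_mono) auto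
    show "cmod ((of_real (1 - x) - of_real (exp (- x))) * (LINT \<omega>|M. U \<omega>)) \<le> \<theta> ^ 4 / 8 * \<kappa>"
      unfolding norm_mult using mult_mono[OF t2 uU] order_trans[OF norm_ge_zero t2] by simp
    have "cmod (of_real (exp (- x)) * ((LINT \<omega>|M. U \<omega>) - of_real e)) \<le> 1 * cmod ((LINT \<omega>|M. U \<omega>) - of_real e)"
      unfolding norm_mult norm_of_real using x0 by (intro mult_right_mono) auto
    with IH show "cmod (of_real (exp (- x)) * ((LINT \<omega>|M. U \<omega>) - of_real e)) \<le> ?B" by simp
  qed
  finally show ?case unfolding ex by (simp add: \<tau>_def \<kappa>_def X_def algebra_simps)
qed

end

section \<open>Sums over pairs of indices\<close>

definition pairs :: "nat \<Rightarrow> (nat \<times> nat) set" where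
  "pairs n = {(i, j). 1 \<le> i \<and> i < j \<and> j \<le> n}"

lemma pairs_eq_Sigma: "pairs n = prod.swap ` (SIGMA j:{1..n}. {1..<j})"
  by (auto simp: pairs_def image_iff)

lemma finite_pairs [simp]: "finite (pairs n)"
  by (auto simp: pairs_eq_Sigma)

lemma sum_pairs: "(\<Sum>(i, j)\<in>pairs n. g i j) = (\<Sum>j\<in>{1..n}. \<Sum>i\<in>{1..<j}. g i j)"
  unfolding pairs_eq_Sigma by (subst sum.reindex) (auto simp: sum.Sigma inj_on_def intro!: sum.cong)

lemma sum_square_pairs:
  fixes g :: "nat \<Rightarrow> nat \<Rightarrow> real"
  assumes "\<And>i j. g i j = g j i"
  shows "(\<Sum>i\<in>{1..n}. \<Sum>j\<in>{1..n}. g i j) = (\<Sum>i\<in>{1..n}. g i i) + 2 * (\<Sum>(i, j)\<in>pairs n. g i j)"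
proof (induction n)
  case 0
  then show ?case by (simp add: sum_pairs)
next
  case (Suc n)
  have in1: "{1..<Suc n} = {1..n}" by auto
  have "(\<Sum>i\<in>{1..Suc n}. \<Sum>j\<in>{1..Suc n}. g i j) =
    (\<Sum>i\<in>{1..n}. \<Sum>j\<in>{1..n}. g i j) + (\<Sum>i\<in>{1..n}. g i (Suc n)) + (\<Sum>j\<in>{1..n}. g (Suc n) j) + g (Suc n) (Suc n)"
    by (simp add: sum.distrib)
  also have "(\<Sum>j\<in>{1..n}. g (Suc n) j) = (\<Sum>i\<in>{1..n}. g i (Suc n))" by (simp add: assms[of "Suc n"])
  finally have "(\<Sum>i\<in>{1..Suc n}. \<Sum>j\<in>{1..Suc n}. g i j) =
    (\<Sum>i\<in>{1..n}. \<Sum>j\<in>{1..n}. g i j) + 2 * (\<Sum>i\<in>{1..n}. g i (Suc n)) + g (Suc n) (Suc n)" by simp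
  moreover have "(\<Sum>(i, j)\<in>pairs (Suc n). g i j) = (\<Sum>(i, j)\<in>pairs n. g i j) + (\<Sum>i\<in>{1..n}. g i (Suc n))"
    unfolding sum_pairs using in1 by simp
  ultimately show ?case unfolding Suc by simp
qed

lemma square_sum_pairs:
  fixes x :: "nat \<Rightarrow> real"
  shows "(\<Sum>i\<in>{1..n}. x i)\<^sup>2 = (\<Sum>i\<in>{1..n}. (x i)\<^sup>2) + 2 * (\<Sum>(i, j)\<in>pairs n. x i * x j)"
  using sum_square_pairs[of "\<lambda>i j. x i * x j" n] by (simp add: power2_eq_square sum_product mult.commute)

lemma card_pairs: "2 * real (card (pairs n)) = real n * (real n - 1)"
  using sum_square_pairs[of "\<lambda>_ _. 1" n] by (simp add: algebra_simps)

lemma card_pairs_le: "real (card (pairs n)) \<le> (real n)\<^sup>2 / 2"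
  using card_pairs[of n] by (simp add: power2_eq_square algebra_simps)

lemma sum_pairs_add:
  fixes y :: "nat \<Rightarrow> real"
  shows "(\<Sum>(i, j)\<in>pairs n. y i + y j) = (real n - 1) * (\<Sum>i\<in>{1..n}. y i)"
  using sum_square_pairs[of "\<lambda>i j. y i + y j" n] by (simp add: sum.distrib algebra_simps sum_distrib_left[symmetric] sum_distrib_right[symmetric])

text \<open>
The effect of the substitution \<open>x\<^sup>2 = 1 + y\<close>: every index lies in \<open>n - 1\<close> pairs.
\<close>

lemma sum_pairs_squares:
  fixes x :: "nat \<Rightarrow> real"
  shows "(\<Sum>(i, j)\<in>pairs n. (x i)\<^sup>2 * (x j)\<^sup>2) = real (card (pairs n)) +
    (real n - 1) * (\<Sum>i\<in>{1..n}. (x i)\<^sup>2 - 1) + (\<Sum>(i, j)\<in>pairs n. ((x i)\<^sup>2 - 1) * ((x j)\<^sup>2 - 1))"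
proof -
  have "(x i)\<^sup>2 * (x j)\<^sup>2 = 1 + (((x i)\<^sup>2 - 1) + ((x j)\<^sup>2 - 1)) + ((x i)\<^sup>2 - 1) * ((x j)\<^sup>2 - 1)" for i j
    by (simp add: algebra_simps)
  then have "(\<Sum>(i, j)\<in>pairs n. (x i)\<^sup>2 * (x j)\<^sup>2) =
    (\<Sum>e\<in>pairs n. 1 + (case e of (i, j) \<Rightarrow> ((x i)\<^sup>2 - 1) + ((x j)\<^sup>2 - 1)) + (case e of (i, j) \<Rightarrow> ((x i)\<^sup>2 - 1) * ((x j)\<^sup>2 - 1)))"
    by (intro sum.cong) auto
  also have "\<dots> = real (card (pairs n)) + (\<Sum>(i, j)\<in>pairs n. ((x i)\<^sup>2 - 1) + ((x j)\<^sup>2 - 1)) + (\<Sum>(i, j)\<in>pairs n. ((x i)\<^sup>2 - 1) * ((x j)\<^sup>2 - 1))"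
    by (simp only: sum.distrib) simp
  finally show ?thesis unfolding sum_pairs_add .
qed

lemma pairs_doubleton_eq: "(i, j) \<in> pairs p \<Longrightarrow> (k, l) \<in> pairs q \<Longrightarrow> {i, j} = {k, l} \<longleftrightarrow> i = k \<and> j = l"
  by (auto simp: pairs_def doubleton_eq_iff)

lemma times_eqD:
  assumes "A \<times> B = C \<times> D" "A \<noteq> {}" "B \<noteq> {}"
  shows "A = C \<and> B = D"
  using assms by (auto simp: times_eq_iff)

text \<open>
A cycle through two rows and two columns is determined by its set of four entries, hence the monomials of the
cycle sum are distinct.
\<close>

lemma inj_on_block: "inj_on (\<lambda>((i, j), (s, t)). {i, j} \<times> {s, t}) (pairs p \<times> pairs n)"
proof (rule inj_onI, clarsimp simp del: insert_Times_insert)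
  fix i j s t i' j' s' t'
  assume p: "(i, j) \<in> pairs p" "(s, t) \<in> pairs n" "(i', j') \<in> pairs p" "(s', t') \<in> pairs n"
    and "{i, j} \<times> {s, t} = {i', j'} \<times> {s', t'}"
  then have "{i, j} = {i', j'}" "{s, t} = {s', t'}"
    using times_eqD[OF _ insert_not_empty insert_not_empty] by blast+
  with p show "i = i' \<and> j = j' \<and> s = s' \<and> t = t'" by (simp add: pairs_doubleton_eq)
qed

section \<open>The array and its elementary sums\<close>

locale iid_array = prob_space M for M :: "'a measure" +
  fixes \<xi> :: "'a \<Rightarrow> real" and Z :: "nat \<times> nat \<Rightarrow> 'a \<Rightarrow> real"
  assumes \<xi>_measurable [measurable]: "\<xi> \<in> borel_measurable M"
    and indep_entries: "indep_vars (\<lambda>_. borel) Z ({1..} \<times> {1..})"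
    and distr_entry: "\<And>c. c \<in> {1..} \<times> {1..} \<Longrightarrow> distr M borel (Z c) = distr M borel \<xi>"
    and \<xi>_mean: "(LINT \<omega>|M. \<xi> \<omega>) = 0"
    and \<xi>_var: "(LINT \<omega>|M. \<xi> \<omega> ^ 2) = 1"
    and \<xi>_fourth: "integrable M (\<lambda>\<omega>. \<xi> \<omega> ^ 4)"
begin

abbreviation entries :: "(nat \<times> nat) set" where "entries \<equiv> {1..} \<times> {1..}"

definition m4 :: real where "m4 = (LINT \<omega>|M. \<xi> \<omega> ^ 4)"

abbreviation Y :: "nat \<times> nat \<Rightarrow> 'a \<Rightarrow> real" where "Y c \<omega> \<equiv> (Z c \<omega>)\<^sup>2 - 1"

lemma \<xi>_power: "k \<le> 4 \<Longrightarrow> integrable M (\<lambda>\<omega>. \<xi> \<omega> ^ k)"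
  using integrable_power_le[OF _ \<xi>_fourth] by simp

lemma Z_measurable: "c \<in> entries \<Longrightarrow> Z c \<in> borel_measurable M"
  using indep_entries by (auto simp: indep_vars_def)

lemma
  fixes g :: "real \<Rightarrow> real"
  assumes c: "c \<in> entries" and [measurable]: "g \<in> borel_measurable borel"
  shows expectation_entry: "(LINT \<omega>|M. g (Z c \<omega>)) = (LINT \<omega>|M. g (\<xi> \<omega>))"
    and integrable_entry: "integrable M (\<lambda>\<omega>. g (Z c \<omega>)) \<longleftrightarrow> integrable M (\<lambda>\<omega>. g (\<xi> \<omega>))"
  using integral_distr[OF Z_measurable[OF c], of g] integral_distr[OF \<xi>_measurable, of g]
    integrable_distr_eq[OF Z_measurable[OF c], of g] integrable_distr_eq[OF \<xi>_measurable, of g]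
    distr_entry[OF c] by auto

lemma Y_square_integrable: "integrable M (\<lambda>\<omega>. ((\<xi> \<omega>)\<^sup>2 - 1)\<^sup>2)"
  and Y_variance: "(LINT \<omega>|M. ((\<xi> \<omega>)\<^sup>2 - 1)\<^sup>2) = m4 - 1"
proof -
  have *: "((\<xi> \<omega>)\<^sup>2 - 1)\<^sup>2 = \<xi> \<omega> ^ 4 - 2 * \<xi> \<omega> ^ 2 + 1" for \<omega>
    by (simp add: power4_eq_xxxx power2_eq_square algebra_simps)
  show "integrable M (\<lambda>\<omega>. ((\<xi> \<omega>)\<^sup>2 - 1)\<^sup>2)" "(LINT \<omega>|M. ((\<xi> \<omega>)\<^sup>2 - 1)\<^sup>2) = m4 - 1"
    unfolding * using \<xi>_fourth \<xi>_power[of 2] by (auto simp: \<xi>_var m4_def prob_space)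
qed

lemma m4_ge_1: "1 \<le> m4"
  using Y_variance integral_nonneg_AE[where M = M and f = "\<lambda>\<omega>. ((\<xi> \<omega>)\<^sup>2 - 1)\<^sup>2"] by auto

lemma indep_centred_entry_function:
  fixes f :: "real \<Rightarrow> real"
  assumes [measurable]: "f \<in> borel_measurable borel"
    and "integrable M (\<lambda>\<omega>. f (\<xi> \<omega>) ^ 2)" "(LINT \<omega>|M. f (\<xi> \<omega>)) = 0"
  shows "indep_centred M (\<lambda>c \<omega>. f (Z c \<omega>)) entries (LINT \<omega>|M. f (\<xi> \<omega>) ^ 2)"
proof
  show "indep_vars (\<lambda>_. borel) (\<lambda>c \<omega>. f (Z c \<omega>)) entries"
    using indep_vars_compose2[OF indep_entries, of "\<lambda>_. f" "\<lambda>_. borel"] by simp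
qed (use assms in \<open>auto simp: integrable_entry[where g="\<lambda>x. f x ^ 2"] expectation_entry[where g="\<lambda>x. f x ^ 2"] expectation_entry[where g=f]\<close>)

sublocale X: indep_fourth M Z entries m4
proof (intro indep_fourth.intro indep_fourth_axioms.intro)
  show "indep_centred M Z entries 1"
    using indep_centred_entry_function[of "\<lambda>x. x"] \<xi>_power[of 2] \<xi>_mean \<xi>_var by simp
qed (use m4_ge_1 \<xi>_fourth in \<open>auto simp: integrable_entry[where g="\<lambda>x. x ^ 4"] expectation_entry[where g="\<lambda>x. x ^ 4"] m4_def\<close>)

sublocale Y: indep_centred M Y entries "m4 - 1"
  using indep_centred_entry_function[of "\<lambda>x. x\<^sup>2 - 1"] \<xi>_power[of 2] Y_square_integrable Y_variance
  by (simp add: \<xi>_var prob_space)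

text \<open>
The four sums that make up the trace besides the fourth powers. Each is a multilinear polynomial in the \<open>Y\<close> or in the
entries, so its second moment is the number of its monomials times a power of the variance.
\<close>

definition lin_sum :: "nat \<Rightarrow> nat \<Rightarrow> 'a \<Rightarrow> real" where
  "lin_sum p n \<omega> = (\<Sum>c\<in>{1..p} \<times> {1..n}. Y c \<omega>)"

definition row_sum :: "nat \<Rightarrow> nat \<Rightarrow> 'a \<Rightarrow> real" where
  "row_sum p n \<omega> = (\<Sum>i\<in>{1..p}. \<Sum>(s, t)\<in>pairs n. Y (i, s) \<omega> * Y (i, t) \<omega>)"

definition col_sum :: "nat \<Rightarrow> nat \<Rightarrow> 'a \<Rightarrow> real" where
  "col_sum p n \<omega> = (\<Sum>t\<in>{1..n}. \<Sum>(i, j)\<in>pairs p. Y (i, t) \<omega> * Y (j, t) \<omega>)"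

definition cycle_sum :: "nat \<Rightarrow> nat \<Rightarrow> 'a \<Rightarrow> real" where
  "cycle_sum p n \<omega> = (\<Sum>(i, j)\<in>pairs p. \<Sum>(s, t)\<in>pairs n. Z (i, s) \<omega> * Z (j, s) \<omega> * (Z (i, t) \<omega> * Z (j, t) \<omega>))"

lemma
  shows integrable_lin_sum: "integrable M (lin_sum p n)"
    and expectation_lin_sum: "(LINT \<omega>|M. lin_sum p n \<omega>) = 0"
    and integrable_lin_sum_sq: "integrable M (\<lambda>\<omega>. (lin_sum p n \<omega>)\<^sup>2)"
    and expectation_lin_sum_sq: "(LINT \<omega>|M. (lin_sum p n \<omega>)\<^sup>2) = real p * real n * (m4 - 1)"
proof -
  have "lin_sum p n \<omega> = (\<Sum>c\<in>{1..p} \<times> {1..n}. 1 * (\<Prod>c'\<in>{c}. Y c' \<omega>))" for \<omega>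
    by (simp add: lin_sum_def)
  then have "lin_sum p n = (\<lambda>\<omega>. \<Sum>c\<in>{1..p} \<times> {1..n}. 1 * (\<Prod>c'\<in>{c}. Y c' \<omega>))" by (rule ext)
  then show "integrable M (lin_sum p n)" "(LINT \<omega>|M. lin_sum p n \<omega>) = 0"
    "integrable M (\<lambda>\<omega>. (lin_sum p n \<omega>)\<^sup>2)" "(LINT \<omega>|M. (lin_sum p n \<omega>)\<^sup>2) = real p * real n * (m4 - 1)"
    using Y.integrable_multilinear[of "{1..p} \<times> {1..n}" "\<lambda>c. {c}" "\<lambda>_. 1"]
      Y.expectation_multilinear[of "{1..p} \<times> {1..n}" "\<lambda>c. {c}" "\<lambda>_. 1"]
      Y.integrable_multilinear_sq[of "{1..p} \<times> {1..n}" "\<lambda>c. {c}" 1 "\<lambda>_. 1"]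
      Y.expectation_multilinear_sq[of "{1..p} \<times> {1..n}" "\<lambda>c. {c}" 1 "\<lambda>_. 1"]
    by auto
qed

lemma
  shows integrable_row_sum_sq: "integrable M (\<lambda>\<omega>. (row_sum p n \<omega>)\<^sup>2)"
    and integrable_row_sum: "integrable M (row_sum p n)"
    and expectation_row_sum: "(LINT \<omega>|M. row_sum p n \<omega>) = 0"
    and expectation_row_sum_sq: "(LINT \<omega>|M. (row_sum p n \<omega>)\<^sup>2) = real p * real (card (pairs n)) * (m4 - 1)\<^sup>2"
proof -
  let ?\<sigma> = "\<lambda>(i, (s, t)). {i} \<times> {s, t}" and ?T = "{1..p} \<times> pairs n"
  have eq: "row_sum p n \<omega> = (\<Sum>\<tau>\<in>?T. 1 * (\<Prod>c\<in>?\<sigma> \<tau>. Y c \<omega>))" for \<omega>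
    unfolding row_sum_def sum.cartesian_product by (intro sum.cong refl) (auto simp: pairs_def)
  have inj: "inj_on ?\<sigma> ?T"
    by (rule inj_onI) (auto dest!: times_eqD simp: pairs_doubleton_eq simp del: insert_Times_insert)
  have \<sigma>: "?\<sigma> \<tau> \<subseteq> entries \<and> finite (?\<sigma> \<tau>) \<and> card (?\<sigma> \<tau>) = 2" if "\<tau> \<in> ?T" for \<tau>
    using that by (auto simp: pairs_def card_cartesian_product)
  have \<sigma>1: "?\<sigma> \<tau> \<subseteq> entries \<and> finite (?\<sigma> \<tau>) \<and> ?\<sigma> \<tau> \<noteq> {}" if "\<tau> \<in> ?T" for \<tau>
    using \<sigma>[OF that] by fastforce
  show "integrable M (row_sum p n)" "(LINT \<omega>|M. row_sum p n \<omega>) = 0"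
    unfolding eq[abs_def] by (rule Y.integrable_multilinear[OF \<sigma>1] Y.expectation_multilinear[OF \<sigma>1]; assumption)+
  show "integrable M (\<lambda>\<omega>. (row_sum p n \<omega>)\<^sup>2)"
    unfolding eq by (rule Y.integrable_multilinear_sq[OF _ inj \<sigma>]) auto
  show "(LINT \<omega>|M. (row_sum p n \<omega>)\<^sup>2) = real p * real (card (pairs n)) * (m4 - 1)\<^sup>2"
    unfolding eq by (subst Y.expectation_multilinear_sq[OF _ inj \<sigma>]) auto
qed

lemma
  shows integrable_col_sum_sq: "integrable M (\<lambda>\<omega>. (col_sum p n \<omega>)\<^sup>2)"
    and integrable_col_sum: "integrable M (col_sum p n)"
    and expectation_col_sum: "(LINT \<omega>|M. col_sum p n \<omega>) = 0"
    and expectation_col_sum_sq: "(LINT \<omega>|M. (col_sum p n \<omega>)\<^sup>2) = real n * real (card (pairs p)) * (m4 - 1)\<^sup>2"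
proof -
  let ?\<sigma> = "\<lambda>(t, (i, j)). {i, j} \<times> {t}" and ?T = "{1..n} \<times> pairs p"
  have eq: "col_sum p n \<omega> = (\<Sum>\<tau>\<in>?T. 1 * (\<Prod>c\<in>?\<sigma> \<tau>. Y c \<omega>))" for \<omega>
    unfolding col_sum_def sum.cartesian_product by (intro sum.cong refl) (auto simp: pairs_def)
  have inj: "inj_on ?\<sigma> ?T"
    by (rule inj_onI) (auto dest!: times_eqD simp: pairs_doubleton_eq simp del: insert_Times_insert)
  have \<sigma>: "?\<sigma> \<tau> \<subseteq> entries \<and> finite (?\<sigma> \<tau>) \<and> card (?\<sigma> \<tau>) = 2" if "\<tau> \<in> ?T" for \<tau>
    using that by (auto simp: pairs_def card_cartesian_product)
  have \<sigma>1: "?\<sigma> \<tau> \<subseteq> entries \<and> finite (?\<sigma> \<tau>) \<and> ?\<sigma> \<tau> \<noteq> {}" if "\<tau> \<in> ?T" for \<tau>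
    using \<sigma>[OF that] by fastforce
  show "integrable M (col_sum p n)" "(LINT \<omega>|M. col_sum p n \<omega>) = 0"
    unfolding eq[abs_def] by (rule Y.integrable_multilinear[OF \<sigma>1] Y.expectation_multilinear[OF \<sigma>1]; assumption)+
  show "integrable M (\<lambda>\<omega>. (col_sum p n \<omega>)\<^sup>2)"
    unfolding eq by (rule Y.integrable_multilinear_sq[OF _ inj \<sigma>]) auto
  show "(LINT \<omega>|M. (col_sum p n \<omega>)\<^sup>2) = real n * real (card (pairs p)) * (m4 - 1)\<^sup>2"
    unfolding eq by (subst Y.expectation_multilinear_sq[OF _ inj \<sigma>]) auto
qed

lemma prod_block:
  assumes "(i, j) \<in> pairs p" "(s, t) \<in> pairs n"
  shows "(\<Prod>c\<in>{i, j} \<times> {s, t}. Z c \<omega>) = Z (i, s) \<omega> * Z (j, s) \<omega> * (Z (i, t) \<omega> * Z (j, t) \<omega>)"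
proof -
  have "{i, j} \<times> {s, t} = {(i, s), (j, s), (i, t), (j, t)}" by auto
  then show ?thesis using assms by (auto simp: pairs_def)
qed

lemma
  shows integrable_cycle_sum_sq: "integrable M (\<lambda>\<omega>. (cycle_sum p n \<omega>)\<^sup>2)"
    and integrable_cycle_sum: "integrable M (cycle_sum p n)"
    and expectation_cycle_sum: "(LINT \<omega>|M. cycle_sum p n \<omega>) = 0"
    and expectation_cycle_sum_sq: "(LINT \<omega>|M. (cycle_sum p n \<omega>)\<^sup>2) = real (card (pairs p)) * real (card (pairs n))"
proof -
  let ?\<sigma> = "\<lambda>((i, j), (s, t)). {i, j} \<times> {s, t}" and ?T = "pairs p \<times> pairs n"
  have eq: "cycle_sum p n \<omega> = (\<Sum>\<tau>\<in>?T. 1 * (\<Prod>c\<in>?\<sigma> \<tau>. Z c \<omega>))" for \<omega>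
    unfolding cycle_sum_def case_prod_beta sum.cartesian_product
    by (intro sum.cong refl) (auto simp: prod_block simp del: insert_Times_insert)
  have \<sigma>: "?\<sigma> \<tau> \<subseteq> entries \<and> finite (?\<sigma> \<tau>) \<and> card (?\<sigma> \<tau>) = 4" if "\<tau> \<in> ?T" for \<tau>
    using that by (auto simp: pairs_def card_cartesian_product)
  have \<sigma>1: "?\<sigma> \<tau> \<subseteq> entries \<and> finite (?\<sigma> \<tau>) \<and> ?\<sigma> \<tau> \<noteq> {}" if "\<tau> \<in> ?T" for \<tau>
    using \<sigma>[OF that] by fastforce
  show "integrable M (cycle_sum p n)" "(LINT \<omega>|M. cycle_sum p n \<omega>) = 0"
    unfolding eq[abs_def] by (rule X.integrable_multilinear[OF \<sigma>1] X.expectation_multilinear[OF \<sigma>1]; assumption)+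
  show "integrable M (\<lambda>\<omega>. (cycle_sum p n \<omega>)\<^sup>2)"
    unfolding eq by (rule X.integrable_multilinear_sq[OF _ inj_on_block \<sigma>]) auto
  show "(LINT \<omega>|M. (cycle_sum p n \<omega>)\<^sup>2) = real (card (pairs p)) * real (card (pairs n))"
    unfolding eq by (subst X.expectation_multilinear_sq[OF _ inj_on_block \<sigma>]) auto
qed

text \<open>
This expansion is used twice: for the trace itself, and with fewer columns for the conditional variances of the increments.
\<close>

lemma off_diagonal_expansion:
  "(\<Sum>(i, j)\<in>pairs p. (\<Sum>t\<in>{1..n}. Z (i, t) \<omega> * Z (j, t) \<omega>)\<^sup>2) =
    real (card (pairs p)) * real n + (real p - 1) * lin_sum p n \<omega> + col_sum p n \<omega> + 2 * cycle_sum p n \<omega>"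
proof -
  have "(\<Sum>(i, j)\<in>pairs p. (\<Sum>t\<in>{1..n}. Z (i, t) \<omega> * Z (j, t) \<omega>)\<^sup>2) =
    (\<Sum>t\<in>{1..n}. \<Sum>(i, j)\<in>pairs p. (Z (i, t) \<omega>)\<^sup>2 * (Z (j, t) \<omega>)\<^sup>2) + 2 * cycle_sum p n \<omega>"
    unfolding square_sum_pairs cycle_sum_def
    by (subst sum.swap) (simp add: case_prod_beta sum.distrib sum_distrib_left power_mult_distrib)
  also have "(\<Sum>t\<in>{1..n}. \<Sum>(i, j)\<in>pairs p. (Z (i, t) \<omega>)\<^sup>2 * (Z (j, t) \<omega>)\<^sup>2) =
    (\<Sum>t\<in>{1..n}. real (card (pairs p)) + (real p - 1) * (\<Sum>i\<in>{1..p}. Y (i, t) \<omega>) + (\<Sum>(i, j)\<in>pairs p. Y (i, t) \<omega> * Y (j, t) \<omega>))"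
    by (simp only: sum_pairs_squares[where x="\<lambda>i. Z (i, _) \<omega>"])
  also have "\<dots> = real (card (pairs p)) * real n + (real p - 1) * (\<Sum>t\<in>{1..n}. \<Sum>i\<in>{1..p}. Y (i, t) \<omega>) + col_sum p n \<omega>"
    by (simp add: sum.distrib col_sum_def sum_distrib_left[symmetric])
  also have "(\<Sum>t\<in>{1..n}. \<Sum>i\<in>{1..p}. Y (i, t) \<omega>) = lin_sum p n \<omega>"
    unfolding lin_sum_def by (subst sum.swap) (simp add: sum.cartesian_product)
  finally show ?thesis .
qed

lemma diagonal_expansion:
  "(\<Sum>i\<in>{1..p}. (\<Sum>t\<in>{1..n}. (Z (i, t) \<omega>)\<^sup>2)\<^sup>2) =
    (\<Sum>c\<in>{1..p} \<times> {1..n}. Z c \<omega> ^ 4) + 2 * (real p * real (card (pairs n)) + (real n - 1) * lin_sum p n \<omega> + row_sum p n \<omega>)"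
proof -
  have "(\<Sum>i\<in>{1..p}. (\<Sum>t\<in>{1..n}. (Z (i, t) \<omega>)\<^sup>2)\<^sup>2) =
    (\<Sum>i\<in>{1..p}. \<Sum>t\<in>{1..n}. Z (i, t) \<omega> ^ 4) + 2 * (\<Sum>i\<in>{1..p}. \<Sum>(s, t)\<in>pairs n. (Z (i, s) \<omega>)\<^sup>2 * (Z (i, t) \<omega>)\<^sup>2)"
    unfolding square_sum_pairs by (simp add: sum.distrib sum_distrib_left)
  also have "(\<Sum>i\<in>{1..p}. \<Sum>(s, t)\<in>pairs n. (Z (i, s) \<omega>)\<^sup>2 * (Z (i, t) \<omega>)\<^sup>2) =
    (\<Sum>i\<in>{1..p}. real (card (pairs n)) + (real n - 1) * (\<Sum>t\<in>{1..n}. Y (i, t) \<omega>) + (\<Sum>(s, t)\<in>pairs n. Y (i, s) \<omega> * Y (i, t) \<omega>))"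
    by (simp only: sum_pairs_squares[where x="\<lambda>t. Z (_, t) \<omega>"])
  also have "\<dots> = real p * real (card (pairs n)) + (real n - 1) * lin_sum p n \<omega> + row_sum p n \<omega>"
    by (simp add: sum.distrib row_sum_def sum_distrib_left[symmetric] lin_sum_def sum.cartesian_product)
  finally show ?thesis by (simp add: sum.cartesian_product)
qed

end

section \<open>The increments contributed by the columns\<close>

lemma sum_fourth_le: "((x::real) + y) ^ 4 \<le> 8 * (x ^ 4 + y ^ 4)"
proof -
  have "(x + y) ^ 4 = ((x + y)\<^sup>2)\<^sup>2" by simp
  also have "\<dots> \<le> (2 * (x\<^sup>2 + y\<^sup>2))\<^sup>2"
    using sum_squares_bound[of x y] by (intro power_mono zero_le_power2) (simp add: power2_sum)
  also have "\<dots> \<le> 8 * (x ^ 4 + y ^ 4)"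
    using sum_squares_bound[of "x\<^sup>2" "y\<^sup>2"] by (simp add: power2_sum power_mult_distrib flip: power_mult)
  finally show ?thesis .
qed

text \<open>
The function \<open>f\<close> stands for a truncation of \<open>x\<^sup>2 - 1\<close>. Without a bound the linear part of an increment would
need eight moments of the entries.
\<close>

locale truncated_array = iid_array +
  fixes f :: "real \<Rightarrow> real" and B :: real
  assumes f_measurable [measurable]: "f \<in> borel_measurable borel"
    and f_bounded: "\<And>x. \<bar>f x\<bar> \<le> B"
    and f_centred: "(LINT \<omega>|M. f (\<xi> \<omega>)) = 0"
begin

definition w :: real where "w = (LINT \<omega>|M. f (\<xi> \<omega>) ^ 2)"

lemma B_nonneg: "0 \<le> B" using f_bounded[of 0] by linarith

lemma w_nonneg: "0 \<le> w" unfolding w_def by (auto intro!: integral_nonneg_AE)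

lemma f_bounded_power: "\<bar>f x ^ k\<bar> \<le> B ^ k"
  using power_mono[OF f_bounded, of x k] by (simp add: power_abs)

lemma integrable_f_power: "integrable M (\<lambda>\<omega>. f (\<xi> \<omega>) ^ k)"
  using f_bounded_power by (intro integrable_const_bound[where B="B ^ k"]) auto

sublocale F: indep_centred M "\<lambda>c \<omega>. f (Z c \<omega>)" entries w
  unfolding w_def by (rule indep_centred_entry_function) (auto simp: integrable_f_power f_centred)

text \<open>
When column \<open>t\<close> is added, the pair of rows \<open>e\<close> contributes the product of the new entries in these rows, weighted by
the inner product of the rows over the earlier columns.
\<close>

definition past_sum :: "nat \<times> nat \<Rightarrow> nat \<Rightarrow> 'a \<Rightarrow> real" where
  "past_sum e t \<omega> = (\<Sum>s\<in>{1..<t}. Z (fst e, s) \<omega> * Z (snd e, s) \<omega>)"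

definition now_prod :: "nat \<times> nat \<Rightarrow> nat \<Rightarrow> 'a \<Rightarrow> real" where
  "now_prod e t \<omega> = Z (fst e, t) \<omega> * Z (snd e, t) \<omega>"

definition lin_part :: "nat \<Rightarrow> nat \<Rightarrow> 'a \<Rightarrow> real" where
  "lin_part p t \<omega> = (\<Sum>i\<in>{1..p}. f (Z (i, t) \<omega>))"

definition quad_part :: "nat \<Rightarrow> nat \<Rightarrow> 'a \<Rightarrow> real" where
  "quad_part p t \<omega> = (\<Sum>e\<in>pairs p. past_sum e t \<omega> * now_prod e t \<omega>)"

definition incr :: "real \<Rightarrow> real \<Rightarrow> nat \<Rightarrow> nat \<Rightarrow> 'a \<Rightarrow> real" where
  "incr a b p t \<omega> = a * lin_part p t \<omega> + b * quad_part p t \<omega>"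

abbreviation past :: "nat \<Rightarrow> (nat \<times> nat) set" where "past t \<equiv> {1..} \<times> {1..<t}"
abbreviation col :: "nat \<Rightarrow> (nat \<times> nat) set" where "col t \<equiv> {1..} \<times> {t}"

lemma sum_incr:
  "(\<Sum>t\<in>{1..n}. incr a b p t \<omega>) = a * (\<Sum>c\<in>{1..p} \<times> {1..n}. f (Z c \<omega>)) + b * cycle_sum p n \<omega>"
proof -
  have "(\<Sum>t\<in>{1..n}. lin_part p t \<omega>) = (\<Sum>c\<in>{1..p} \<times> {1..n}. f (Z c \<omega>))"
    unfolding lin_part_def by (subst sum.swap) (simp add: sum.cartesian_product)
  moreover have "(\<Sum>t\<in>{1..n}. quad_part p t \<omega>) = cycle_sum p n \<omega>"
    unfolding quad_part_def cycle_sum_def sum_pairs[where n=n] past_sum_def now_prod_def case_prod_beta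
    by (subst sum.swap) (simp add: sum_distrib_right)
  ultimately show ?thesis by (simp add: incr_def sum.distrib sum_distrib_left[symmetric])
qed

lemma past_sum_gen: "e \<in> pairs p \<Longrightarrow> past_sum e t \<in> borel_measurable (gen Z (past t))"
  unfolding past_sum_def by (intro borel_measurable_sum borel_measurable_times measurable_gen) (auto simp: pairs_def)

lemma now_prod_gen: "e \<in> pairs p \<Longrightarrow> now_prod e t \<in> borel_measurable (gen Z (col t))"
  unfolding now_prod_def by (intro borel_measurable_times measurable_gen) (auto simp: pairs_def)

lemma f_gen: "c \<in> A \<Longrightarrow> (\<lambda>\<omega>. f (Z c \<omega>)) \<in> borel_measurable (gen Z A)"
  by (rule measurable_compose[OF measurable_gen f_measurable])

lemma lin_part_gen: "lin_part p t \<in> borel_measurable (gen Z (col t))"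
  unfolding lin_part_def by (intro borel_measurable_sum f_gen) auto

lemma incr_gen:
  assumes "1 \<le> t" "t < u"
  shows "incr a b p t \<in> borel_measurable (gen Z (past u))"
proof -
  have "col t \<subseteq> past u" "past t \<subseteq> past u" using assms by auto
  note * = gen_mono[OF this(1) lin_part_gen] gen_mono[OF this(2) past_sum_gen] gen_mono[OF this(1) now_prod_gen]
  show ?thesis unfolding incr_def quad_part_def
    by (intro borel_measurable_add borel_measurable_times borel_measurable_sum borel_measurable_const *)
qed

lemma past_sum_sq_integrable:
  assumes "e \<in> pairs p" shows "integrable M (\<lambda>\<omega>. (past_sum e t \<omega>)\<^sup>2)"
proof -
  have "past_sum e t \<omega> = (\<Sum>s\<in>{1..<t}. 1 * (\<Prod>c\<in>{fst e, snd e} \<times> {s}. Z c \<omega>))" for \<omega>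
    unfolding past_sum_def using assms by (intro sum.cong refl) (auto simp: pairs_def)
  moreover have "integrable M (\<lambda>\<omega>. (\<Sum>s\<in>{1..<t}. 1 * (\<Prod>c\<in>{fst e, snd e} \<times> {s}. Z c \<omega>))\<^sup>2)"
    using assms by (intro X.integrable_multilinear_sq[where d=2]) (auto simp: inj_on_def pairs_def)
  ultimately show ?thesis by simp
qed

lemma now_prod_eq: "e \<in> pairs p \<Longrightarrow> now_prod e t \<omega> = (\<Prod>c\<in>{fst e, snd e} \<times> {t}. Z c \<omega>)"
  by (auto simp: now_prod_def pairs_def)

lemma
  assumes "e \<in> pairs p" "1 \<le> t"
  shows now_prod_integrable: "integrable M (now_prod e t)"
    and now_prod_mean: "(LINT \<omega>|M. now_prod e t \<omega>) = 0"
  unfolding now_prod_eq[OF assms(1), abs_def]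
  using X.integrable_monomial_mult[of "{fst e, snd e} \<times> {t}" "{}"] X.expectation_monomial_mult[of "{fst e, snd e} \<times> {t}" "{}"]
    assms by (auto simp: pairs_def)

lemma
  assumes "e \<in> pairs p" "e' \<in> pairs p" "1 \<le> t"
  shows now_prod_mult_integrable: "integrable M (\<lambda>\<omega>. now_prod e t \<omega> * now_prod e' t \<omega>)"
    and now_prod_mult_mean: "(LINT \<omega>|M. now_prod e t \<omega> * now_prod e' t \<omega>) = (if e = e' then 1 else 0)"
proof -
  have eq: "{fst e, snd e} \<times> {t} = {fst e', snd e'} \<times> {t} \<longleftrightarrow> e = e'"
    using times_eqD[of "{fst e, snd e}" "{t}" "{fst e', snd e'}" "{t}"] assms
      pairs_doubleton_eq[of "fst e" "snd e" p "fst e'" "snd e'" p] by (auto simp: prod_eq_iff)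
  show "integrable M (\<lambda>\<omega>. now_prod e t \<omega> * now_prod e' t \<omega>)"
    unfolding now_prod_eq[OF assms(1)] now_prod_eq[OF assms(2)]
    by (rule X.integrable_monomial_mult) (use assms in \<open>auto simp: pairs_def\<close>)
  have "(LINT \<omega>|M. now_prod e t \<omega> * now_prod e' t \<omega>) =
      (if {fst e, snd e} \<times> {t} = {fst e', snd e'} \<times> {t} then 1 ^ card ({fst e, snd e} \<times> {t}) else 0)"
    unfolding now_prod_eq[OF assms(1)] now_prod_eq[OF assms(2)]
    by (rule X.expectation_monomial_mult) (use assms in \<open>auto simp: pairs_def\<close>)
  then show "(LINT \<omega>|M. now_prod e t \<omega> * now_prod e' t \<omega>) = (if e = e' then 1 else 0)"
    unfolding eq by simp
qed

lemma
  assumes "e \<in> pairs p" "1 \<le> i" "1 \<le> t"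
  shows f_now_prod_integrable: "integrable M (\<lambda>\<omega>. f (Z (i, t) \<omega>) * now_prod e t \<omega>)"
    and f_now_prod_mean: "(LINT \<omega>|M. f (Z (i, t) \<omega>) * now_prod e t \<omega>) = 0"
proof -
  obtain j k where e: "e = (j, k)" "1 \<le> j" "1 \<le> k" "j \<noteq> k" using assms by (cases e) (auto simp: pairs_def)
  \<comment> \<open>One of the two indices of \<open>e\<close> differs from \<open>i\<close>; its entry is independent of the rest.\<close>
  obtain m l where ml: "{m, l} = {j, k}" "m \<noteq> l" "m \<noteq> i" "1 \<le> m" "1 \<le> l" using e by (cases "k = i") auto
  let ?g = "\<lambda>\<omega>. f (Z (i, t) \<omega>) * Z (l, t) \<omega>"
  have eq: "f (Z (i, t) \<omega>) * now_prod e t \<omega> = Z (m, t) \<omega> * ?g \<omega>" for \<omega>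
    using ml e by (auto simp: now_prod_def doubleton_eq_iff)
  have [measurable]: "Z (i, t) \<in> borel_measurable M" "Z (l, t) \<in> borel_measurable M"
    using Z_measurable assms ml by auto
  have ig: "integrable M ?g"
  proof (rule Bochner_Integration.integrable_bound)
    show "integrable M (\<lambda>\<omega>. B * Z (l, t) \<omega>)" using X.Z_integrable[of "(l, t)"] ml assms by auto
    show "AE \<omega> in M. norm (?g \<omega>) \<le> norm (B * Z (l, t) \<omega>)"
      using f_bounded B_nonneg by (auto simp: abs_mult intro!: mult_right_mono)
  qed simp
  have m1: "Z (m, t) \<in> borel_measurable (gen Z {(m, t)})" by (rule measurable_gen) simp
  have m2: "?g \<in> borel_measurable (gen Z {(i, t), (l, t)})"
    by (intro borel_measurable_times f_gen measurable_gen) auto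
  have sub: "{(m, t)} \<subseteq> entries" "{(i, t), (l, t)} \<subseteq> entries" "{(m, t)} \<inter> {(i, t), (l, t)} = {}"
    using ml assms by auto
  have im: "integrable M (Z (m, t))" using X.Z_integrable[of "(m, t)"] sub by auto
  show "integrable M (\<lambda>\<omega>. f (Z (i, t) \<omega>) * now_prod e t \<omega>)"
    unfolding eq by (rule integrable_gen_mult[OF indep_entries sub m1 m2 im ig])
  show "(LINT \<omega>|M. f (Z (i, t) \<omega>) * now_prod e t \<omega>) = 0"
    unfolding eq expectation_gen_mult[OF indep_entries sub m1 m2 im ig]
    using X.mean_zero[of "(m, t)"] sub by simp
qed

lemma
  assumes "1 \<le> t"
  shows lin_part_sq_integrable: "integrable M (\<lambda>\<omega>. (lin_part p t \<omega>)\<^sup>2)"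
    and lin_part_sq_mean: "(LINT \<omega>|M. (lin_part p t \<omega>)\<^sup>2) = real p * w"
proof -
  have eq: "lin_part p t \<omega> = (\<Sum>i\<in>{1..p}. 1 * (\<Prod>c\<in>{(i, t)}. f (Z c \<omega>)))" for \<omega>
    by (simp add: lin_part_def)
  have inj: "inj_on (\<lambda>i. {(i, t)}) {1..p}" by (auto simp: inj_on_def)
  show "integrable M (\<lambda>\<omega>. (lin_part p t \<omega>)\<^sup>2)"
    unfolding eq by (rule F.integrable_multilinear_sq[where d=1, OF _ inj]) (use assms in auto)
  show "(LINT \<omega>|M. (lin_part p t \<omega>)\<^sup>2) = real p * w"
    unfolding eq by (subst F.expectation_multilinear_sq[where d=1, OF _ inj]) (use assms in auto)
qed

lemma lin_part_bounded: "\<bar>lin_part p t \<omega>\<bar> \<le> real p * B"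
proof -
  have "\<bar>lin_part p t \<omega>\<bar> \<le> (\<Sum>i\<in>{1..p}. \<bar>f (Z (i, t) \<omega>)\<bar>)" unfolding lin_part_def by (rule sum_abs)
  also have "\<dots> \<le> (\<Sum>i\<in>{1..p}. B)" by (intro sum_mono f_bounded)
  finally show ?thesis by simp
qed

lemma lin_part_measurable: "1 \<le> t \<Longrightarrow> lin_part p t \<in> borel_measurable M"
  by (rule gen_measurable_M[OF indep_entries _ lin_part_gen]) auto

lemma lin_part_power_integrable: "1 \<le> t \<Longrightarrow> integrable M (\<lambda>\<omega>. lin_part p t \<omega> ^ k)"
  using power_mono[OF lin_part_bounded, of p t _ k] lin_part_measurable[of t p]
  by (intro integrable_const_bound[where B="(real p * B) ^ k"]) (auto simp: power_abs)

text \<open>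
The factor \<open>w\<close> is kept on the right, although \<open>B\<^sup>2\<close> bounds it: it vanishes together with \<open>E[X\<^sup>4] - 1\<close>, and this
covers the degenerate case where the normalised coefficient \<open>a\<close> of the linear part is not bounded.
\<close>

lemma lin_part_fourth:
  assumes t: "1 \<le> t"
  shows "(LINT \<omega>|M. lin_part p t \<omega> ^ 4) \<le> 3 * (real p)\<^sup>2 * (B\<^sup>2 * w)"
proof (induction p)
  case 0
  show ?case by (simp add: lin_part_def)
next
  case (Suc p)
  define g where "g \<omega> = f (Z (Suc p, t) \<omega>)" for \<omega>
  have L: "lin_part (Suc p) t \<omega> = lin_part p t \<omega> + g \<omega>" for \<omega> by (simp add: lin_part_def g_def)
  have c: "(Suc p, t) \<in> entries" using t by simp
  have gp: "(LINT \<omega>|M. g \<omega> ^ k) = (LINT \<omega>|M. f (\<xi> \<omega>) ^ k)" "integrable M (\<lambda>\<omega>. g \<omega> ^ k)" for k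
    using expectation_entry[OF c, of "\<lambda>x. f x ^ k"] integrable_entry[OF c, of "\<lambda>x. f x ^ k"] integrable_f_power
    by (auto simp: g_def)
  have m1: "(\<lambda>\<omega>. lin_part p t \<omega> ^ k) \<in> borel_measurable (gen Z ({1..p} \<times> {t}))" for k
    unfolding lin_part_def by (intro borel_measurable_power borel_measurable_sum f_gen) auto
  have m2: "(\<lambda>\<omega>. g \<omega> ^ k) \<in> borel_measurable (gen Z {(Suc p, t)})" for k
    unfolding g_def by (intro borel_measurable_power f_gen) auto
  have sub: "{1..p} \<times> {t} \<subseteq> entries" "{(Suc p, t)} \<subseteq> entries" "({1..p} \<times> {t}) \<inter> {(Suc p, t)} = {}"
    using t by auto
  define T where "T k l \<omega> = lin_part p t \<omega> ^ k * g \<omega> ^ l" for k l \<omega>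
  have T: "integrable M (T k l)" "(LINT \<omega>|M. T k l \<omega>) = (LINT \<omega>|M. lin_part p t \<omega> ^ k) * (LINT \<omega>|M. f (\<xi> \<omega>) ^ l)" for k l
    using expectation_gen_mult[OF indep_entries sub m1 m2 lin_part_power_integrable[OF t] gp(2), of k l]
      integrable_gen_mult[OF indep_entries sub m1 m2 lin_part_power_integrable[OF t] gp(2), of k l] gp(1)[of l]
    by (simp_all add: T_def[abs_def])
  have exp4: "lin_part (Suc p) t \<omega> ^ 4 = T 4 0 \<omega> + 4 * T 3 1 \<omega> + 6 * T 2 2 \<omega> + 4 * T 1 3 \<omega> + T 0 4 \<omega>" for \<omega>
    unfolding L T_def by (simp add: power4_eq_xxxx power3_eq_cube power2_eq_square algebra_simps)
  have mean: "(LINT \<omega>|M. lin_part p t \<omega> ^ 1) = 0"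
    using F.expectation_multilinear[of "{1..p}" "\<lambda>i. {(i, t)}" "\<lambda>_. 1"] t by (simp add: lin_part_def)
  have "(LINT \<omega>|M. lin_part (Suc p) t \<omega> ^ 4) =
    (LINT \<omega>|M. lin_part p t \<omega> ^ 4) + 6 * ((real p * w) * w) + (LINT \<omega>|M. f (\<xi> \<omega>) ^ 4)"
  proof -
    have "(LINT \<omega>|M. lin_part (Suc p) t \<omega> ^ 4) = (LINT \<omega>|M. T 4 0 \<omega>) + 4 * (LINT \<omega>|M. T 3 1 \<omega>)
      + 6 * (LINT \<omega>|M. T 2 2 \<omega>) + 4 * (LINT \<omega>|M. T 1 3 \<omega>) + (LINT \<omega>|M. T 0 4 \<omega>)"
      unfolding exp4 using T(1) by simp
    then show ?thesis unfolding T(2) using mean lin_part_sq_mean[OF t] f_centred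
      by (simp add: prob_space w_def)
  qed
  also have "\<dots> \<le> 3 * (real p)\<^sup>2 * (B\<^sup>2 * w) + 6 * (real p * (B\<^sup>2 * w)) + B\<^sup>2 * w"
  proof -
    have B2: "f x ^ 2 \<le> B\<^sup>2" for x using f_bounded_power[of x 2] by simp
    have "w \<le> B\<^sup>2"
      using integral_mono[OF integrable_f_power[of 2] integrable_const[of "B\<^sup>2"]] B2 by (simp add: prob_space w_def)
    then have "w * w \<le> B\<^sup>2 * w" using w_nonneg by (rule mult_right_mono)
    then have "real p * w * w \<le> real p * (B\<^sup>2 * w)" by (simp add: mult.assoc mult_left_mono)
    moreover have "(LINT \<omega>|M. f (\<xi> \<omega>) ^ 4) \<le> (LINT \<omega>|M. B\<^sup>2 * f (\<xi> \<omega>) ^ 2)"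
    proof (rule integral_mono[OF integrable_f_power])
      fix \<omega>
      show "f (\<xi> \<omega>) ^ 4 \<le> B\<^sup>2 * f (\<xi> \<omega>) ^ 2"
        using mult_right_mono[OF B2[of "\<xi> \<omega>"] zero_le_power2[of "f (\<xi> \<omega>)"]] by (simp add: power4_eq_xxxx power2_eq_square)
    qed (use integrable_f_power in auto)
    ultimately show ?thesis using Suc by (simp add: w_def)
  qed
  also have "\<dots> \<le> 3 * (real (Suc p))\<^sup>2 * (B\<^sup>2 * w)"
    using w_nonneg B_nonneg by (simp add: power2_eq_square algebra_simps)
  finally show ?case .
qed

lemma
  assumes t: "1 \<le> t"
  shows quad_part_fourth_integrable: "integrable M (\<lambda>\<omega>. quad_part p t \<omega> ^ 4)"
    and quad_part_fourth: "(LINT \<omega>|M. quad_part p t \<omega> ^ 4) \<le> (m4 + 4) ^ 8 * (real (card (pairs p)) * real (t - 1))\<^sup>2"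
proof -
  let ?\<sigma> = "\<lambda>((i::nat, j::nat), s::nat). {i, j} \<times> {s, t}" and ?T = "pairs p \<times> {1..<t}"
  have pr: "(\<Prod>c\<in>{i, j} \<times> {s, t}. Z c \<omega>) = Z (i, s) \<omega> * Z (j, s) \<omega> * (Z (i, t) \<omega> * Z (j, t) \<omega>)"
    if "(i, j) \<in> pairs p" "s \<in> {1..<t}" for i j s \<omega>
    using prod_block[of i j p s t t] that by (auto simp: pairs_def)
  have eq: "quad_part p t \<omega> = (\<Sum>\<tau>\<in>?T. 1 * (\<Prod>c\<in>?\<sigma> \<tau>. Z c \<omega>))" for \<omega>
    unfolding quad_part_def past_sum_def now_prod_def sum_distrib_right sum.cartesian_product
    by (intro sum.cong refl) (auto simp: pr simp del: insert_Times_insert)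
  have inj: "inj_on ?\<sigma> ?T"
  proof -
    have "inj_on ((\<lambda>((i, j), (s, t)). {i, j} \<times> {s, t}) \<circ> (\<lambda>(e, s). (e, (s, t)))) ?T"
      by (rule comp_inj_on[OF _ inj_on_subset[OF inj_on_block[of p t]]]) (auto simp: inj_on_def pairs_def)
    moreover have "(\<lambda>((i, j), (s, t)). {i, j} \<times> {s, t}) \<circ> (\<lambda>(e, s). (e, (s, t))) = ?\<sigma>" by (intro ext) auto
    ultimately show ?thesis by (simp only:)
  qed
  have \<sigma>: "?\<sigma> \<tau> \<subseteq> entries \<and> finite (?\<sigma> \<tau>) \<and> card (?\<sigma> \<tau>) \<le> 4" if "\<tau> \<in> ?T" for \<tau>
    using that by (auto simp: pairs_def card_cartesian_product simp del: insert_Times_insert)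
  show "integrable M (\<lambda>\<omega>. quad_part p t \<omega> ^ 4)"
    unfolding eq by (rule X.integrable_multilinear_fourth[OF _ inj \<sigma>]) auto
  show "(LINT \<omega>|M. quad_part p t \<omega> ^ 4) \<le> (m4 + 4) ^ 8 * (real (card (pairs p)) * real (t - 1))\<^sup>2"
    unfolding eq using X.expectation_multilinear_fourth[OF _ inj \<sigma>, of "\<lambda>_. 1"] by simp
qed

lemma quad_part_measurable: "1 \<le> t \<Longrightarrow> quad_part p t \<in> borel_measurable M"
  unfolding quad_part_def past_sum_def now_prod_def
  by (intro borel_measurable_sum borel_measurable_times Z_measurable) (auto simp: pairs_def)

lemma incr_measurable: "1 \<le> t \<Longrightarrow> incr a b p t \<in> borel_measurable M"
  unfolding incr_def using lin_part_measurable quad_part_measurable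
  by (intro borel_measurable_add borel_measurable_times borel_measurable_const) auto

lemma
  assumes t: "1 \<le> t"
  shows incr_fourth_integrable: "integrable M (\<lambda>\<omega>. incr a b p t \<omega> ^ 4)"
    and incr_fourth: "(LINT \<omega>|M. incr a b p t \<omega> ^ 4) \<le>
      8 * (a ^ 4 * (3 * (real p)\<^sup>2 * (B\<^sup>2 * w)) + b ^ 4 * ((m4 + 4) ^ 8 * (real (card (pairs p)) * real (t - 1))\<^sup>2))"
proof -
  let ?h = "\<lambda>\<omega>. 8 * (a ^ 4 * lin_part p t \<omega> ^ 4 + b ^ 4 * quad_part p t \<omega> ^ 4)"
  have le: "incr a b p t \<omega> ^ 4 \<le> ?h \<omega>" for \<omega>
    unfolding incr_def using sum_fourth_le[of "a * lin_part p t \<omega>" "b * quad_part p t \<omega>"]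
    by (simp add: power_mult_distrib)
  have ih: "integrable M ?h" using quad_part_fourth_integrable[OF t] lin_part_power_integrable[OF t] by auto
  show i: "integrable M (\<lambda>\<omega>. incr a b p t \<omega> ^ 4)"
    by (rule Bochner_Integration.integrable_bound[OF ih])
      (use le order_trans[OF le abs_ge_self] incr_measurable[OF t] in auto)
  have "(LINT \<omega>|M. incr a b p t \<omega> ^ 4) \<le> (LINT \<omega>|M. ?h \<omega>)" by (rule integral_mono[OF i ih le])
  also have "\<dots> = 8 * (a ^ 4 * (LINT \<omega>|M. lin_part p t \<omega> ^ 4) + b ^ 4 * (LINT \<omega>|M. quad_part p t \<omega> ^ 4))"
    using quad_part_fourth_integrable[OF t] lin_part_power_integrable[OF t] by simp
  also have "\<dots> \<le> 8 * (a ^ 4 * (3 * (real p)\<^sup>2 * (B\<^sup>2 * w)) + b ^ 4 * ((m4 + 4) ^ 8 * (real (card (pairs p)) * real (t - 1))\<^sup>2))"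
    by (intro mult_left_mono add_mono lin_part_fourth[OF t] quad_part_fourth[OF t]) auto
  finally show "(LINT \<omega>|M. incr a b p t \<omega> ^ 4) \<le> \<dots>" .
qed

text \<open>
Conditioning on the past in elementary form: a past-measurable weight \<open>U G\<close> is independent of a function \<open>H\<close> of
the new column.
\<close>

lemma
  assumes t: "1 \<le> t" and U: "U \<in> borel_measurable (gen Z (past t))" "\<And>\<omega>. cmod (U \<omega>) \<le> 1"
    and G: "G \<in> borel_measurable (gen Z (past t))" "integrable M G"
    and H: "H \<in> borel_measurable (gen Z (col t))" "integrable M H"
  shows expectation_past_col: "(LINT \<omega>|M. U \<omega> * of_real (G \<omega> * H \<omega>)) = (LINT \<omega>|M. U \<omega> * of_real (G \<omega>)) * of_real (LINT \<omega>|M. H \<omega>)"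
    and integrable_past_col: "integrable M (\<lambda>\<omega>. U \<omega> * of_real (G \<omega> * H \<omega>))"
proof -
  have sub: "past t \<subseteq> entries" "col t \<subseteq> entries" "past t \<inter> col t = {}" using t by auto
  have gU: "(\<lambda>\<omega>. U \<omega> * of_real (G \<omega>)) \<in> borel_measurable (gen Z (past t))" using U(1) G(1) by measurable
  have gH: "(\<lambda>\<omega>. of_real (H \<omega>) :: complex) \<in> borel_measurable (gen Z (col t))" using H(1) by measurable
  have iU: "integrable M (\<lambda>\<omega>. U \<omega> * of_real (G \<omega>))"
  proof (rule Bochner_Integration.integrable_bound[OF G(2)])
    show "(\<lambda>\<omega>. U \<omega> * of_real (G \<omega>)) \<in> borel_measurable M"
      by (rule gen_measurable_M[OF indep_entries sub(1) gU])
    show "AE \<omega> in M. cmod (U \<omega> * of_real (G \<omega>)) \<le> norm (G \<omega>)"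
      using mult_right_mono[OF U(2) abs_ge_zero[of "G _"]] by (intro AE_I2) (simp add: norm_mult)
  qed
  have iH: "integrable M (\<lambda>\<omega>. of_real (H \<omega>) :: complex)" using H(2) by simp
  have eq: "U \<omega> * of_real (G \<omega> * H \<omega>) = (U \<omega> * of_real (G \<omega>)) * of_real (H \<omega>)" for \<omega> by simp
  show "(LINT \<omega>|M. U \<omega> * of_real (G \<omega> * H \<omega>)) = (LINT \<omega>|M. U \<omega> * of_real (G \<omega>)) * of_real (LINT \<omega>|M. H \<omega>)"
    unfolding eq expectation_gen_mult[OF indep_entries sub gU gH iU iH] by simp
  show "integrable M (\<lambda>\<omega>. U \<omega> * of_real (G \<omega> * H \<omega>))"
    unfolding eq by (rule integrable_gen_mult[OF indep_entries sub gU gH iU iH])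
qed

definition past_form :: "nat \<Rightarrow> nat \<Rightarrow> 'a \<Rightarrow> real" where
  "past_form p t \<omega> = (\<Sum>e\<in>pairs p. (past_sum e t \<omega>)\<^sup>2)"

lemma past_sum_mult_integrable:
  assumes "e \<in> pairs p" "e' \<in> pairs p" "1 \<le> t"
  shows "integrable M (\<lambda>\<omega>. past_sum e t \<omega> * past_sum e' t \<omega>)"
proof (rule integrable_mult_of_squares)
  have sub: "past t \<subseteq> entries" by auto
  show "past_sum e t \<in> borel_measurable M" "past_sum e' t \<in> borel_measurable M"
    using gen_measurable_M[OF indep_entries sub past_sum_gen] assms by auto
qed (use past_sum_sq_integrable assms in auto)

lemma past_sum_integrable:
  assumes "e \<in> pairs p" "1 \<le> t"
  shows "integrable M (past_sum e t)"
proof -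
  have sub: "past t \<subseteq> entries" by auto
  show ?thesis
    using integrable_power_le[OF gen_measurable_M[OF indep_entries sub past_sum_gen[OF assms(1)]] past_sum_sq_integrable[OF assms(1)], of 1]
    by simp
qed

lemma incr_centred:
  assumes t: "1 \<le> t" and U: "U \<in> borel_measurable (gen Z (past t))" "\<And>\<omega>. cmod (U \<omega>) \<le> 1"
  shows "(LINT \<omega>|M. U \<omega> * of_real (incr a b p t \<omega>)) = 0"
proof -
  have f: "integrable M (\<lambda>\<omega>. f (Z (i, t) \<omega>))" "(LINT \<omega>|M. f (Z (i, t) \<omega>)) = 0" if "i \<in> {1..p}" for i
    using that t F.Z_integrable[of "(i, t)"] F.mean_zero[of "(i, t)"] by auto
  have eq: "U \<omega> * of_real (incr a b p t \<omega>) = (\<Sum>i\<in>{1..p}. U \<omega> * of_real (a * f (Z (i, t) \<omega>)))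
      + (\<Sum>e\<in>pairs p. U \<omega> * of_real ((b * past_sum e t \<omega>) * now_prod e t \<omega>))" for \<omega>
    by (simp add: incr_def lin_part_def quad_part_def sum_distrib_left algebra_simps)
  have gc: "(\<lambda>_. c) \<in> borel_measurable (gen Z (past t))" "integrable M (\<lambda>_. c)" for c :: real by auto
  have gf: "(\<lambda>\<omega>. f (Z (i, t) \<omega>)) \<in> borel_measurable (gen Z (col t))" if "i \<in> {1..p}" for i
    by (rule f_gen) (use that in auto)
  have 1: "integrable M (\<lambda>\<omega>. U \<omega> * of_real (a * f (Z (i, t) \<omega>)))"
    "(LINT \<omega>|M. U \<omega> * of_real (a * f (Z (i, t) \<omega>))) = 0" if "i \<in> {1..p}" for i
    using expectation_past_col[OF t U gc gf[OF that] f(1)[OF that], of a] integrable_past_col[OF t U gc gf[OF that] f(1)[OF that], of a] f(2)[OF that]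
    by simp_all
  have gA: "(\<lambda>\<omega>. b * past_sum e t \<omega>) \<in> borel_measurable (gen Z (past t))" "integrable M (\<lambda>\<omega>. b * past_sum e t \<omega>)"
    if "e \<in> pairs p" for e
    using past_sum_gen[OF that] past_sum_integrable[OF that t] by auto
  have 2: "integrable M (\<lambda>\<omega>. U \<omega> * of_real ((b * past_sum e t \<omega>) * now_prod e t \<omega>))"
    "(LINT \<omega>|M. U \<omega> * of_real ((b * past_sum e t \<omega>) * now_prod e t \<omega>)) = 0" if "e \<in> pairs p" for e
    using expectation_past_col[OF t U gA[OF that] now_prod_gen[OF that] now_prod_integrable[OF that t]]
      integrable_past_col[OF t U gA[OF that] now_prod_gen[OF that] now_prod_integrable[OF that t]] now_prod_mean[OF that t]
    by auto
  have s: "(LINT \<omega>|M. (\<Sum>x\<in>S. h x \<omega>)) = (0 :: complex)" "integrable M (\<lambda>\<omega>. \<Sum>x\<in>S. h x \<omega>)"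
    if "\<And>x. x \<in> S \<Longrightarrow> integrable M (h x)" "\<And>x. x \<in> S \<Longrightarrow> (LINT \<omega>|M. h x \<omega>) = 0" for S and h :: "'s \<Rightarrow> 'a \<Rightarrow> complex"
    using that by (simp_all add: Bochner_Integration.integral_sum Bochner_Integration.integrable_sum)
  show ?thesis
    unfolding eq
    by (subst Bochner_Integration.integral_add) (simp_all only: s[OF 1] s[OF 2] add_0)
qed

text \<open>
The conditional second moment of an increment given the past, tested against \<open>U\<close>. Mixed products of the linear
and the quadratic part have mean \<open>0\<close>, and among products of two pairs of rows only the squares survive.
\<close>

lemma incr_conditional_square:
  assumes t: "1 \<le> t" and U: "U \<in> borel_measurable (gen Z (past t))" "\<And>\<omega>. cmod (U \<omega>) \<le> 1"
  shows "(LINT \<omega>|M. U \<omega> * of_real ((incr a b p t \<omega>)\<^sup>2)) =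
    of_real (a\<^sup>2 * (real p * w)) * (LINT \<omega>|M. U \<omega>) + of_real (b\<^sup>2) * (LINT \<omega>|M. U \<omega> * of_real (past_form p t \<omega>))"
proof -
  let ?T1 = "\<lambda>\<omega>. U \<omega> * of_real (a\<^sup>2 * (lin_part p t \<omega>)\<^sup>2)"
  let ?G2 = "\<lambda>e \<omega>. (2 * a * b) * past_sum e t \<omega>" and ?H2 = "\<lambda>i e \<omega>. f (Z (i, t) \<omega>) * now_prod e t \<omega>"
  let ?T2 = "\<lambda>x \<omega>. U \<omega> * of_real (?G2 (snd x) \<omega> * ?H2 (fst x) (snd x) \<omega>)"
  let ?G3 = "\<lambda>e e' \<omega>. past_sum e t \<omega> * past_sum e' t \<omega>" and ?H3 = "\<lambda>e e' \<omega>. now_prod e t \<omega> * now_prod e' t \<omega>"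
  let ?T3 = "\<lambda>x \<omega>. U \<omega> * of_real (?G3 (fst x) (snd x) \<omega> * ?H3 (fst x) (snd x) \<omega>)"
  have eq: "U \<omega> * of_real ((incr a b p t \<omega>)\<^sup>2) = ?T1 \<omega> + (\<Sum>x\<in>{1..p} \<times> pairs p. ?T2 x \<omega>) + of_real (b\<^sup>2) * (\<Sum>x\<in>pairs p \<times> pairs p. ?T3 x \<omega>)" for \<omega>
  proof -
    have "lin_part p t \<omega> * quad_part p t \<omega> = (\<Sum>i\<in>{1..p}. \<Sum>e\<in>pairs p. f (Z (i, t) \<omega>) * (past_sum e t \<omega> * now_prod e t \<omega>))"
      unfolding lin_part_def quad_part_def by (rule sum_product)
    then have "(\<Sum>x\<in>{1..p} \<times> pairs p. ?G2 (snd x) \<omega> * ?H2 (fst x) (snd x) \<omega>) = 2 * a * b * (lin_part p t \<omega> * quad_part p t \<omega>)"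
      by (simp only: sum_distrib_left sum.cartesian_product) (auto intro!: sum.cong)
    moreover have "(\<Sum>x\<in>{1..p} \<times> pairs p. ?T2 x \<omega>) = U \<omega> * of_real (\<Sum>x\<in>{1..p} \<times> pairs p. ?G2 (snd x) \<omega> * ?H2 (fst x) (snd x) \<omega>)"
      by (simp only: of_real_sum sum_distrib_left)
    moreover have "quad_part p t \<omega> * quad_part p t \<omega> = (\<Sum>e\<in>pairs p. \<Sum>e'\<in>pairs p. (past_sum e t \<omega> * now_prod e t \<omega>) * (past_sum e' t \<omega> * now_prod e' t \<omega>))"
      unfolding quad_part_def by (rule sum_product)
    then have "(\<Sum>x\<in>pairs p \<times> pairs p. ?G3 (fst x) (snd x) \<omega> * ?H3 (fst x) (snd x) \<omega>) = quad_part p t \<omega> * quad_part p t \<omega>"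
      by (simp only: sum.cartesian_product) (auto intro!: sum.cong)
    moreover have "(\<Sum>x\<in>pairs p \<times> pairs p. ?T3 x \<omega>) = U \<omega> * of_real (\<Sum>x\<in>pairs p \<times> pairs p. ?G3 (fst x) (snd x) \<omega> * ?H3 (fst x) (snd x) \<omega>)"
      by (simp only: of_real_sum sum_distrib_left)
    ultimately show ?thesis by (simp add: incr_def power2_eq_square algebra_simps)
  qed
  have gc: "(\<lambda>_. c) \<in> borel_measurable (gen Z (past t))" "integrable M (\<lambda>_. c)" for c :: real by auto
  have gL: "(\<lambda>\<omega>. (lin_part p t \<omega>)\<^sup>2) \<in> borel_measurable (gen Z (col t))"
    using lin_part_gen by (rule borel_measurable_power)
  note T1 = expectation_past_col[OF t U gc gL lin_part_sq_integrable[OF t], of "a\<^sup>2"]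
    integrable_past_col[OF t U gc gL lin_part_sq_integrable[OF t], of "a\<^sup>2"]
  have T2: "integrable M (?T2 x)" "(LINT \<omega>|M. ?T2 x \<omega>) = 0" if x: "x \<in> {1..p} \<times> pairs p" for x
  proof -
    have e: "snd x \<in> pairs p" "1 \<le> fst x" using x by auto
    have g: "?G2 (snd x) \<in> borel_measurable (gen Z (past t))" "integrable M (?G2 (snd x))"
      using past_sum_gen[OF e(1)] past_sum_integrable[OF e(1) t] by auto
    have h: "?H2 (fst x) (snd x) \<in> borel_measurable (gen Z (col t))"
      by (intro borel_measurable_times f_gen now_prod_gen[OF e(1)]) (use e in auto)
    show "integrable M (?T2 x)" "(LINT \<omega>|M. ?T2 x \<omega>) = 0"
      using integrable_past_col[OF t U g h f_now_prod_integrable[OF e t]]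
        expectation_past_col[OF t U g h f_now_prod_integrable[OF e t]] f_now_prod_mean[OF e t] by auto
  qed
  have T3: "integrable M (?T3 x)"
    "(LINT \<omega>|M. ?T3 x \<omega>) = (if fst x = snd x then (LINT \<omega>|M. U \<omega> * of_real ((past_sum (fst x) t \<omega>)\<^sup>2)) else 0)"
    if x: "x \<in> pairs p \<times> pairs p" for x
  proof -
    have e: "fst x \<in> pairs p" "snd x \<in> pairs p" using x by auto
    have g: "?G3 (fst x) (snd x) \<in> borel_measurable (gen Z (past t))"
      using past_sum_gen[OF e(1)] past_sum_gen[OF e(2)] by (intro borel_measurable_times) auto
    have h: "?H3 (fst x) (snd x) \<in> borel_measurable (gen Z (col t))"
      using now_prod_gen[OF e(1)] now_prod_gen[OF e(2)] by (intro borel_measurable_times) auto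
    note * = past_sum_mult_integrable[OF e t] now_prod_mult_integrable[OF e t]
    show "integrable M (?T3 x)" by (rule integrable_past_col[OF t U g *(1) h *(2)])
    show "(LINT \<omega>|M. ?T3 x \<omega>) = (if fst x = snd x then (LINT \<omega>|M. U \<omega> * of_real ((past_sum (fst x) t \<omega>)\<^sup>2)) else 0)"
      unfolding expectation_past_col[OF t U g *(1) h *(2)] now_prod_mult_mean[OF e t] by (auto simp: power2_eq_square)
  qed
  have s2: "integrable M (\<lambda>\<omega>. \<Sum>x\<in>{1..p} \<times> pairs p. ?T2 x \<omega>)"
    by (rule Bochner_Integration.integrable_sum) (rule T2(1))
  have "(LINT \<omega>|M. (\<Sum>x\<in>{1..p} \<times> pairs p. ?T2 x \<omega>)) = (\<Sum>x\<in>{1..p} \<times> pairs p. LINT \<omega>|M. ?T2 x \<omega>)"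
    by (rule Bochner_Integration.integral_sum) (rule T2(1))
  also have "\<dots> = 0" by (intro sum.neutral ballI) (rule T2(2))
  finally have E2: "(LINT \<omega>|M. (\<Sum>x\<in>{1..p} \<times> pairs p. ?T2 x \<omega>)) = 0" .
  have s3: "integrable M (\<lambda>\<omega>. \<Sum>x\<in>pairs p \<times> pairs p. ?T3 x \<omega>)"
    by (rule Bochner_Integration.integrable_sum) (rule T3(1))
  have pf: "integrable M (\<lambda>\<omega>. U \<omega> * of_real ((past_sum e t \<omega>)\<^sup>2))" if e: "e \<in> pairs p" for e
  proof -
    have "(\<lambda>\<omega>. (past_sum e t \<omega>)\<^sup>2) \<in> borel_measurable (gen Z (past t))" using past_sum_gen[OF e] by (rule borel_measurable_power)
    moreover have "(\<lambda>_. 1 :: real) \<in> borel_measurable (gen Z (col t))" "integrable M (\<lambda>_. 1 :: real)" by auto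
    ultimately have "integrable M (\<lambda>\<omega>. U \<omega> * of_real ((past_sum e t \<omega>)\<^sup>2 * 1))"
      by (intro integrable_past_col[OF t U] past_sum_sq_integrable[OF e])
    then show ?thesis by simp
  qed
  have "(LINT \<omega>|M. (\<Sum>x\<in>pairs p \<times> pairs p. ?T3 x \<omega>)) = (\<Sum>x\<in>pairs p \<times> pairs p. LINT \<omega>|M. ?T3 x \<omega>)"
    by (rule Bochner_Integration.integral_sum) (rule T3(1))
  also have "\<dots> = (\<Sum>e\<in>pairs p. \<Sum>e'\<in>pairs p. if e = e' then (LINT \<omega>|M. U \<omega> * of_real ((past_sum e t \<omega>)\<^sup>2)) else 0)"
    unfolding sum.cartesian_product by (rule sum.cong[OF refl]) (simp only: T3(2) case_prod_beta)
  also have "\<dots> = (\<Sum>e\<in>pairs p. LINT \<omega>|M. U \<omega> * of_real ((past_sum e t \<omega>)\<^sup>2))"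
    by simp
  also have "\<dots> = (LINT \<omega>|M. (\<Sum>e\<in>pairs p. U \<omega> * of_real ((past_sum e t \<omega>)\<^sup>2)))"
    by (rule Bochner_Integration.integral_sum[symmetric]) (rule pf)
  also have "\<dots> = (LINT \<omega>|M. U \<omega> * of_real (past_form p t \<omega>))"
    by (simp add: past_form_def sum_distrib_left)
  finally have E3: "(LINT \<omega>|M. (\<Sum>x\<in>pairs p \<times> pairs p. ?T3 x \<omega>)) = (LINT \<omega>|M. U \<omega> * of_real (past_form p t \<omega>))" .
  have E1: "(LINT \<omega>|M. ?T1 \<omega>) = of_real (a\<^sup>2 * (real p * w)) * (LINT \<omega>|M. U \<omega>)"
    unfolding T1(1) lin_part_sq_mean[OF t] by (simp add: mult_ac)
  have "(LINT \<omega>|M. U \<omega> * of_real ((incr a b p t \<omega>)\<^sup>2)) = (LINT \<omega>|M. ?T1 \<omega>) + (LINT \<omega>|M. (\<Sum>x\<in>{1..p} \<times> pairs p. ?T2 x \<omega>))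
    + of_real (b\<^sup>2) * (LINT \<omega>|M. (\<Sum>x\<in>pairs p \<times> pairs p. ?T3 x \<omega>))"
    unfolding eq using T1(2) s2 s3
    by (simp only: Bochner_Integration.integral_add integral_mult_right_zero Bochner_Integration.integrable_add integrable_mult_right)
  then show ?thesis unfolding E1 E2 E3 by simp
qed

lemma past_form_eq:
  "past_form p t \<omega> - real (card (pairs p)) * real (t - 1) =
    (real p - 1) * lin_sum p (t - 1) \<omega> + col_sum p (t - 1) \<omega> + 2 * cycle_sum p (t - 1) \<omega>"
proof -
  have "{1..<t} = {1..t - 1}" by auto
  then show ?thesis
    using off_diagonal_expansion[of "\<omega>" "t - 1" p] by (simp add: past_form_def past_sum_def case_prod_beta)
qed

lemma
  shows past_form_integrable: "integrable M (past_form p t)"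
    and past_form_mean: "(LINT \<omega>|M. past_form p t \<omega>) = real (card (pairs p)) * real (t - 1)"
proof -
  have eq: "past_form p t = (\<lambda>\<omega>. real (card (pairs p)) * real (t - 1) +
    ((real p - 1) * lin_sum p (t - 1) \<omega> + col_sum p (t - 1) \<omega> + 2 * cycle_sum p (t - 1) \<omega>))"
    using past_form_eq[of p t] by (auto simp: algebra_simps intro!: ext)
  show "integrable M (past_form p t)" "(LINT \<omega>|M. past_form p t \<omega>) = real (card (pairs p)) * real (t - 1)"
    unfolding eq using integrable_lin_sum integrable_col_sum integrable_cycle_sum
    by (simp_all add: expectation_lin_sum expectation_col_sum expectation_cycle_sum prob_space)
qed

text \<open>
The mean of the left-hand quadratic form is of order \<open>p\<^sup>2 t\<close>. The bound, weighted with \<open>b\<^sup>2 \<le> 4 / (n\<^sup>2 p\<^sup>2)\<close>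
and summed over the \<open>n\<close> columns, still tends to \<open>0\<close>.
\<close>

lemma past_form_deviation:
  assumes "1 \<le> p" "1 \<le> t" "t \<le> n"
  shows "(LINT \<omega>|M. \<bar>past_form p t \<omega> - real (card (pairs p)) * real (t - 1)\<bar>)
    \<le> real p * sqrt (real p * real n * (m4 - 1)) + real p * (m4 - 1) * sqrt (real n) + real n * real p"
proof -
  let ?k = "t - 1"
  note int = integrable_lin_sum[of p ?k] integrable_col_sum[of p ?k] integrable_cycle_sum[of p ?k]
  have "(LINT \<omega>|M. \<bar>past_form p t \<omega> - real (card (pairs p)) * real (t - 1)\<bar>)
    \<le> (LINT \<omega>|M. (real p - 1) * \<bar>lin_sum p ?k \<omega>\<bar> + \<bar>col_sum p ?k \<omega>\<bar> + 2 * \<bar>cycle_sum p ?k \<omega>\<bar>)"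
    unfolding past_form_eq
  proof (rule integral_mono)
    fix \<omega>
    show "\<bar>(real p - 1) * lin_sum p ?k \<omega> + col_sum p ?k \<omega> + 2 * cycle_sum p ?k \<omega>\<bar>
      \<le> (real p - 1) * \<bar>lin_sum p ?k \<omega>\<bar> + \<bar>col_sum p ?k \<omega>\<bar> + 2 * \<bar>cycle_sum p ?k \<omega>\<bar>"
    proof -
      have "\<bar>(real p - 1) * lin_sum p ?k \<omega>\<bar> = (real p - 1) * \<bar>lin_sum p ?k \<omega>\<bar>"
        using assms by (simp add: abs_mult)
      then show ?thesis by arith
    qed
  qed (use int in auto)
  also have "\<dots> = (real p - 1) * (LINT \<omega>|M. \<bar>lin_sum p ?k \<omega>\<bar>) + (LINT \<omega>|M. \<bar>col_sum p ?k \<omega>\<bar>) + 2 * (LINT \<omega>|M. \<bar>cycle_sum p ?k \<omega>\<bar>)"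
    using int by simp
  also have "\<dots> \<le> real p * sqrt (real p * real n * (m4 - 1)) + real p * (m4 - 1) * sqrt (real n) + real n * real p"
  proof (intro add_mono)
    have kn: "real ?k \<le> real n" using assms by simp
    have v: "0 \<le> m4 - 1" using m4_ge_1 by simp
    have "(LINT \<omega>|M. \<bar>lin_sum p ?k \<omega>\<bar>) \<le> sqrt (real p * real n * (m4 - 1))"
      by (rule expectation_abs_le_sqrt) (use integrable_lin_sum integrable_lin_sum_sq kn v in
          \<open>auto simp: expectation_lin_sum_sq intro!: mult_mono mult_right_mono mult_left_mono\<close>)
    then show "(real p - 1) * (LINT \<omega>|M. \<bar>lin_sum p ?k \<omega>\<bar>) \<le> real p * sqrt (real p * real n * (m4 - 1))"
      by (intro mult_mono) (auto intro!: integral_nonneg_AE)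
    have c: "real (card (pairs p)) \<le> (real p)\<^sup>2" using card_pairs_le[of p] zero_le_power2[of "real p"] by linarith
    have "(LINT \<omega>|M. \<bar>col_sum p ?k \<omega>\<bar>) \<le> sqrt (real n * (real p)\<^sup>2 * (m4 - 1)\<^sup>2)"
      by (rule expectation_abs_le_sqrt) (use integrable_col_sum integrable_col_sum_sq kn v c in
          \<open>auto simp: expectation_col_sum_sq intro!: mult_mono mult_right_mono\<close>)
    then show "(LINT \<omega>|M. \<bar>col_sum p ?k \<omega>\<bar>) \<le> real p * (m4 - 1) * sqrt (real n)"
      using v by (simp add: real_sqrt_mult mult_ac)
    have "(real ?k)\<^sup>2 \<le> (real n)\<^sup>2" using kn by (intro power_mono) auto
    then have c2: "real (card (pairs ?k)) \<le> (real n)\<^sup>2 / 2" using card_pairs_le[of ?k] by linarith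
    have "(LINT \<omega>|M. \<bar>cycle_sum p ?k \<omega>\<bar>) \<le> sqrt (((real p)\<^sup>2 / 2) * ((real n)\<^sup>2 / 2))"
      by (rule expectation_abs_le_sqrt) (use integrable_cycle_sum integrable_cycle_sum_sq card_pairs_le c2 in
          \<open>auto simp: expectation_cycle_sum_sq simp del: times_divide_eq_left times_divide_eq_right intro!: mult_mono\<close>)
    also have "((real p)\<^sup>2 / 2) * ((real n)\<^sup>2 / 2) = (real n * real p / 2)\<^sup>2" by (simp add: power2_eq_square)
    finally show "2 * (LINT \<omega>|M. \<bar>cycle_sum p ?k \<omega>\<bar>) \<le> real n * real p" by simp
  qed
  finally show ?thesis .
qed

lemma incr_sq_integrable: "1 \<le> t \<Longrightarrow> integrable M (\<lambda>\<omega>. (incr a b p t \<omega>)\<^sup>2)"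
  by (rule integrable_power_le[OF incr_measurable incr_fourth_integrable]) auto

lemma incr_sq_mean:
  assumes t: "1 \<le> t"
  shows "(LINT \<omega>|M. (incr a b p t \<omega>)\<^sup>2) = a\<^sup>2 * (real p * w) + b\<^sup>2 * (real (card (pairs p)) * real (t - 1))"
proof -
  have "(\<lambda>_. 1 :: complex) \<in> borel_measurable (gen Z (past t))" by simp
  from incr_conditional_square[OF t this, of a b p]
  have "complex_of_real (LINT \<omega>|M. (incr a b p t \<omega>)\<^sup>2) =
      of_real (a\<^sup>2 * (real p * w) + b\<^sup>2 * (LINT \<omega>|M. past_form p t \<omega>))"
    by (simp add: prob_space flip: of_real_power)
  then show ?thesis unfolding past_form_mean of_real_eq_iff .
qed

lemma incr_conditional_variance:
  assumes t: "1 \<le> t" and U: "U \<in> borel_measurable (gen Z (past t))" "\<And>\<omega>. cmod (U \<omega>) \<le> 1"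
  shows "cmod (LINT \<omega>|M. U \<omega> * of_real ((incr a b p t \<omega>)\<^sup>2 - (LINT \<omega>'|M. (incr a b p t \<omega>')\<^sup>2)))
    \<le> b\<^sup>2 * (LINT \<omega>|M. \<bar>past_form p t \<omega> - real (card (pairs p)) * real (t - 1)\<bar>)"
proof -
  define \<mu> where "\<mu> = real (card (pairs p)) * real (t - 1)"
  define \<tau> where "\<tau> = (LINT \<omega>'|M. (incr a b p t \<omega>')\<^sup>2)"
  have Um: "U \<in> borel_measurable M"
    by (rule gen_measurable_M[OF indep_entries _ U(1)]) auto
  have int: "integrable M (\<lambda>\<omega>. U \<omega> * of_real (g \<omega>))" if "integrable M g" for g
  proof (rule Bochner_Integration.integrable_bound[OF that])
    show "(\<lambda>\<omega>. U \<omega> * of_real (g \<omega>)) \<in> borel_measurable M"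
      using Um borel_measurable_integrable[OF that] by measurable
    show "AE \<omega> in M. cmod (U \<omega> * of_real (g \<omega>)) \<le> norm (g \<omega>)"
      using mult_right_mono[OF U(2) abs_ge_zero[of "g _"]] by (intro AE_I2) (simp add: norm_mult)
  qed
  have iU: "integrable M U" using int[of "\<lambda>_. 1"] by simp
  have "(LINT \<omega>|M. U \<omega> * of_real ((incr a b p t \<omega>)\<^sup>2 - \<tau>)) =
    (LINT \<omega>|M. U \<omega> * of_real ((incr a b p t \<omega>)\<^sup>2) - U \<omega> * of_real \<tau>)"
    by (simp add: algebra_simps)
  also have "\<dots> = (LINT \<omega>|M. U \<omega> * of_real ((incr a b p t \<omega>)\<^sup>2)) - (LINT \<omega>|M. U \<omega>) * of_real \<tau>"
    by (subst Bochner_Integration.integral_diff[OF int[OF incr_sq_integrable[OF t]] int]) (auto simp: iU)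
  also have "\<dots> = of_real (b\<^sup>2) * ((LINT \<omega>|M. U \<omega> * of_real (past_form p t \<omega>)) - (LINT \<omega>|M. U \<omega>) * of_real \<mu>)"
    unfolding incr_conditional_square[OF t U] \<tau>_def incr_sq_mean[OF t] \<mu>_def by (simp add: algebra_simps)
  also have "(LINT \<omega>|M. U \<omega> * of_real (past_form p t \<omega>)) - (LINT \<omega>|M. U \<omega>) * of_real \<mu> =
    (LINT \<omega>|M. U \<omega> * of_real (past_form p t \<omega>) - U \<omega> * of_real \<mu>)"
    by (subst Bochner_Integration.integral_diff[OF int[OF past_form_integrable] int]) (auto simp: iU)
  also have "\<dots> = (LINT \<omega>|M. U \<omega> * of_real (past_form p t \<omega> - \<mu>))" by (simp add: algebra_simps)
  finally have eq: "(LINT \<omega>|M. U \<omega> * of_real ((incr a b p t \<omega>)\<^sup>2 - \<tau>)) =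
    of_real (b\<^sup>2) * (LINT \<omega>|M. U \<omega> * of_real (past_form p t \<omega> - \<mu>))" .
  have ip: "integrable M (\<lambda>\<omega>. past_form p t \<omega> - \<mu>)" using past_form_integrable by auto
  have "cmod (LINT \<omega>|M. U \<omega> * of_real (past_form p t \<omega> - \<mu>)) \<le> (LINT \<omega>|M. cmod (U \<omega> * of_real (past_form p t \<omega> - \<mu>)))"
    by (rule integral_norm_bound)
  also have "\<dots> \<le> (LINT \<omega>|M. \<bar>past_form p t \<omega> - \<mu>\<bar>)"
  proof (rule integral_mono[OF integrable_norm[OF int[OF ip]] integrable_abs[OF ip]])
    fix \<omega>
    show "cmod (U \<omega> * of_real (past_form p t \<omega> - \<mu>)) \<le> \<bar>past_form p t \<omega> - \<mu>\<bar>"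
      using mult_right_mono[OF U(2) abs_ge_zero[of "past_form p t \<omega> - \<mu>"]] by (simp add: norm_mult del: of_real_diff)
  qed
  finally show ?thesis unfolding \<tau>_def[symmetric] eq \<mu>_def[symmetric] norm_mult norm_of_real
    by (intro mult_mono) auto
qed

text \<open>
The martingale bound with the moments of the increments inserted: \<open>\<tau>\<close> is the variance of the sum, \<open>\<kappa>\<close> bounds the
sum of the fourth moments, and \<open>\<delta>\<close> bounds the total fluctuation of the conditional variances.
\<close>

theorem char_function_bound:
  fixes a b \<theta> \<epsilon> :: real and n p :: nat
  assumes p: "1 \<le> p" and \<epsilon>: "0 < \<epsilon>"
  defines "\<tau> \<equiv> a\<^sup>2 * (real n * real p * w) + b\<^sup>2 * (real (card (pairs p)) * real (card (pairs n)))"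
    and "\<kappa> \<equiv> real n * (8 * (a ^ 4 * (3 * (real p)\<^sup>2 * (B\<^sup>2 * w)) + b ^ 4 * ((m4 + 4) ^ 8 * (real (card (pairs p)) * real n)\<^sup>2)))"
    and "\<delta> \<equiv> real n * (b\<^sup>2 * (real p * sqrt (real p * real n * (m4 - 1)) + real p * (m4 - 1) * sqrt (real n) + real n * real p))"
  shows "cmod ((LINT \<omega>|M. iexp (\<theta> * (a * (\<Sum>c\<in>{1..p} \<times> {1..n}. f (Z c \<omega>)) + b * cycle_sum p n \<omega>))) - of_real (exp (- (\<theta>\<^sup>2 / 2 * \<tau>))))
    \<le> \<bar>\<theta>\<bar> ^ 3 / 12 * (\<epsilon> * \<tau> + \<kappa> / \<epsilon>) + \<theta>\<^sup>2 / 2 * \<delta> + \<theta> ^ 4 / 8 * \<kappa>"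
proof -
  define dev where "dev = real p * sqrt (real p * real n * (m4 - 1)) + real p * (m4 - 1) * sqrt (real n) + real n * real p"
  let ?D = "incr a b p"
  have U: "(\<lambda>\<omega>. iexp (\<theta> * (\<Sum>s\<in>{1..<t}. ?D s \<omega>))) \<in> borel_measurable (gen Z (past t))" for t
  proof -
    have "(\<lambda>\<omega>. \<Sum>s\<in>{1..<t}. ?D s \<omega>) \<in> borel_measurable (gen Z (past t))"
      by (rule borel_measurable_sum) (rule incr_gen, auto)
    then show ?thesis by measurable
  qed
  have U1: "cmod (iexp (\<theta> * (\<Sum>s\<in>{1..<t}. ?D s \<omega>))) \<le> 1" for t \<omega> by simp
  have "cmod ((LINT \<omega>|M. iexp (\<theta> * (\<Sum>t\<in>{1..n}. ?D t \<omega>))) - of_real (exp (- (\<theta>\<^sup>2 / 2 * (\<Sum>t\<in>{1..n}. LINT \<omega>|M. ?D t \<omega> ^ 2)))))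
    \<le> (\<Sum>t\<in>{1..n}. \<bar>\<theta>\<bar> ^ 3 / 12 * (\<epsilon> * (LINT \<omega>|M. ?D t \<omega> ^ 2) + (LINT \<omega>|M. ?D t \<omega> ^ 4) / \<epsilon>)
          + \<theta>\<^sup>2 / 2 * (b\<^sup>2 * dev) + \<theta> ^ 4 / 8 * (LINT \<omega>|M. ?D t \<omega> ^ 4))"
  proof (rule char_function_martingale_bound[OF _ _ _ _ \<epsilon>])
    fix t assume t: "t \<in> {1..n}"
    then have t1: "1 \<le> t" by simp
    show "?D t \<in> borel_measurable M" by (rule incr_measurable[OF t1])
    show "integrable M (\<lambda>\<omega>. ?D t \<omega> ^ 4)" by (rule incr_fourth_integrable[OF t1])
    show "(LINT \<omega>|M. iexp (\<theta> * (\<Sum>s\<in>{1..<t}. ?D s \<omega>)) * of_real (?D t \<omega>)) = 0"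
      by (rule incr_centred[OF t1 U U1])
    show "cmod (LINT \<omega>|M. iexp (\<theta> * (\<Sum>s\<in>{1..<t}. ?D s \<omega>)) * of_real (?D t \<omega> ^ 2 - (LINT \<omega>'|M. ?D t \<omega>' ^ 2))) \<le> b\<^sup>2 * dev"
      by (rule order_trans[OF incr_conditional_variance[OF t1 U U1]])
        (use past_form_deviation[OF p t1, of n] t in \<open>auto simp: dev_def intro!: mult_left_mono\<close>)
  qed
  also have "\<dots> = \<bar>\<theta>\<bar> ^ 3 / 12 * (\<epsilon> * (\<Sum>t\<in>{1..n}. LINT \<omega>|M. ?D t \<omega> ^ 2) + (\<Sum>t\<in>{1..n}. LINT \<omega>|M. ?D t \<omega> ^ 4) / \<epsilon>)
     + \<theta>\<^sup>2 / 2 * (real n * (b\<^sup>2 * dev)) + \<theta> ^ 4 / 8 * (\<Sum>t\<in>{1..n}. LINT \<omega>|M. ?D t \<omega> ^ 4)"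
    by (simp only: sum.distrib sum_distrib_left[symmetric] sum_divide_distrib[symmetric] sum_constant card_atLeastAtMost)
      (simp add: algebra_simps)
  also have "\<dots> \<le> \<bar>\<theta>\<bar> ^ 3 / 12 * (\<epsilon> * (\<Sum>t\<in>{1..n}. LINT \<omega>|M. ?D t \<omega> ^ 2) + \<kappa> / \<epsilon>) + \<theta>\<^sup>2 / 2 * (real n * (b\<^sup>2 * dev)) + \<theta> ^ 4 / 8 * \<kappa>"
  proof -
    have "(LINT \<omega>|M. ?D t \<omega> ^ 4) \<le> 8 * (a ^ 4 * (3 * (real p)\<^sup>2 * (B\<^sup>2 * w)) + b ^ 4 * ((m4 + 4) ^ 8 * (real (card (pairs p)) * real n)\<^sup>2))"
      if "t \<in> {1..n}" for t
      by (rule order_trans[OF incr_fourth]) (use that m4_ge_1 in \<open>auto intro!: mult_left_mono power_mono\<close>)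
    from sum_bounded_above[of "{1..n}", OF this] have "(\<Sum>t\<in>{1..n}. LINT \<omega>|M. ?D t \<omega> ^ 4) \<le> \<kappa>"
      unfolding \<kappa>_def by simp
    then show ?thesis using \<epsilon> by (intro add_mono mult_left_mono divide_right_mono order_refl) auto
  qed
  also have "(\<Sum>t\<in>{1..n}. LINT \<omega>|M. ?D t \<omega> ^ 2) = \<tau>"
  proof -
    have "real (card (pairs n)) = (\<Sum>t\<in>{1..n}. real (t - 1))" using sum_pairs[of "\<lambda>_ _. 1 :: real" n] by simp
    moreover have "(\<Sum>t\<in>{1..n}. LINT \<omega>|M. ?D t \<omega> ^ 2) = (\<Sum>t\<in>{1..n}. a\<^sup>2 * (real p * w) + b\<^sup>2 * (real (card (pairs p)) * real (t - 1)))"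
      by (intro sum.cong refl incr_sq_mean) auto
    ultimately show ?thesis
      by (simp only: \<tau>_def sum.distrib sum_distrib_left[symmetric] sum_constant card_atLeastAtMost) simp
  qed
  finally show ?thesis unfolding sum_incr \<delta>_def dev_def .
qed

end

section \<open>Normalisation and truncation\<close>

text \<open>
Here \<open>S\<close> is the variance \<open>\<sigma>\<^sup>2\<close>, \<open>v\<close> is the variance of \<open>X\<^sup>2\<close>, and \<open>w\<close> is the variance after truncation, which
differs from \<open>v\<close> by at most \<open>2 \<eta>\<close>. The variance splits as \<open>S = 4 v p (n + p)\<^sup>2 / n\<^sup>3 + 4 p\<^sup>2 / n\<^sup>2\<close>, and the two parts
dominate the linear sum and the cycles separately. If \<open>v = 0\<close>, then \<open>w = \<eta> = 0\<close> and \<open>\<eta> / v = 0\<close>, so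
the bounds hold in the degenerate case as well.
\<close>

lemma
  fixes n p v w \<eta> :: real
  assumes n: "1 \<le> n" and p: "1 \<le> p" and v: "0 \<le> v"
  defines "S \<equiv> (p / n + 2 * (p\<^sup>2 / n\<^sup>2) + p ^ 3 / n ^ 3) * (4 * v) + 4 * (p\<^sup>2 / n\<^sup>2)"
  defines "a \<equiv> 2 * (n + p - 2) / (n\<^sup>2 * sqrt S)" and "b \<equiv> 4 / (n\<^sup>2 * sqrt S)"
  shows normalisation_lower: "2 * p * n \<le> n\<^sup>2 * sqrt S"
    and normalisation_lin: "a\<^sup>2 * (n * p * v) \<le> 1"
    and normalisation_cycle: "b\<^sup>2 \<le> 4 / (n\<^sup>2 * p\<^sup>2)"
    and normalisation_total: "0 \<le> \<eta> \<Longrightarrow> v - 2 * \<eta> \<le> w \<Longrightarrow> w \<le> v \<Longrightarrow> \<eta> \<le> v \<Longrightarrow> 0 \<le> w \<Longrightarrow>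
       1 - (a\<^sup>2 * (n * p * w) + b\<^sup>2 * (p * (p - 1) / 2 * (n * (n - 1) / 2))) \<in> {0..2 * \<eta> / v + 5 * (1 / n + 1 / p)}"
proof -
  define S1 where "S1 = 4 * v * p * (n + p)\<^sup>2 / n ^ 3"
  define S2 where "S2 = 4 * p\<^sup>2 / n\<^sup>2"
  have S: "S = S1 + S2"
    using n by (simp add: S_def S1_def S2_def field_simps power2_eq_square power3_eq_cube)
  have S1: "0 \<le> S1" and S2: "0 < S2" using n p v by (auto simp: S1_def S2_def)
  then have Spos: "0 < S" by (simp add: S)
  have "(2 * p / n)\<^sup>2 \<le> S" using S1 by (simp add: S S2_def power2_eq_square)
  then have "2 * p / n \<le> sqrt S" by (rule real_le_rsqrt)
  then have "n\<^sup>2 * (2 * p / n) \<le> n\<^sup>2 * sqrt S" by (intro mult_left_mono) auto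
  then show "2 * p * n \<le> n\<^sup>2 * sqrt S" using n by (simp add: power2_eq_square)
  have a2: "a\<^sup>2 = 4 * (n + p - 2)\<^sup>2 / (n ^ 4 * S)"
    unfolding a_def power_divide power_mult_distrib using Spos by simp
  have b2: "b\<^sup>2 = 16 / (n ^ 4 * S)"
    unfolding b_def power_divide power_mult_distrib using Spos by simp
  have np: "(n + p - 2)\<^sup>2 \<le> (n + p)\<^sup>2" using n p by (intro power_mono) auto
  have "a\<^sup>2 * (n * p * v) = (4 * v * p * (n + p - 2)\<^sup>2 / n ^ 3) / S"
    unfolding a2 using n Spos by (simp add: field_simps power4_eq_xxxx power3_eq_cube)
  also have "\<dots> \<le> S1 / S"
    unfolding S1_def using np n p v Spos by (intro divide_right_mono mult_left_mono) auto
  also have "\<dots> \<le> 1" using Spos S2 by (simp add: S)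
  finally show "a\<^sup>2 * (n * p * v) \<le> 1" .
  have "n ^ 4 * S2 \<le> n ^ 4 * S" using S1 by (intro mult_left_mono) (auto simp: S)
  moreover have "n ^ 4 * S2 = 4 * (n\<^sup>2 * p\<^sup>2)" using n by (simp add: S2_def field_simps power4_eq_xxxx power2_eq_square)
  ultimately have "16 / (n ^ 4 * S) \<le> 16 / (4 * (n\<^sup>2 * p\<^sup>2))" using n p by (intro frac_le) auto
  then show "b\<^sup>2 \<le> 4 / (n\<^sup>2 * p\<^sup>2)" unfolding b2 by simp
  assume \<eta>: "0 \<le> \<eta>" "v - 2 * \<eta> \<le> w" "w \<le> v" "\<eta> \<le> v" "0 \<le> w"
  define A where "A = 4 * p / n ^ 3 * (v * (n + p)\<^sup>2 - w * (n + p - 2)\<^sup>2)"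
  define C where "C = 4 * p * (p + n - 1) / n ^ 3"
  define R where "R = 4 * p / n ^ 3 * (w * (n + p - 2)\<^sup>2) + 4 * p * (p - 1) * (n - 1) / n ^ 3"
  have "a\<^sup>2 * (n * p * w) + b\<^sup>2 * (p * (p - 1) / 2 * (n * (n - 1) / 2)) = R / S"
    unfolding a2 b2 R_def using n Spos by (simp add: field_simps power4_eq_xxxx power3_eq_cube)
  moreover have "S - R = A + C"
    unfolding S S1_def S2_def A_def C_def R_def using n by (simp add: field_simps power2_eq_square power3_eq_cube)
  moreover have "1 - R / S = (S - R) / S" using Spos by (simp add: diff_divide_distrib)
  ultimately have eq: "1 - (a\<^sup>2 * (n * p * w) + b\<^sup>2 * (p * (p - 1) / 2 * (n * (n - 1) / 2))) = A / S + C / S"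
    by (simp add: add_divide_distrib)
  have "w * (n + p - 2)\<^sup>2 \<le> v * (n + p)\<^sup>2" using np \<eta> v by (intro mult_mono) auto
  then have A0: "0 \<le> A" unfolding A_def using n p by (intro mult_nonneg_nonneg) auto
  have C0: "0 \<le> C" unfolding C_def using n p by (intro divide_nonneg_nonneg mult_nonneg_nonneg) auto
  have AS: "A / S \<le> 2 * \<eta> / v + 4 / (n + p)"
  proof (cases "v = 0")
    case True
    then have "A = 0" using \<eta> by (simp add: A_def)
    then show ?thesis using True n p by simp
  next
    case False
    then have v0: "0 < v" using v by simp
    have "v * (n + p)\<^sup>2 - w * (n + p - 2)\<^sup>2 \<le> v * (n + p)\<^sup>2 - (v - 2 * \<eta>) * (n + p - 2)\<^sup>2"
      using \<eta>(2) by (intro diff_left_mono mult_right_mono) auto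
    also have "\<dots> = v * ((n + p)\<^sup>2 - (n + p - 2)\<^sup>2) + 2 * \<eta> * (n + p - 2)\<^sup>2" by (simp add: algebra_simps)
    also have "\<dots> \<le> v * (4 * (n + p)) + 2 * \<eta> * (n + p)\<^sup>2"
      using np v \<eta> by (intro add_mono mult_left_mono) (auto simp: power2_eq_square algebra_simps)
    also have "\<dots> = (v * (n + p)\<^sup>2) * (2 * \<eta> / v + 4 / (n + p))"
    proof -
      have "v * (4 * m) + 2 * \<eta> * m\<^sup>2 = (v * m\<^sup>2) * (2 * \<eta> / v + 4 / m)" if "0 < m" for m
        using v0 that by (simp add: field_simps power2_eq_square)
      from this[of "n + p"] show ?thesis using n p by simp
    qed
    finally have "A \<le> 4 * p / n ^ 3 * ((v * (n + p)\<^sup>2) * (2 * \<eta> / v + 4 / (n + p)))"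
      unfolding A_def using n p by (intro mult_left_mono) auto
    also have "\<dots> = S1 * (2 * \<eta> / v + 4 / (n + p))" by (simp add: S1_def)
    also have "\<dots> \<le> S * (2 * \<eta> / v + 4 / (n + p))"
      using S2 v0 \<eta> n p by (intro mult_right_mono) (auto simp: S)
    finally show ?thesis using Spos by (simp add: divide_le_eq mult.commute)
  qed
  have CS: "C / S \<le> 1 / n + 1 / p"
  proof -
    have "C \<le> S2 * (1 / n + 1 / p)"
      unfolding C_def S2_def using n p by (simp add: field_simps power2_eq_square power3_eq_cube)
    also have "\<dots> \<le> S * (1 / n + 1 / p)" using S1 n p by (intro mult_right_mono) (auto simp: S)
    finally show ?thesis using Spos by (simp add: divide_le_eq mult.commute)
  qed
  have "4 / (n + p) \<le> 4 / n" using n p by (intro divide_left_mono) auto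
  also have "4 / n \<le> 4 * (1 / n + 1 / p)" using n p by simp
  finally have "A / S + C / S \<le> 2 * \<eta> / v + 5 * (1 / n + 1 / p)" using AS CS by argo
  moreover have "0 \<le> A / S + C / S" using A0 C0 Spos by simp
  ultimately show "1 - (a\<^sup>2 * (n * p * w) + b\<^sup>2 * (p * (p - 1) / 2 * (n * (n - 1) / 2))) \<in> {0..2 * \<eta> / v + 5 * (1 / n + 1 / p)}"
    unfolding eq by simp
qed

context iid_array
begin

lemma expectation_abs_sum_entries:
  fixes g :: "real \<Rightarrow> real"
  assumes g: "g \<in> borel_measurable borel" and int: "integrable M (\<lambda>\<omega>. g (\<xi> \<omega>) ^ 2)"
    and "(LINT \<omega>|M. g (\<xi> \<omega>)) = 0" and s: "(LINT \<omega>|M. g (\<xi> \<omega>) ^ 2) \<le> s"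
  shows "integrable M (\<lambda>\<omega>. \<Sum>c\<in>{1..p} \<times> {1..n}. g (Z c \<omega>))"
    and "(LINT \<omega>|M. \<bar>\<Sum>c\<in>{1..p} \<times> {1..n}. g (Z c \<omega>)\<bar>) \<le> sqrt (real p * real n * s)"
proof -
  interpret G: indep_centred M "\<lambda>c \<omega>. g (Z c \<omega>)" entries "LINT \<omega>|M. g (\<xi> \<omega>) ^ 2"
    by (rule indep_centred_entry_function[OF assms(1-3)])
  have eq: "(\<Sum>c\<in>{1..p} \<times> {1..n}. g (Z c \<omega>)) = (\<Sum>c\<in>{1..p} \<times> {1..n}. 1 * (\<Prod>c'\<in>{c}. g (Z c' \<omega>)))" for \<omega> by simp
  have sub: "{c} \<subseteq> entries \<and> finite {c} \<and> card {c} = 1" "{c} \<subseteq> entries \<and> finite {c} \<and> {c} \<noteq> {}"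
    if "c \<in> {1..p} \<times> {1..n}" for c using that by auto
  have inj: "inj_on (\<lambda>c. {c}) ({1..p} \<times> {1..n})" by (simp add: inj_on_def)
  show i: "integrable M (\<lambda>\<omega>. \<Sum>c\<in>{1..p} \<times> {1..n}. g (Z c \<omega>))"
    unfolding eq by (rule G.integrable_multilinear[OF sub(2)])
  show "(LINT \<omega>|M. \<bar>\<Sum>c\<in>{1..p} \<times> {1..n}. g (Z c \<omega>)\<bar>) \<le> sqrt (real p * real n * s)"
  proof (rule expectation_abs_le_sqrt)
    show "(\<lambda>\<omega>. \<Sum>c\<in>{1..p} \<times> {1..n}. g (Z c \<omega>)) \<in> borel_measurable M" using i by auto
    show "integrable M (\<lambda>\<omega>. (\<Sum>c\<in>{1..p} \<times> {1..n}. g (Z c \<omega>))\<^sup>2)"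
      unfolding eq by (rule G.integrable_multilinear_sq[OF _ inj sub(1)]) auto
    have "(LINT \<omega>|M. (\<Sum>c\<in>{1..p} \<times> {1..n}. g (Z c \<omega>))\<^sup>2) = real p * real n * (LINT \<omega>|M. g (\<xi> \<omega>) ^ 2)"
      unfolding eq by (subst G.expectation_multilinear_sq[OF _ inj sub(1)]) auto
    also have "\<dots> \<le> real p * real n * s" using s by (intro mult_left_mono) auto
    finally show "(LINT \<omega>|M. (\<Sum>c\<in>{1..p} \<times> {1..n}. g (Z c \<omega>))\<^sup>2) \<le> real p * real n * s" .
  qed
qed

text \<open>
Truncating \<open>x\<^sup>2 - 1\<close> rather than \<open>x\<close> keeps the variance below \<open>E[X\<^sup>4] - 1\<close>; in particular the truncated variable
is degenerate if \<open>X\<^sup>2\<close> is.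
\<close>

definition cut :: "real \<Rightarrow> real \<Rightarrow> real" where
  "cut K x = (if \<bar>x\<^sup>2 - 1\<bar> \<le> K then x\<^sup>2 - 1 else 0)"

definition trunc :: "real \<Rightarrow> real \<Rightarrow> real" where
  "trunc K x = cut K x - (LINT \<omega>|M. cut K (\<xi> \<omega>))"

definition tail2 :: "real \<Rightarrow> real" where
  "tail2 K = (LINT \<omega>|M. (if \<bar>(\<xi> \<omega>)\<^sup>2 - 1\<bar> \<le> K then 0 else ((\<xi> \<omega>)\<^sup>2 - 1)\<^sup>2))"

definition tail4 :: "real \<Rightarrow> real" where
  "tail4 K = (LINT \<omega>|M. (if \<bar>(\<xi> \<omega>)\<^sup>2 - 1\<bar> \<le> K then 0 else \<xi> \<omega> ^ 4))"

lemma cut_measurable [measurable]: "cut K \<in> borel_measurable borel"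
  unfolding cut_def[abs_def] by measurable

lemma trunc_measurable [measurable]: "trunc K \<in> borel_measurable borel"
  unfolding trunc_def[abs_def] by measurable

lemma cut_bounded: "0 \<le> K \<Longrightarrow> \<bar>cut K x\<bar> \<le> K"
  by (simp add: cut_def)

lemma cut_integrable:
  assumes "0 \<le> K" shows "integrable M (\<lambda>\<omega>. cut K (\<xi> \<omega>) ^ k)"
  using power_mono[OF cut_bounded[OF assms]]
  by (intro integrable_const_bound[where B="K ^ k"]) (auto simp: power_abs)

lemma truncated_array_trunc:
  assumes "0 \<le> K" shows "truncated_array M \<xi> Z (trunc K) (2 * K)"
proof unfold_locales
  have "\<bar>LINT \<omega>|M. cut K (\<xi> \<omega>)\<bar> \<le> (LINT \<omega>|M. K)"
    using cut_integrable[OF assms, of 1] cut_bounded[OF assms]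
    by (intro order_trans[OF integral_abs_bound integral_mono]) auto
  then show "\<bar>trunc K x\<bar> \<le> 2 * K" for x
    using cut_bounded[OF assms, of x] by (simp add: trunc_def prob_space)
  show "(LINT \<omega>|M. trunc K (\<xi> \<omega>)) = 0"
    using cut_integrable[OF assms, of 1] by (simp add: trunc_def prob_space)
qed simp

lemma tail_integrable:
  assumes "integrable M g"
  shows "integrable M (\<lambda>\<omega>. if \<bar>(\<xi> \<omega>)\<^sup>2 - 1\<bar> \<le> K then 0 else g \<omega> :: real)"
  by (rule Bochner_Integration.integrable_bound[OF assms]) (use borel_measurable_integrable[OF assms] in auto)

lemma tail2_nonneg: "0 \<le> tail2 K" unfolding tail2_def by (auto intro!: integral_nonneg_AE)
lemma tail4_nonneg: "0 \<le> tail4 K" unfolding tail4_def by (auto intro!: integral_nonneg_AE)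

lemma
  assumes K: "0 \<le> K"
  defines "c \<equiv> (LINT \<omega>|M. cut K (\<xi> \<omega>))"
  shows trunc_second_moment: "(LINT \<omega>|M. trunc K (\<xi> \<omega>) ^ 2) = m4 - 1 - tail2 K - c\<^sup>2"
    and trunc_remainder_integrable: "integrable M (\<lambda>\<omega>. ((\<xi> \<omega>)\<^sup>2 - 1 - trunc K (\<xi> \<omega>)) ^ 2)"
    and trunc_remainder_moment: "(LINT \<omega>|M. ((\<xi> \<omega>)\<^sup>2 - 1 - trunc K (\<xi> \<omega>)) ^ 2) = tail2 K - c\<^sup>2"
proof -
  let ?t = "\<lambda>\<omega>. if \<bar>(\<xi> \<omega>)\<^sup>2 - 1\<bar> \<le> K then 0 else ((\<xi> \<omega>)\<^sup>2 - 1)\<^sup>2"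
  note ints = cut_integrable[OF K, of 1] cut_integrable[OF K, of 2] \<xi>_power[of 2] Y_square_integrable
    tail_integrable[OF Y_square_integrable, of K]
  have "cut K (\<xi> \<omega>) ^ 2 = ((\<xi> \<omega>)\<^sup>2 - 1)\<^sup>2 - ?t \<omega>" for \<omega> by (simp add: cut_def)
  then have c2: "(LINT \<omega>|M. cut K (\<xi> \<omega>) ^ 2) = m4 - 1 - tail2 K"
    using ints by (simp add: Y_variance tail2_def)
  have "trunc K (\<xi> \<omega>) ^ 2 = cut K (\<xi> \<omega>) ^ 2 - 2 * c * cut K (\<xi> \<omega>) + c\<^sup>2" for \<omega>
    by (simp add: trunc_def c_def power2_eq_square algebra_simps)
  then show "(LINT \<omega>|M. trunc K (\<xi> \<omega>) ^ 2) = m4 - 1 - tail2 K - c\<^sup>2"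
    using ints c2 by (simp add: prob_space power2_eq_square flip: c_def)
  have eq: "((\<xi> \<omega>)\<^sup>2 - 1 - trunc K (\<xi> \<omega>)) ^ 2 = ?t \<omega> + 2 * c * ((\<xi> \<omega>)\<^sup>2 - 1 - cut K (\<xi> \<omega>)) + c\<^sup>2" for \<omega>
    by (simp add: trunc_def cut_def c_def power2_eq_square algebra_simps)
  show "integrable M (\<lambda>\<omega>. ((\<xi> \<omega>)\<^sup>2 - 1 - trunc K (\<xi> \<omega>)) ^ 2)"
    unfolding eq using ints by (intro Bochner_Integration.integrable_add integrable_mult_right Bochner_Integration.integrable_diff) auto
  have "(LINT \<omega>|M. ((\<xi> \<omega>)\<^sup>2 - 1 - trunc K (\<xi> \<omega>)) ^ 2) = (LINT \<omega>|M. ?t \<omega>) + 2 * c * (LINT \<omega>|M. (\<xi> \<omega>)\<^sup>2 - 1 - cut K (\<xi> \<omega>)) + c\<^sup>2"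
    unfolding eq using ints by (simp add: prob_space)
  also have "(LINT \<omega>|M. (\<xi> \<omega>)\<^sup>2 - 1 - cut K (\<xi> \<omega>)) = - c"
    using ints by (simp add: prob_space \<xi>_var c_def)
  finally show "(LINT \<omega>|M. ((\<xi> \<omega>)\<^sup>2 - 1 - trunc K (\<xi> \<omega>)) ^ 2) = tail2 K - c\<^sup>2"
    by (simp add: tail2_def power2_eq_square)
qed

lemma trunc_variance_bounds:
  assumes K: "0 \<le> K"
  shows "m4 - 1 - 2 * tail2 K \<le> (LINT \<omega>|M. trunc K (\<xi> \<omega>) ^ 2)" "(LINT \<omega>|M. trunc K (\<xi> \<omega>) ^ 2) \<le> m4 - 1"
    "tail2 K \<le> m4 - 1"
proof -
  let ?c = "LINT \<omega>|M. cut K (\<xi> \<omega>)"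
  have "0 \<le> (LINT \<omega>|M. ((\<xi> \<omega>)\<^sup>2 - 1 - trunc K (\<xi> \<omega>)) ^ 2)" by (auto intro!: integral_nonneg_AE)
  then have "?c\<^sup>2 \<le> tail2 K" unfolding trunc_remainder_moment[OF K] by simp
  then show "m4 - 1 - 2 * tail2 K \<le> (LINT \<omega>|M. trunc K (\<xi> \<omega>) ^ 2)" "(LINT \<omega>|M. trunc K (\<xi> \<omega>) ^ 2) \<le> m4 - 1"
    using tail2_nonneg[of K] zero_le_power2[of ?c] unfolding trunc_second_moment[OF K] by linarith+
  have "0 \<le> (LINT \<omega>|M. trunc K (\<xi> \<omega>) ^ 2)" by (auto intro!: integral_nonneg_AE)
  then show "tail2 K \<le> m4 - 1" using zero_le_power2[of ?c] unfolding trunc_second_moment[OF K] by linarith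
qed

lemma linear_remainder:
  assumes K: "0 \<le> K"
  shows "integrable M (\<lambda>\<omega>. lin_sum p n \<omega> - (\<Sum>c\<in>{1..p} \<times> {1..n}. trunc K (Z c \<omega>)))"
    and "(LINT \<omega>|M. \<bar>lin_sum p n \<omega> - (\<Sum>c\<in>{1..p} \<times> {1..n}. trunc K (Z c \<omega>))\<bar>) \<le> sqrt (real p * real n * tail2 K)"
proof -
  let ?g = "\<lambda>x. x\<^sup>2 - 1 - trunc K x"
  have eq: "lin_sum p n \<omega> - (\<Sum>c\<in>{1..p} \<times> {1..n}. trunc K (Z c \<omega>)) = (\<Sum>c\<in>{1..p} \<times> {1..n}. ?g (Z c \<omega>))" for \<omega>
    by (simp add: lin_sum_def sum_subtractf)
  have m: "?g \<in> borel_measurable borel" by measurable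
  have z: "(LINT \<omega>|M. ?g (\<xi> \<omega>)) = 0"
    using cut_integrable[OF K, of 1] \<xi>_power[of 2] by (simp add: trunc_def prob_space \<xi>_var)
  have s: "(LINT \<omega>|M. ?g (\<xi> \<omega>) ^ 2) \<le> tail2 K" unfolding trunc_remainder_moment[OF K] by simp
  note * = expectation_abs_sum_entries[OF m trunc_remainder_integrable[OF K] z s, of p n]
  show "integrable M (\<lambda>\<omega>. lin_sum p n \<omega> - (\<Sum>c\<in>{1..p} \<times> {1..n}. trunc K (Z c \<omega>)))"
    "(LINT \<omega>|M. \<bar>lin_sum p n \<omega> - (\<Sum>c\<in>{1..p} \<times> {1..n}. trunc K (Z c \<omega>))\<bar>) \<le> sqrt (real p * real n * tail2 K)"
    unfolding eq by (fact *)+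
qed

definition fourth_sum :: "nat \<Rightarrow> nat \<Rightarrow> 'a \<Rightarrow> real" where
  "fourth_sum p n \<omega> = (\<Sum>c\<in>{1..p} \<times> {1..n}. Z c \<omega> ^ 4 - m4)"

lemma fourth_sum_integrable: "integrable M (fourth_sum p n)"
  and fourth_sum_mean: "(LINT \<omega>|M. fourth_sum p n \<omega>) = 0"
proof -
  have c: "integrable M (\<lambda>\<omega>. Z c \<omega> ^ 4 - m4)" "(LINT \<omega>|M. Z c \<omega> ^ 4 - m4) = 0" if "c \<in> {1..p} \<times> {1..n}" for c
    using that X.fourth_integrable[of c] expectation_entry[of c "\<lambda>x. x ^ 4"] by (auto simp: m4_def prob_space)
  show "integrable M (fourth_sum p n)" unfolding fourth_sum_def[abs_def] using c by (intro Bochner_Integration.integrable_sum) auto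
  show "(LINT \<omega>|M. fourth_sum p n \<omega>) = 0" unfolding fourth_sum_def using c
    by (subst Bochner_Integration.integral_sum) (auto intro!: sum.neutral)
qed

text \<open>
A quantitative weak law of large numbers: the bounded part of the fourth powers is controlled by its variance, and the rest
by its first moment, which is small for large \<open>K\<close>.
\<close>

lemma fourth_sum_bound:
  assumes K: "0 \<le> K"
  shows "(LINT \<omega>|M. \<bar>fourth_sum p n \<omega>\<bar>) \<le> sqrt (real p * real n * (K + 1) ^ 4) + real p * real n * (2 * tail4 K)"
proof -
  define h where "h x = (if \<bar>x\<^sup>2 - 1\<bar> \<le> K then x ^ 4 else 0)" for x :: real
  define r where "r x = x ^ 4 - h x" for x :: real
  define k where "k = (LINT \<omega>|M. h (\<xi> \<omega>))"
  have [measurable]: "h \<in> borel_measurable borel" unfolding h_def[abs_def] by measurable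
  then have [measurable]: "r \<in> borel_measurable borel" unfolding r_def[abs_def] by measurable
  have hb: "0 \<le> h x" "h x \<le> (K + 1)\<^sup>2" for x
  proof -
    have "(x\<^sup>2)\<^sup>2 \<le> (K + 1)\<^sup>2" if "\<bar>x\<^sup>2 - 1\<bar> \<le> K" using that by (intro power_mono) auto
    then show "0 \<le> h x" "h x \<le> (K + 1)\<^sup>2" by (auto simp: h_def)
  qed
  have h2: "h x ^ 2 \<le> (K + 1) ^ 4" for x using power_mono[OF hb(2) hb(1), of x 2] by simp
  have ih: "integrable M (\<lambda>\<omega>. h (\<xi> \<omega>))" using hb by (intro integrable_const_bound[where B="(K + 1)\<^sup>2"]) auto
  have ih2: "integrable M (\<lambda>\<omega>. h (\<xi> \<omega>) ^ 2)" using h2 by (intro integrable_const_bound[where B="(K + 1) ^ 4"]) auto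
  have r: "r (\<xi> \<omega>) = (if \<bar>(\<xi> \<omega>)\<^sup>2 - 1\<bar> \<le> K then 0 else \<xi> \<omega> ^ 4)" for \<omega> by (simp add: r_def h_def)
  have ir: "integrable M (\<lambda>\<omega>. r (\<xi> \<omega>))" "(LINT \<omega>|M. r (\<xi> \<omega>)) = tail4 K"
    unfolding r using tail_integrable[OF \<xi>_fourth, of K] by (auto simp: tail4_def)
  have r0: "0 \<le> r x" for x by (simp add: r_def h_def)
  have k: "k = m4 - tail4 K"
  proof -
    have "(LINT \<omega>|M. r (\<xi> \<omega>)) = m4 - k" unfolding r_def using ih \<xi>_fourth by (simp add: m4_def k_def)
    then show ?thesis using ir by simp
  qed
  have eq: "fourth_sum p n \<omega> = (\<Sum>c\<in>{1..p} \<times> {1..n}. h (Z c \<omega>) - k) + (\<Sum>c\<in>{1..p} \<times> {1..n}. r (Z c \<omega>) - tail4 K)" for \<omega>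
    by (simp add: fourth_sum_def r_def k algebra_simps flip: sum.distrib)
  have sq: "(h (\<xi> \<omega>) - k)\<^sup>2 = h (\<xi> \<omega>) ^ 2 - 2 * k * h (\<xi> \<omega>) + k\<^sup>2" for \<omega> by (simp add: power2_diff)
  have m: "(\<lambda>x. h x - k) \<in> borel_measurable borel" by measurable
  have i: "integrable M (\<lambda>\<omega>. (h (\<xi> \<omega>) - k)\<^sup>2)" unfolding sq using ih ih2 by auto
  have z: "(LINT \<omega>|M. h (\<xi> \<omega>) - k) = 0" using ih by (simp add: prob_space k_def)
  have s: "(LINT \<omega>|M. (h (\<xi> \<omega>) - k)\<^sup>2) \<le> (K + 1) ^ 4"
  proof -
    have "(LINT \<omega>|M. (h (\<xi> \<omega>) - k)\<^sup>2) = (LINT \<omega>|M. h (\<xi> \<omega>) ^ 2) - k\<^sup>2"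
      unfolding sq using ih ih2 by (simp add: prob_space k_def power2_eq_square)
    also have "\<dots> \<le> (LINT \<omega>|M. h (\<xi> \<omega>) ^ 2)" by simp
    also have "\<dots> \<le> (LINT \<omega>|M. (K + 1) ^ 4)" using ih2 h2 by (intro integral_mono) auto
    finally show ?thesis by (simp add: prob_space)
  qed
  note H = expectation_abs_sum_entries[OF m i z s, of p n]
  have rc: "integrable M (\<lambda>\<omega>. r (Z c \<omega>))" "(LINT \<omega>|M. \<bar>r (Z c \<omega>) - tail4 K\<bar>) \<le> 2 * tail4 K" if "c \<in> {1..p} \<times> {1..n}" for c
  proof -
    have c: "c \<in> entries" using that by auto
    show ic: "integrable M (\<lambda>\<omega>. r (Z c \<omega>))" using integrable_entry[OF c, of r] ir by simp
    have "(LINT \<omega>|M. \<bar>r (Z c \<omega>) - tail4 K\<bar>) \<le> (LINT \<omega>|M. r (Z c \<omega>) + tail4 K)"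
      using ic r0 tail4_nonneg[of K] by (intro integral_mono) (auto simp: abs_le_iff)
    also have "\<dots> = 2 * tail4 K" using ic expectation_entry[OF c, of r] ir by (simp add: prob_space)
    finally show "(LINT \<omega>|M. \<bar>r (Z c \<omega>) - tail4 K\<bar>) \<le> 2 * tail4 K" .
  qed
  let ?R = "\<lambda>\<omega>. \<Sum>c\<in>{1..p} \<times> {1..n}. \<bar>r (Z c \<omega>) - tail4 K\<bar>"
  have iR: "integrable M ?R" using rc(1) by (intro Bochner_Integration.integrable_sum integrable_abs Bochner_Integration.integrable_diff) auto
  have ER: "(LINT \<omega>|M. ?R \<omega>) \<le> real p * real n * (2 * tail4 K)"
  proof -
    have "(LINT \<omega>|M. ?R \<omega>) = (\<Sum>c\<in>{1..p} \<times> {1..n}. LINT \<omega>|M. \<bar>r (Z c \<omega>) - tail4 K\<bar>)"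
      using rc(1) by (intro Bochner_Integration.integral_sum integrable_abs Bochner_Integration.integrable_diff) auto
    also have "\<dots> \<le> of_nat (card ({1..p} \<times> {1..n})) * (2 * tail4 K)" by (rule sum_bounded_above) (rule rc(2))
    finally show ?thesis by (simp add: mult_ac)
  qed
  have "(LINT \<omega>|M. \<bar>fourth_sum p n \<omega>\<bar>) \<le> (LINT \<omega>|M. \<bar>\<Sum>c\<in>{1..p} \<times> {1..n}. h (Z c \<omega>) - k\<bar> + ?R \<omega>)"
  proof (rule integral_mono)
    show "integrable M (\<lambda>\<omega>. \<bar>\<Sum>c\<in>{1..p} \<times> {1..n}. h (Z c \<omega>) - k\<bar> + ?R \<omega>)" using H(1) iR by auto
    show "integrable M (\<lambda>\<omega>. \<bar>fourth_sum p n \<omega>\<bar>)" using fourth_sum_integrable by auto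
    fix \<omega>
    show "\<bar>fourth_sum p n \<omega>\<bar> \<le> \<bar>\<Sum>c\<in>{1..p} \<times> {1..n}. h (Z c \<omega>) - k\<bar> + ?R \<omega>"
      unfolding eq by (intro order_trans[OF abs_triangle_ineq] add_mono order_refl sum_abs)
  qed
  also have "\<dots> = (LINT \<omega>|M. \<bar>\<Sum>c\<in>{1..p} \<times> {1..n}. h (Z c \<omega>) - k\<bar>) + (LINT \<omega>|M. ?R \<omega>)"
    using H(1) iR by (intro Bochner_Integration.integral_add) auto
  finally show ?thesis using H(2) ER by simp
qed

end

section \<open>The limit law of the normalised trace\<close>

lemma cmod_iexp_diff_le: "cmod (iexp x - iexp y) \<le> \<bar>x - y\<bar>"
proof -
  have "iexp x - iexp y = iexp y * (iexp (x - y) - 1)"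
    by (simp add: algebra_simps flip: exp_add)
  then have "cmod (iexp x - iexp y) = cmod (iexp (x - y) - 1)" by (simp add: norm_mult)
  also have "\<dots> \<le> \<bar>x - y\<bar>" using iexp_approx1[of "x - y" 0] by simp
  finally show ?thesis .
qed

lemma (in prob_space) char_function_L1_bound:
  fixes V W :: "'a \<Rightarrow> real"
  assumes [measurable]: "V \<in> borel_measurable M" "W \<in> borel_measurable M"
    and int: "integrable M (\<lambda>\<omega>. V \<omega> - W \<omega>)"
  shows "cmod ((LINT \<omega>|M. iexp (\<theta> * V \<omega>)) - (LINT \<omega>|M. iexp (\<theta> * W \<omega>))) \<le> \<bar>\<theta>\<bar> * (LINT \<omega>|M. \<bar>V \<omega> - W \<omega>\<bar>)"
proof -
  have i: "integrable M (\<lambda>\<omega>. iexp (\<theta> * g \<omega>))" if [measurable]: "g \<in> borel_measurable M" for g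
    by (intro integrable_const_bound[where B=1]) auto
  have "(LINT \<omega>|M. iexp (\<theta> * V \<omega>)) - (LINT \<omega>|M. iexp (\<theta> * W \<omega>)) = (LINT \<omega>|M. iexp (\<theta> * V \<omega>) - iexp (\<theta> * W \<omega>))"
    by (rule Bochner_Integration.integral_diff[symmetric]) (intro i assms)+
  also have "cmod \<dots> \<le> (LINT \<omega>|M. cmod (iexp (\<theta> * V \<omega>) - iexp (\<theta> * W \<omega>)))" by (rule integral_norm_bound)
  also have "\<dots> \<le> (LINT \<omega>|M. \<bar>\<theta>\<bar> * \<bar>V \<omega> - W \<omega>\<bar>)"
  proof (rule integral_mono)
    show "integrable M (\<lambda>\<omega>. cmod (iexp (\<theta> * V \<omega>) - iexp (\<theta> * W \<omega>)))"
      by (intro integrable_norm Bochner_Integration.integrable_diff i assms)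
    show "integrable M (\<lambda>\<omega>. \<bar>\<theta>\<bar> * \<bar>V \<omega> - W \<omega>\<bar>)" using int by auto
    show "cmod (iexp (\<theta> * V \<omega>) - iexp (\<theta> * W \<omega>)) \<le> \<bar>\<theta>\<bar> * \<bar>V \<omega> - W \<omega>\<bar>" for \<omega>
      using cmod_iexp_diff_le[of "\<theta> * V \<omega>" "\<theta> * W \<omega>"] by (simp add: abs_mult flip: right_diff_distrib)
  qed
  finally show ?thesis by simp
qed

lemma exp_minus_diff_le:
  fixes x y :: real
  assumes "0 \<le> x" "x \<le> y"
  shows "\<bar>exp (- x) - exp (- y)\<bar> \<le> y - x"
proof -
  have "exp (- x) - exp (- y) = exp (- x) * (1 - exp (x - y))" by (simp add: algebra_simps flip: exp_add)
  also have "\<dots> \<le> 1 * (y - x)"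
  proof (rule mult_mono)
    show "1 - exp (x - y) \<le> y - x" using exp_ge_add_one_self[of "x - y"] by linarith
  qed (use assms in auto)
  finally show ?thesis using assms by simp
qed

context iid_array
begin

lemma trace_expansion:
  assumes n: "1 \<le> n"
  shows "(real n)\<^sup>2 * tr_S_sq (\<lambda>i t. Z (i, t)) p n \<omega> =
    (\<Sum>c\<in>{1..p} \<times> {1..n}. Z c \<omega> ^ 4) + 2 * (real p * real (card (pairs n)) + (real n - 1) * lin_sum p n \<omega> + row_sum p n \<omega>)
    + 2 * (real (card (pairs p)) * real n + (real p - 1) * lin_sum p n \<omega> + col_sum p n \<omega> + 2 * cycle_sum p n \<omega>)"
proof -
  define G where "G i j = (\<Sum>t\<in>{1..n}. Z (i, t) \<omega> * Z (j, t) \<omega>)\<^sup>2" for i j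
  have sym: "G i j = G j i" for i j by (simp add: G_def mult.commute)
  have "tr_S_sq (\<lambda>i t. Z (i, t)) p n \<omega> = (\<Sum>i<p. \<Sum>j<p. G (Suc i) (Suc j) / (real n)\<^sup>2)"
    unfolding tr_S_sq_eq_Frobenius
    by (intro sum.cong refl) (simp add: sample_cov_def G_def power_divide)
  also have "\<dots> = (\<Sum>i\<in>{1..p}. \<Sum>j\<in>{1..p}. G i j) / (real n)\<^sup>2"
    by (simp add: sum.atLeast1_atMost_eq sum_divide_distrib)
  finally have "(real n)\<^sup>2 * tr_S_sq (\<lambda>i t. Z (i, t)) p n \<omega> = (\<Sum>i\<in>{1..p}. \<Sum>j\<in>{1..p}. G i j)" using n by simp
  also have "\<dots> = (\<Sum>i\<in>{1..p}. G i i) + 2 * (\<Sum>(i, j)\<in>pairs p. G i j)"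
    by (rule sum_square_pairs[OF sym])
  also have "(\<Sum>i\<in>{1..p}. G i i) = (\<Sum>i\<in>{1..p}. (\<Sum>t\<in>{1..n}. (Z (i, t) \<omega>)\<^sup>2)\<^sup>2)"
    by (simp add: G_def power2_eq_square)
  finally show ?thesis unfolding G_def off_diagonal_expansion diagonal_expansion by simp
qed

definition trace_mean :: "nat \<Rightarrow> nat \<Rightarrow> real" where
  "trace_mean p n = real p / real n * (real n + m4 - 2) + real p ^ 2 / real n"

lemma trace_decomposition:
  assumes n: "1 \<le> n"
  shows "tr_S_sq (\<lambda>i t. Z (i, t)) p n \<omega> = trace_mean p n +
    (fourth_sum p n \<omega> + 2 * (real n + real p - 2) * lin_sum p n \<omega> + 2 * row_sum p n \<omega> + 2 * col_sum p n \<omega> + 4 * cycle_sum p n \<omega>) / (real n)\<^sup>2"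
proof -
  have "(\<Sum>c\<in>{1..p} \<times> {1..n}. Z c \<omega> ^ 4) = fourth_sum p n \<omega> + real p * real n * m4"
    by (simp add: fourth_sum_def sum_subtractf)
  moreover have "(real n)\<^sup>2 * trace_mean p n = real p * real n * m4 + real p * (2 * real (card (pairs n))) + 2 * real (card (pairs p)) * real n"
    unfolding card_pairs using n by (simp add: trace_mean_def field_simps power2_eq_square)
  moreover note trace_expansion[OF n, of p \<omega>]
  ultimately have "(real n)\<^sup>2 * tr_S_sq (\<lambda>i t. Z (i, t)) p n \<omega> = (real n)\<^sup>2 * trace_mean p n +
    (fourth_sum p n \<omega> + 2 * (real n + real p - 2) * lin_sum p n \<omega> + 2 * row_sum p n \<omega> + 2 * col_sum p n \<omega> + 4 * cycle_sum p n \<omega>)"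
    by (simp add: algebra_simps)
  then show ?thesis using n by (simp add: field_simps)
qed

lemma trace_expectation:
  assumes n: "1 \<le> n"
  shows "mu_S M (\<lambda>i t. Z (i, t)) p n = trace_mean p n"
  unfolding mu_S_def trace_decomposition[OF n]
  using fourth_sum_integrable integrable_lin_sum integrable_row_sum integrable_col_sum integrable_cycle_sum
  by (simp add: fourth_sum_mean expectation_lin_sum expectation_row_sum expectation_col_sum expectation_cycle_sum prob_space)

lemma Z_stat_measurable: "Z_stat M m4 (\<lambda>i t. Z (i, t)) p n \<in> borel_measurable M"
proof -
  have "(\<lambda>\<omega>. sample_cov (\<lambda>i t. Z (i, t)) p n \<omega> $$ (i, j)) \<in> borel_measurable M" if "i < p" "j < p" for i j
    unfolding sample_cov_def using that
    by (simp, intro borel_measurable_times borel_measurable_divide borel_measurable_sum borel_measurable_const Z_measurable) auto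
  then show ?thesis
    unfolding Z_stat_def[abs_def] tr_S_sq_eq_Frobenius
    by (intro borel_measurable_divide borel_measurable_diff borel_measurable_const borel_measurable_sum borel_measurable_power) auto
qed

text \<open>
Discarding the fourth powers, the row and column sums and the truncation error of the linear sum changes the
statistic by a quantity that is small in \<open>L\<^sup>1\<close>.
\<close>

lemma Z_stat_approximation:
  assumes n: "1 \<le> n" and p: "1 \<le> p" and K: "0 \<le> K"
  defines "\<sigma> \<equiv> sqrt (sigma_sq m4 p n)"
  defines "a \<equiv> 2 * (real n + real p - 2) / ((real n)\<^sup>2 * \<sigma>)" and "b \<equiv> 4 / ((real n)\<^sup>2 * \<sigma>)"
  defines "W \<equiv> \<lambda>\<omega>. a * (\<Sum>c\<in>{1..p} \<times> {1..n}. trunc K (Z c \<omega>)) + b * cycle_sum p n \<omega>"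
  shows "integrable M (\<lambda>\<omega>. Z_stat M m4 (\<lambda>i t. Z (i, t)) p n \<omega> - W \<omega>)"
    and "(LINT \<omega>|M. \<bar>Z_stat M m4 (\<lambda>i t. Z (i, t)) p n \<omega> - W \<omega>\<bar>) \<le>
      (K + 1)\<^sup>2 / sqrt (real n) + tail4 K + (m4 - 1) / sqrt (real p) + (m4 - 1) / sqrt (real n) + sqrt (tail2 K / (m4 - 1))"
proof -
  define v where "v = m4 - 1"
  define N where "N = (real n)\<^sup>2 * \<sigma>"
  have v: "0 \<le> v" using m4_ge_1 by (simp add: v_def)
  have n1: "1 \<le> real n" and p1: "1 \<le> real p" using n p by auto
  have sig: "\<sigma> = sqrt ((real p / real n + 2 * (real p ^ 2 / real n ^ 2) + real p ^ 3 / real n ^ 3) * (4 * v) + 4 * (real p ^ 2 / real n ^ 2))"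
    by (simp add: \<sigma>_def sigma_sq_def v_def)
  have N: "2 * real p * real n \<le> N"
    using normalisation_lower[OF n1 p1 v] by (simp add: N_def sig)
  have a2: "a\<^sup>2 * (real n * real p * v) \<le> 1"
    using normalisation_lin[OF n1 p1 v] by (simp add: a_def sig)
  have Npos: "0 < N" using N n1 p1 by (auto intro: less_le_trans[of 0 "2 * real p * real n"])
  have a0: "0 \<le> a" using n1 p1 Npos unfolding a_def N_def by (intro divide_nonneg_pos) auto
  let ?E = "\<lambda>\<omega>. lin_sum p n \<omega> - (\<Sum>c\<in>{1..p} \<times> {1..n}. trunc K (Z c \<omega>))"
  have eq: "Z_stat M m4 (\<lambda>i t. Z (i, t)) p n \<omega> - W \<omega> =
    (fourth_sum p n \<omega> + 2 * row_sum p n \<omega> + 2 * col_sum p n \<omega>) / N + a * ?E \<omega>" for \<omega>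
  proof -
    have z: "Z_stat M m4 (\<lambda>i t. Z (i, t)) p n \<omega> = (fourth_sum p n \<omega> + 2 * (real n + real p - 2) * lin_sum p n \<omega> + 2 * row_sum p n \<omega> + 2 * col_sum p n \<omega> + 4 * cycle_sum p n \<omega>) / N"
      unfolding Z_stat_def trace_expectation[OF n] trace_decomposition[OF n] by (simp add: N_def \<sigma>_def)
    have ab: "a = 2 * (real n + real p - 2) / N" "b = 4 / N" by (simp_all add: a_def b_def N_def)
    show ?thesis unfolding z W_def ab using Npos by (simp add: field_simps)
  qed
  note ints = fourth_sum_integrable[of p n] integrable_row_sum[of p n] integrable_col_sum[of p n] linear_remainder(1)[OF K, of p n]
  show "integrable M (\<lambda>\<omega>. Z_stat M m4 (\<lambda>i t. Z (i, t)) p n \<omega> - W \<omega>)" unfolding eq using ints by auto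
  have "(LINT \<omega>|M. \<bar>Z_stat M m4 (\<lambda>i t. Z (i, t)) p n \<omega> - W \<omega>\<bar>) \<le>
    (LINT \<omega>|M. (\<bar>fourth_sum p n \<omega>\<bar> + 2 * \<bar>row_sum p n \<omega>\<bar> + 2 * \<bar>col_sum p n \<omega>\<bar>) / N + a * \<bar>?E \<omega>\<bar>)"
    unfolding eq
  proof (rule integral_mono)
    fix \<omega>
    have "\<bar>fourth_sum p n \<omega> + 2 * row_sum p n \<omega> + 2 * col_sum p n \<omega>\<bar> / N \<le> (\<bar>fourth_sum p n \<omega>\<bar> + 2 * \<bar>row_sum p n \<omega>\<bar> + 2 * \<bar>col_sum p n \<omega>\<bar>) / N"
      using Npos by (intro divide_right_mono) auto
    then show "\<bar>(fourth_sum p n \<omega> + 2 * row_sum p n \<omega> + 2 * col_sum p n \<omega>) / N + a * ?E \<omega>\<bar>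
      \<le> (\<bar>fourth_sum p n \<omega>\<bar> + 2 * \<bar>row_sum p n \<omega>\<bar> + 2 * \<bar>col_sum p n \<omega>\<bar>) / N + a * \<bar>?E \<omega>\<bar>"
      using abs_triangle_ineq[of "(fourth_sum p n \<omega> + 2 * row_sum p n \<omega> + 2 * col_sum p n \<omega>) / N" "a * ?E \<omega>"] a0 Npos
      by (simp add: abs_mult)
  qed (use ints in auto)
  also have "\<dots> = ((LINT \<omega>|M. \<bar>fourth_sum p n \<omega>\<bar>) + 2 * (LINT \<omega>|M. \<bar>row_sum p n \<omega>\<bar>) + 2 * (LINT \<omega>|M. \<bar>col_sum p n \<omega>\<bar>)) / N + a * (LINT \<omega>|M. \<bar>?E \<omega>\<bar>)"
    using ints by simp
  also have "\<dots> \<le> ((sqrt (real p * real n * (K + 1) ^ 4) + real p * real n * (2 * tail4 K)) + 2 * (real n * v * sqrt (real p)) + 2 * (real p * v * sqrt (real n))) / (2 * real p * real n)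
      + sqrt (tail2 K / v)"
  proof (rule add_mono)
    have crd: "real (card (pairs k)) \<le> (real k)\<^sup>2" for k using card_pairs_le[of k] zero_le_power2[of "real k"] by linarith
    have r: "(LINT \<omega>|M. \<bar>row_sum p n \<omega>\<bar>) \<le> real n * v * sqrt (real p)"
    proof -
      have "(LINT \<omega>|M. \<bar>row_sum p n \<omega>\<bar>) \<le> sqrt (real p * (real n)\<^sup>2 * v\<^sup>2)"
        by (rule expectation_abs_le_sqrt) (use integrable_row_sum integrable_row_sum_sq crd in
            \<open>auto simp: expectation_row_sum_sq v_def intro!: mult_mono mult_right_mono\<close>)
      then show ?thesis using v by (simp add: real_sqrt_mult mult_ac)
    qed
    have c: "(LINT \<omega>|M. \<bar>col_sum p n \<omega>\<bar>) \<le> real p * v * sqrt (real n)"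
    proof -
      have "(LINT \<omega>|M. \<bar>col_sum p n \<omega>\<bar>) \<le> sqrt (real n * (real p)\<^sup>2 * v\<^sup>2)"
        by (rule expectation_abs_le_sqrt) (use integrable_col_sum integrable_col_sum_sq crd in
            \<open>auto simp: expectation_col_sum_sq v_def intro!: mult_mono mult_right_mono\<close>)
      then show ?thesis using v by (simp add: real_sqrt_mult mult_ac)
    qed
    have nn: "0 \<le> (LINT \<omega>|M. \<bar>fourth_sum p n \<omega>\<bar>) + 2 * (LINT \<omega>|M. \<bar>row_sum p n \<omega>\<bar>) + 2 * (LINT \<omega>|M. \<bar>col_sum p n \<omega>\<bar>)"
      by (intro add_nonneg_nonneg mult_nonneg_nonneg integral_nonneg_AE) auto
    have bd: "(LINT \<omega>|M. \<bar>fourth_sum p n \<omega>\<bar>) + 2 * (LINT \<omega>|M. \<bar>row_sum p n \<omega>\<bar>) + 2 * (LINT \<omega>|M. \<bar>col_sum p n \<omega>\<bar>)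
      \<le> (sqrt (real p * real n * (K + 1) ^ 4) + real p * real n * (2 * tail4 K)) + 2 * (real n * v * sqrt (real p)) + 2 * (real p * v * sqrt (real n))"
      using fourth_sum_bound[OF K, of p n] r c by linarith
    show "((LINT \<omega>|M. \<bar>fourth_sum p n \<omega>\<bar>) + 2 * (LINT \<omega>|M. \<bar>row_sum p n \<omega>\<bar>) + 2 * (LINT \<omega>|M. \<bar>col_sum p n \<omega>\<bar>)) / N
      \<le> ((sqrt (real p * real n * (K + 1) ^ 4) + real p * real n * (2 * tail4 K)) + 2 * (real n * v * sqrt (real p)) + 2 * (real p * v * sqrt (real n))) / (2 * real p * real n)"
      using order_trans[OF nn bd] bd N n1 p1 by (intro frac_le) auto
    have "a * (LINT \<omega>|M. \<bar>?E \<omega>\<bar>) \<le> a * sqrt (real p * real n * tail2 K)"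
      by (intro mult_left_mono linear_remainder(2)[OF K] a0)
    also have "\<dots> = sqrt (a\<^sup>2 * (real p * real n * tail2 K))" using a0 by (simp add: real_sqrt_mult)
    also have "\<dots> \<le> sqrt (tail2 K / v)"
    proof (rule real_sqrt_le_mono, cases "v = 0")
      case True
      then have "tail2 K = 0" using trunc_variance_bounds(3)[OF K] tail2_nonneg[of K] by (simp add: v_def)
      then show "a\<^sup>2 * (real p * real n * tail2 K) \<le> tail2 K / v" by simp
    next
      case False
      with v have v0: "0 < v" by simp
      have "a\<^sup>2 * (real p * real n * tail2 K) = (a\<^sup>2 * (real n * real p * v)) * (tail2 K / v)" using v0 by simp
      also have "\<dots> \<le> 1 * (tail2 K / v)" using a2 tail2_nonneg v by (intro mult_right_mono) auto
      finally show "a\<^sup>2 * (real p * real n * tail2 K) \<le> tail2 K / v" by simp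
    qed
    finally show "a * (LINT \<omega>|M. \<bar>?E \<omega>\<bar>) \<le> sqrt (tail2 K / v)" .
  qed
  also have "((sqrt (real p * real n * (K + 1) ^ 4) + real p * real n * (2 * tail4 K)) + 2 * (real n * v * sqrt (real p)) + 2 * (real p * v * sqrt (real n))) / (2 * real p * real n)
    \<le> (K + 1)\<^sup>2 / sqrt (real n) + tail4 K + v / sqrt (real p) + v / sqrt (real n)"
  proof -
    define x y where "x = sqrt (real p)" and "y = sqrt (real n)"
    have xy: "1 \<le> x" "1 \<le> y" "real p = x\<^sup>2" "real n = y\<^sup>2" using n1 p1 by (auto simp: x_def y_def)
    have "sqrt ((K + 1) ^ 4) = (K + 1)\<^sup>2"
      by (rule real_sqrt_unique) (auto simp flip: power_mult)
    then have s: "sqrt (real p * real n * (K + 1) ^ 4) = x * y * (K + 1)\<^sup>2" by (simp add: real_sqrt_mult x_def y_def)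
    have "(x * y * (K + 1)\<^sup>2 + x\<^sup>2 * y\<^sup>2 * (2 * tail4 K) + 2 * (y\<^sup>2 * v * x) + 2 * (x\<^sup>2 * v * y)) / (2 * x\<^sup>2 * y\<^sup>2)
      = (K + 1)\<^sup>2 / y * (1 / (2 * x)) + tail4 K + v / x + v / y"
      using xy(1,2) by (simp add: field_simps power2_eq_square)
    moreover have "(K + 1)\<^sup>2 / y * (1 / (2 * x)) \<le> (K + 1)\<^sup>2 / y * 1"
      using xy(1,2) by (intro mult_left_mono) auto
    ultimately show ?thesis
      unfolding s unfolding x_def[symmetric] y_def[symmetric] unfolding xy(3,4) using xy(1,2) by simp
  qed
  finally show "(LINT \<omega>|M. \<bar>Z_stat M m4 (\<lambda>i t. Z (i, t)) p n \<omega> - W \<omega>\<bar>) \<le>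
      (K + 1)\<^sup>2 / sqrt (real n) + tail4 K + (m4 - 1) / sqrt (real p) + (m4 - 1) / sqrt (real n) + sqrt (tail2 K / (m4 - 1))"
    by (simp add: v_def)
qed

text \<open>
The three lines of the bound come from passing from the statistic to \<open>W\<close>, from \<open>W\<close> to a normal variable with the
same variance \<open>\<tau>\<close>, and from \<open>\<tau>\<close> to \<open>1\<close>.
\<close>

lemma char_function_Z_stat_bound:
  assumes n: "1 \<le> n" and p: "1 \<le> p" and K: "0 \<le> K" and \<epsilon>: "0 < \<epsilon>"
  defines "v \<equiv> m4 - 1"
  defines "\<kappa> \<equiv> 96 / v * (K\<^sup>2 / real n) + 32 * (m4 + 4) ^ 8 * (1 / real n)"
  shows "cmod ((LINT \<omega>|M. iexp (\<theta> * Z_stat M m4 (\<lambda>i t. Z (i, t)) p n \<omega>)) - of_real (exp (- (\<theta>\<^sup>2 / 2))))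
    \<le> \<bar>\<theta>\<bar> * ((K + 1)\<^sup>2 / sqrt (real n) + tail4 K + v / sqrt (real p) + v / sqrt (real n) + sqrt (tail2 K / v))
      + (\<bar>\<theta>\<bar> ^ 3 / 12 * (\<epsilon> + \<kappa> / \<epsilon>) + \<theta>\<^sup>2 / 2 * (4 * sqrt v / sqrt (real p) + 4 * v / sqrt (real n) + 4 / real p) + \<theta> ^ 4 / 8 * \<kappa>)
      + \<theta>\<^sup>2 / 2 * (2 * tail2 K / v + 5 * (1 / real n + 1 / real p))"
proof -
  interpret T: truncated_array M \<xi> Z "trunc K" "2 * K" by (rule truncated_array_trunc[OF K])
  define \<sigma> where "\<sigma> = sqrt (sigma_sq m4 p n)"
  define a b where "a = 2 * (real n + real p - 2) / ((real n)\<^sup>2 * \<sigma>)" and "b = 4 / ((real n)\<^sup>2 * \<sigma>)"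
  define W where "W \<omega> = a * (\<Sum>c\<in>{1..p} \<times> {1..n}. trunc K (Z c \<omega>)) + b * cycle_sum p n \<omega>" for \<omega>
  define P C where "P = real (card (pairs p))" and "C = real (card (pairs n))"
  define \<tau> where "\<tau> = a\<^sup>2 * (real n * real p * T.w) + b\<^sup>2 * (P * C)"
  define \<kappa>0 where "\<kappa>0 = real n * (8 * (a ^ 4 * (3 * (real p)\<^sup>2 * ((2 * K)\<^sup>2 * T.w)) + b ^ 4 * ((m4 + 4) ^ 8 * (P * real n)\<^sup>2)))"
  define \<delta>0 where "\<delta>0 = real n * (b\<^sup>2 * (real p * sqrt (real p * real n * (m4 - 1)) + real p * (m4 - 1) * sqrt (real n) + real n * real p))"
  have v: "0 \<le> v" using m4_ge_1 by (simp add: v_def)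
  have n1: "1 \<le> real n" and p1: "1 \<le> real p" using n p by auto
  have sig: "\<sigma> = sqrt ((real p / real n + 2 * (real p ^ 2 / real n ^ 2) + real p ^ 3 / real n ^ 3) * (4 * v) + 4 * (real p ^ 2 / real n ^ 2))"
    by (simp add: \<sigma>_def sigma_sq_def v_def)
  have w: "v - 2 * tail2 K \<le> T.w" "T.w \<le> v" "tail2 K \<le> v" "0 \<le> T.w" "0 \<le> tail2 K"
    using trunc_variance_bounds[OF K] T.w_nonneg tail2_nonneg[of K] unfolding T.w_def v_def by auto
  have a2: "a\<^sup>2 * (real n * real p * v) \<le> 1"
    using normalisation_lin[OF n1 p1 v] by (simp add: a_def sig)
  have b2: "b\<^sup>2 \<le> 4 / ((real n)\<^sup>2 * (real p)\<^sup>2)"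
    using normalisation_cycle[OF n1 p1 v] by (simp add: b_def sig)
  have PC: "P = real p * (real p - 1) / 2" "C = real n * (real n - 1) / 2"
    using card_pairs[of p] card_pairs[of n] by (simp_all add: P_def C_def)
  have \<tau>: "1 - \<tau> \<in> {0..2 * tail2 K / v + 5 * (1 / real n + 1 / real p)}"
    using normalisation_total[OF n1 p1 v w(5,1,2,3,4)] unfolding \<tau>_def PC a_def b_def sig .
  have \<tau>0: "0 \<le> \<tau>" unfolding \<tau>_def using w by (auto simp: P_def C_def intro!: add_nonneg_nonneg mult_nonneg_nonneg)
  have P: "P \<le> (real p)\<^sup>2 / 2" unfolding P_def by (rule card_pairs_le)
  have \<kappa>: "\<kappa>0 \<le> \<kappa>"
  proof -
    \<comment> \<open>For \<open>v = 0\<close> both sides are \<open>0\<close>, by the convention on division.\<close>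
    have 1: "(a\<^sup>2 * (real n * real p))\<^sup>2 * T.w \<le> 1 / v"
    proof (cases "v = 0")
      case True
      then show ?thesis using w by simp
    next
      case False
      with v have v0: "0 < v" by simp
      have "(a\<^sup>2 * (real n * real p))\<^sup>2 * T.w \<le> (a\<^sup>2 * (real n * real p))\<^sup>2 * v" by (intro mult_left_mono w) auto
      also have "\<dots> = (a\<^sup>2 * (real n * real p * v))\<^sup>2 / v" using v0 by (simp add: power2_eq_square)
      also have "\<dots> \<le> 1\<^sup>2 / v" using a2 v by (intro divide_right_mono power_mono) auto
      finally show ?thesis by simp
    qed
    have 2: "(b\<^sup>2 * (P * real n))\<^sup>2 \<le> (2 / real n)\<^sup>2"
    proof (rule power_mono)
      have "b\<^sup>2 * (P * real n) \<le> 4 / ((real n)\<^sup>2 * (real p)\<^sup>2) * ((real p)\<^sup>2 / 2 * real n)"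
        using b2 P by (intro mult_mono mult_right_mono) (auto simp: P_def)
      also have "\<dots> = 2 / real n" using n1 p1 by (simp add: field_simps power2_eq_square)
      finally show "b\<^sup>2 * (P * real n) \<le> 2 / real n" .
    qed (auto simp: P_def)
    have "\<kappa>0 = 96 * K\<^sup>2 / real n * ((a\<^sup>2 * (real n * real p))\<^sup>2 * T.w) + 8 * (m4 + 4) ^ 8 * real n * (b\<^sup>2 * (P * real n))\<^sup>2"
      unfolding \<kappa>0_def using n1 by (simp add: field_simps power2_eq_square power4_eq_xxxx)
    also have "\<dots> \<le> 96 * K\<^sup>2 / real n * (1 / v) + 8 * (m4 + 4) ^ 8 * real n * (2 / real n)\<^sup>2"
      using m4_ge_1 by (intro add_mono mult_left_mono 1 2) auto
    also have "\<dots> = \<kappa>" unfolding \<kappa>_def using n1 by (simp add: power2_eq_square)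
    finally show ?thesis .
  qed
  have \<delta>: "\<delta>0 \<le> 4 * sqrt v / sqrt (real p) + 4 * v / sqrt (real n) + 4 / real p"
  proof -
    define x y where "x = sqrt (real p)" and "y = sqrt (real n)"
    have xy: "1 \<le> x" "1 \<le> y" "real p = x\<^sup>2" "real n = y\<^sup>2" using n1 p1 by (auto simp: x_def y_def)
    have s: "sqrt (real p * real n * v) = x * y * sqrt v" by (simp add: real_sqrt_mult x_def y_def)
    have "\<delta>0 \<le> real n * (4 / ((real n)\<^sup>2 * (real p)\<^sup>2) * (real p * (x * y * sqrt v) + real p * v * y + real n * real p))"
      unfolding \<delta>0_def v_def[symmetric] unfolding s y_def[symmetric] using b2 v xy(1,2)
      by (intro mult_left_mono mult_right_mono add_nonneg_nonneg mult_nonneg_nonneg) auto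
    also have "\<dots> = 4 * sqrt v / x * (1 / y) + 4 * v / y * (1 / x\<^sup>2) + 4 / x\<^sup>2"
      unfolding xy(3,4) using xy(1,2) by (simp add: field_simps power2_eq_square)
    also have "\<dots> \<le> 4 * sqrt v / x * 1 + 4 * v / y * 1 + 4 / x\<^sup>2"
      using xy(1,2) v by (intro add_mono mult_left_mono order_refl) (auto simp: one_le_power)
    finally show ?thesis unfolding xy(3) unfolding x_def[symmetric] y_def[symmetric] by (simp add: xy(1) x_def)
  qed
  let ?V = "Z_stat M m4 (\<lambda>i t. Z (i, t)) p n"
  have Wm: "W \<in> borel_measurable M"
  proof -
    have t: "(\<lambda>\<omega>. trunc K (Z c \<omega>)) \<in> borel_measurable M" if "c \<in> {1..p} \<times> {1..n}" for c
      by (rule measurable_compose[OF Z_measurable trunc_measurable]) (use that in auto)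
    have "cycle_sum p n \<in> borel_measurable M" using integrable_cycle_sum by auto
    then show ?thesis unfolding W_def[abs_def]
      by (intro borel_measurable_add borel_measurable_times borel_measurable_const borel_measurable_sum t)
  qed
  note Z_stat_approximation[OF n p K, folded \<sigma>_def, folded a_def b_def, folded W_def]
  then have 1: "cmod ((LINT \<omega>|M. iexp (\<theta> * ?V \<omega>)) - (LINT \<omega>|M. iexp (\<theta> * W \<omega>))) \<le> 
     \<bar>\<theta>\<bar> * ((K + 1)\<^sup>2 / sqrt (real n) + tail4 K + v / sqrt (real p) + v / sqrt (real n) + sqrt (tail2 K / v))"
    by (intro order_trans[OF char_function_L1_bound[OF Z_stat_measurable Wm]] mult_left_mono) (auto simp: v_def)
  have "cmod ((LINT \<omega>|M. iexp (\<theta> * W \<omega>)) - of_real (exp (- (\<theta>\<^sup>2 / 2 * \<tau>)))) \<le>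
    \<bar>\<theta>\<bar> ^ 3 / 12 * (\<epsilon> * \<tau> + \<kappa>0 / \<epsilon>) + \<theta>\<^sup>2 / 2 * \<delta>0 + \<theta> ^ 4 / 8 * \<kappa>0"
    unfolding W_def \<tau>_def \<kappa>0_def \<delta>0_def P_def C_def by (rule T.char_function_bound[OF p \<epsilon>])
  also have "\<dots> \<le> \<bar>\<theta>\<bar> ^ 3 / 12 * (\<epsilon> * 1 + \<kappa> / \<epsilon>) + \<theta>\<^sup>2 / 2 * (4 * sqrt v / sqrt (real p) + 4 * v / sqrt (real n) + 4 / real p) + \<theta> ^ 4 / 8 * \<kappa>"
    using \<epsilon> \<tau> \<kappa> \<delta> by (intro add_mono mult_left_mono divide_right_mono) auto
  finally have 2: "cmod ((LINT \<omega>|M. iexp (\<theta> * W \<omega>)) - of_real (exp (- (\<theta>\<^sup>2 / 2 * \<tau>)))) \<le>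
    \<bar>\<theta>\<bar> ^ 3 / 12 * (\<epsilon> + \<kappa> / \<epsilon>) + \<theta>\<^sup>2 / 2 * (4 * sqrt v / sqrt (real p) + 4 * v / sqrt (real n) + 4 / real p) + \<theta> ^ 4 / 8 * \<kappa>"
    by simp
  have "cmod (of_real (exp (- (\<theta>\<^sup>2 / 2 * \<tau>))) - of_real (exp (- (\<theta>\<^sup>2 / 2))) :: complex) = \<bar>exp (- (\<theta>\<^sup>2 / 2 * \<tau>)) - exp (- (\<theta>\<^sup>2 / 2))\<bar>"
    by (simp only: of_real_diff[symmetric] norm_of_real)
  also have "\<dots> \<le> \<theta>\<^sup>2 / 2 - \<theta>\<^sup>2 / 2 * \<tau>"
    using \<tau>0 \<tau> mult_left_mono[of \<tau> 1 "\<theta>\<^sup>2 / 2"] by (intro exp_minus_diff_le) auto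
  also have "\<dots> = \<theta>\<^sup>2 / 2 * (1 - \<tau>)" by (simp add: algebra_simps)
  also have "\<dots> \<le> \<theta>\<^sup>2 / 2 * (2 * tail2 K / v + 5 * (1 / real n + 1 / real p))"
    using \<tau> by (intro mult_left_mono) auto
  finally have 3: "cmod (of_real (exp (- (\<theta>\<^sup>2 / 2 * \<tau>))) - of_real (exp (- (\<theta>\<^sup>2 / 2))) :: complex) \<le> \<dots>" .
  have "cmod ((LINT \<omega>|M. iexp (\<theta> * ?V \<omega>)) - of_real (exp (- (\<theta>\<^sup>2 / 2)))) \<le>
    cmod ((LINT \<omega>|M. iexp (\<theta> * ?V \<omega>)) - (LINT \<omega>|M. iexp (\<theta> * W \<omega>))) +
    cmod ((LINT \<omega>|M. iexp (\<theta> * W \<omega>)) - of_real (exp (- (\<theta>\<^sup>2 / 2 * \<tau>)))) +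
    cmod (of_real (exp (- (\<theta>\<^sup>2 / 2 * \<tau>))) - of_real (exp (- (\<theta>\<^sup>2 / 2))) :: complex)"
    by (rule norm_diff_triangle_le[OF norm_diff_triangle_le[OF order_refl order_refl] order_refl])
  then show ?thesis using 1 2 3 by linarith
qed

lemma tail_tendsto_0:
  fixes K :: "nat \<Rightarrow> real"
  assumes K: "filterlim K at_top sequentially" and g: "integrable M g"
  shows "(\<lambda>n. LINT \<omega>|M. (if \<bar>(\<xi> \<omega>)\<^sup>2 - 1\<bar> \<le> K n then 0 else g \<omega> :: real)) \<longlonglongrightarrow> 0"
proof -
  have [measurable]: "g \<in> borel_measurable M" using g by auto
  have "(\<lambda>n. LINT \<omega>|M. (if \<bar>(\<xi> \<omega>)\<^sup>2 - 1\<bar> \<le> K n then 0 else g \<omega>)) \<longlonglongrightarrow> (LINT \<omega>|M. 0)"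
  proof (rule integral_dominated_convergence[where w="\<lambda>\<omega>. \<bar>g \<omega>\<bar>"])
    show "AE \<omega> in M. (\<lambda>n. if \<bar>(\<xi> \<omega>)\<^sup>2 - 1\<bar> \<le> K n then 0 else g \<omega>) \<longlonglongrightarrow> 0"
    proof (rule AE_I2, rule tendsto_eventually)
      fix \<omega>
      have "eventually (\<lambda>n. \<bar>(\<xi> \<omega>)\<^sup>2 - 1\<bar> \<le> K n) sequentially" using K by (simp add: filterlim_at_top)
      then show "eventually (\<lambda>n. (if \<bar>(\<xi> \<omega>)\<^sup>2 - 1\<bar> \<le> K n then 0 else g \<omega>) = 0) sequentially"
        by eventually_elim simp
    qed
  qed (use g in auto)
  then show ?thesis by simp
qed

theorem Z_stat_weak_convergence:
  assumes p1: "\<And>n. 1 \<le> n \<Longrightarrow> 1 \<le> p n" and p: "filterlim p at_top sequentially"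
  shows "weak_conv_m (\<lambda>n. distr M borel (Z_stat M m4 (\<lambda>i t. Z (i, t)) (p n) n)) std_normal_distribution"
proof (rule levy_continuity)
  show "real_distribution (distr M borel (Z_stat M m4 (\<lambda>i t. Z (i, t)) (p n) n))" for n
    by (rule real_distribution_distr[OF Z_stat_measurable])
  show "real_distribution std_normal_distribution" by (rule real_dist_normal_dist)
  fix \<theta> :: real
  let ?V = "\<lambda>n. Z_stat M m4 (\<lambda>i t. Z (i, t)) (p n) n"
  define v where "v = m4 - 1"
  \<comment> \<open>The level must grow, but slowly: \<open>K\<^sup>2 / (n \<epsilon>)\<close> and \<open>(K + 1)\<^sup>2 / sqrt n\<close> have to tend to \<open>0\<close>, as well as \<open>\<epsilon>\<close>.\<close>
  define K where "K n = real n powr (1 / 8)" for n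
  define \<epsilon> where "\<epsilon> n = real n powr (- 1 / 4)" for n
  define \<kappa> where "\<kappa> n = 96 / v * ((K n)\<^sup>2 / real n) + 32 * (m4 + 4) ^ 8 * (1 / real n)" for n
  have K: "filterlim K at_top sequentially" unfolding K_def by real_asymp
  have t2: "(\<lambda>n. tail2 (K n)) \<longlonglongrightarrow> 0" unfolding tail2_def by (rule tail_tendsto_0[OF K Y_square_integrable])
  have t4: "(\<lambda>n. tail4 (K n)) \<longlonglongrightarrow> 0" unfolding tail4_def by (rule tail_tendsto_0[OF K \<xi>_fourth])
  have pr: "filterlim (\<lambda>n. real (p n)) at_top sequentially"
    by (rule filterlim_compose[OF filterlim_real_sequentially p])
  have sp: "filterlim (\<lambda>n. sqrt (real (p n))) at_top sequentially"
    by (rule filterlim_compose[OF sqrt_at_top pr])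
  have pl: "(\<lambda>n. c / sqrt (real (p n))) \<longlonglongrightarrow> 0" "(\<lambda>n. c / real (p n)) \<longlonglongrightarrow> 0" for c
    by (rule real_tendsto_divide_at_top[OF tendsto_const sp], rule real_tendsto_divide_at_top[OF tendsto_const pr])
  have nl: "(\<lambda>n. (K n + 1)\<^sup>2 / sqrt (real n)) \<longlonglongrightarrow> 0" "(\<lambda>n. c / sqrt (real n)) \<longlonglongrightarrow> 0" "(\<lambda>n. c / real n) \<longlonglongrightarrow> 0" 
    "\<epsilon> \<longlonglongrightarrow> 0" for c
    unfolding K_def \<epsilon>_def[abs_def] by real_asymp+
  have \<kappa>0: "\<kappa> \<longlonglongrightarrow> 0"
  proof -
    have "(\<lambda>n. (K n)\<^sup>2 / real n) \<longlonglongrightarrow> 0" "(\<lambda>n. 1 / real n) \<longlonglongrightarrow> 0" unfolding K_def by real_asymp+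
    from tendsto_add[OF tendsto_mult_right_zero[OF this(1), of "96 / v"] tendsto_mult_right_zero[OF this(2), of "32 * (m4 + 4) ^ 8"]]
    show ?thesis unfolding \<kappa>_def[abs_def] by simp
  qed
  have \<kappa>\<epsilon>: "(\<lambda>n. \<kappa> n / \<epsilon> n) \<longlonglongrightarrow> 0"
  proof -
    have "(\<lambda>n. (K n)\<^sup>2 / real n / \<epsilon> n) \<longlonglongrightarrow> 0" "(\<lambda>n. 1 / real n / \<epsilon> n) \<longlonglongrightarrow> 0" unfolding K_def \<epsilon>_def by real_asymp+
    from tendsto_add[OF tendsto_mult_right_zero[OF this(1), of "96 / v"] tendsto_mult_right_zero[OF this(2), of "32 * (m4 + 4) ^ 8"]]
    show ?thesis unfolding \<kappa>_def[abs_def] by (simp add: add_divide_distrib mult.assoc)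
  qed
  define bnd where "bnd n = \<bar>\<theta>\<bar> * ((K n + 1)\<^sup>2 / sqrt (real n) + tail4 (K n) + v / sqrt (real (p n)) + v / sqrt (real n) + sqrt (tail2 (K n) / v))
      + (\<bar>\<theta>\<bar> ^ 3 / 12 * (\<epsilon> n + \<kappa> n / \<epsilon> n) + \<theta>\<^sup>2 / 2 * (4 * sqrt v / sqrt (real (p n)) + 4 * v / sqrt (real n) + 4 / real (p n)) + \<theta> ^ 4 / 8 * \<kappa> n)
      + \<theta>\<^sup>2 / 2 * (2 * tail2 (K n) / v + 5 * (1 / real n + 1 / real (p n)))" for n
  have tv: "(\<lambda>n. sqrt (tail2 (K n) / v)) \<longlonglongrightarrow> 0" "(\<lambda>n. 2 * tail2 (K n) / v) \<longlonglongrightarrow> 0"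
  proof -
    have "(\<lambda>n. tail2 (K n) * (1 / v)) \<longlonglongrightarrow> 0" by (rule tendsto_mult_left_zero[OF t2])
    then show "(\<lambda>n. sqrt (tail2 (K n) / v)) \<longlonglongrightarrow> 0" using tendsto_real_sqrt by fastforce
    have "(\<lambda>n. tail2 (K n) * (2 / v)) \<longlonglongrightarrow> 0" by (rule tendsto_mult_left_zero[OF t2])
    then show "(\<lambda>n. 2 * tail2 (K n) / v) \<longlonglongrightarrow> 0" by (simp add: mult.commute)
  qed
  have "bnd \<longlonglongrightarrow> \<bar>\<theta>\<bar> * (0 + 0 + 0 + 0 + 0) + (\<bar>\<theta>\<bar> ^ 3 / 12 * (0 + 0) + \<theta>\<^sup>2 / 2 * (0 + 0 + 0) + \<theta> ^ 4 / 8 * 0) + \<theta>\<^sup>2 / 2 * (0 + 5 * (0 + 0))"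
    unfolding bnd_def[abs_def]
    by (intro tendsto_add tendsto_mult tendsto_const nl pl t4 tv \<kappa>0 \<kappa>\<epsilon>)
  then have bnd0: "bnd \<longlonglongrightarrow> 0" by simp
  have "(\<lambda>n. char (distr M borel (?V n)) \<theta>) \<longlonglongrightarrow> of_real (exp (- (\<theta>\<^sup>2 / 2)))"
  proof (rule Lim_transform_bound[of _ bnd, THEN LIM_zero_cancel])
    show "bnd \<longlonglongrightarrow> 0" by (rule bnd0)
    show "eventually (\<lambda>n. cmod (char (distr M borel (?V n)) \<theta> - of_real (exp (- (\<theta>\<^sup>2 / 2)))) \<le> norm (bnd n)) sequentially"
      using eventually_ge_at_top[of 1]
    proof eventually_elim
      case (elim n)
      have "char (distr M borel (?V n)) \<theta> = (LINT \<omega>|M. iexp (\<theta> * ?V n \<omega>))"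
        unfolding char_def by (rule integral_distr[OF Z_stat_measurable]) auto
      moreover have "0 \<le> K n" "0 < \<epsilon> n" using elim by (auto simp: K_def \<epsilon>_def)
      then have "cmod ((LINT \<omega>|M. iexp (\<theta> * ?V n \<omega>)) - of_real (exp (- (\<theta>\<^sup>2 / 2)))) \<le> bnd n"
        unfolding bnd_def \<kappa>_def v_def by (rule char_function_Z_stat_bound[OF elim p1[OF elim]])
      ultimately show ?case unfolding real_norm_def by (metis abs_ge_self order_trans)
    qed
  qed
  then show "(\<lambda>n. char (distr M borel (?V n)) \<theta>) \<longlonglongrightarrow> char std_normal_distribution \<theta>"
    by (simp add: char_std_normal_distribution)
qed

end

theorem theorem2p2:
  fixes M :: "'a measure"
    and \<xi> :: "'a \<Rightarrow> real"
    and X :: "nat \<Rightarrow> nat \<Rightarrow> 'a \<Rightarrow> real"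
    and p :: "nat \<Rightarrow> nat"
  assumes "prob_space M"
    and "\<xi> \<in> borel_measurable M"
    and "prob_space.indep_vars M (\<lambda>_. borel) (\<lambda>(i, t). X i t) ({1..} \<times> {1..})"
    and "\<And>i t. i \<ge> 1 \<Longrightarrow> t \<ge> 1 \<Longrightarrow> distr M borel (X i t) = distr M borel \<xi>"
    and "(\<integral>\<omega>. \<xi> \<omega> \<partial>M) = 0"
    and "(\<integral>\<omega>. \<xi> \<omega> ^ 2 \<partial>M) = 1"
    and "integrable M (\<lambda>\<omega>. \<xi> \<omega> ^ 4)"
    and "\<And>n. n \<ge> 1 \<Longrightarrow> p n > 0"
    and "filterlim p at_top sequentially"
  defines "m4 \<equiv> (\<integral>\<omega>. \<xi> \<omega> ^ 4 \<partial>M)"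
  shows "(\<forall>n\<ge>1. mu_S M X (p n) n =
            real (p n) / real n * (real n + m4 - 2) + real (p n) ^ 2 / real n)
       \<and> weak_conv_m (\<lambda>n. distr M borel (Z_stat M m4 X (p n) n)) std_normal_distribution"
proof -
  interpret prob_space M by fact
  interpret A: iid_array M \<xi> "\<lambda>(i, t). X i t"
    by unfold_locales (use assms in auto)
  have m4: "m4 = A.m4" by (simp add: m4_def A.m4_def)
  have "1 \<le> p n" if "1 \<le> n" for n using assms(8)[OF that] by simp
  from A.Z_stat_weak_convergence[of p, OF this assms(9)] A.trace_expectation
  show ?thesis by (simp add: m4 A.trace_mean_def)
qed

end
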